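(* In the mismatched side information problem, $\liminf_{\epsilon\to0}R^m_{lb}(\mathbf{D}+\epsilon\mathbf{1})\ge R^M(\mathbf{D})$ and $R_{ach}(\mathbf{D})\le R^M(\mathbf{D})$, where $R^M(\mathbf{D})=\min\max\{R^M_1,R^M_2\}$ with $R^M_1=I(X_1;W_1|Y_{11})+I(X_2;W_2|Y_{12})+I(X_1;U_1|Y_{11},W_1)+I(X_2;U_2|Y_{22},W_2)$, $R^M_2=I(X_1;W_1|Y_{21})+I(X_2;W_2|Y_{22})+I(X_1;U_1|Y_{11},W_1)+I(X_2;U_2|Y_{22},W_2)$, the minimum being over finite-alphabet $W_1,W_2,U_1,U_2$ such that (1) $(W_i,U_i)\leftrightarrow X_i\leftrightarrow(Y_{1i},Y_{2i})$ for $i=1,2$; (2) $(W_1,U_1,X_1,Y_{11},Y_{21})$ is independent of $(W_2,U_2,X_2,Y_{12},Y_{22})$; (3) there are functions with $\widehat X_{11}=g_{11}(W_1,U_1,Y_{11})$, $\widehat X_{12}=g_{12}(W_2,Y_{12})$, $\widehat X_{21}=g_{21}(W_1,Y_{21})$, $\widehat X_{22}=g_{22}(W_2,U_2,Y_{22})$ satisfying $E[d_{ji}(X_i,\widehat X_{ji})]\le D_{ji}$ for $i,j\in\{1,2\}$; (4) $|\mathcal{W}_i|\le|\mathcal{X}_i|+3$ and $|\mathcal{U}_i|\le|\mathcal{X}_i|(|\mathcal{X}_i|+3)+1$.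
   Context: Mismatched side information problem (finite alphabets): source $\mathbf{X}=(X_1,X_2)$, two decoders with side information $\mathbf{Y_1}=(Y_{11},Y_{12})$ and $\mathbf{Y_2}=(Y_{21},Y_{22})$, where $(X_1,Y_{11},Y_{21})$ is independent of $(X_2,Y_{12},Y_{22})$, and $X_1\leftrightarrow Y_{11}\leftrightarrow Y_{21}$, $X_2\leftrightarrow Y_{22}\leftrightarrow Y_{12}$ are Markov chains. Decoder $j\in\{1,2\}$ reconstructs $X_i$ as $\widehat X_{ji}$, $i\in\{1,2\}$, with distortion constraint $E[d_{ji}(X_i,\widehat X_{ji})]\le D_{ji}$. $\mathbf{D}$ collects the $D_{ji}$. $R^m_{lb}(\mathbf{D}+\epsilon\mathbf{1})=\sup_{\bar P}\inf_{\bar C}\bar R_{lb}-\epsilon$ where for $m=2$ decoders $\bar R_{lb}=\max_\sigma[I(\mathbf{X};V,U_{Y_{\sigma(1)}}|\mathbf{Y}_{\sigma(1)})+I(\mathbf{X};U_{Y_{\sigma(2)}}|V,U_{Y_{\sigma(1)}},\mathbf{Y_1},\mathbf{Y_2})]$ over permutations $\sigma$ of $\{1,2\}$; $\bar P$ is the set of joint distributions of $(\mathbf{X},\mathbf{Y_1},\mathbf{Y_2})$ with the given pairwise marginals $p(\mathbf{x},\mathbf{y_i})$; $\bar C$ is the set of $(V,U_{Y_1},U_{Y_2})$ with $(\mathbf{Y_1},\mathbf{Y_2})\leftrightarrow\mathbf{X}\leftrightarrow(V,U_{Y_1},U_{Y_2})$ such that decoder $j$ can meet all its distortion constraints (each increased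 by $\epsilon$) with functions of $(V,U_{Y_j},\mathbf{Y_j})$. $R_{ach}(\mathbf{D})$ is the lower convex envelope in $\mathbf{D}$ of $\min_v\inf_p\inf\sum_j R_{\mathcal{S}_j}$, where $v$ orders the nonempty subsets $\mathcal{S}$ of $\{1,2\}$, $p$ ranges over laws of finite-alphabet $(U_\mathcal{S})_\mathcal{S}$ with $(\mathbf{X},\mathbf{Y_1},\mathbf{Y_2})$ having the given law, $(U_\mathcal{S})_\mathcal{S}\leftrightarrow\mathbf{X}\leftrightarrow(\mathbf{Y_1},\mathbf{Y_2})$, and decoder $l$ meeting its constraints with functions of $(U_{\mathcal{D}_l},\mathbf{Y_l})$; and the inner infimum is over nonnegative $R_{\mathcal{S}_j},R'_{\mathcal{S}_j}$ with $R_{\mathcal{S}_j}+R'_{\mathcal{S}_j}\ge I(\mathbf{X},U^-_{\mathcal{S}_j};U_{\mathcal{S}_j})$ and $\sum_{\mathcal{S}_j\in\mathcal{D}'_l}R'_{\mathcal{S}_j}\le\sum_{\mathcal{S}_j\in\mathcal{D}'_l}H(U_{\mathcal{S}_j})-H(U_{\mathcal{D}'_l}|U_{\mathcal{D}_l\setminus\mathcal{D}'_l},\mathbf{Y_l})$ for all $l$ and nonempty $\mathcal{D}'_l\subseteq\mathcal{D}_l$, with $\mathcal{D}_l=\{\mathcal{S}:l\in\mathcal{S}\}$, $U^-_{\mathcal{S}_j}=\{U_{\mathcal{S}_i}:i<j\}$. *)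

theory Defs
  imports "HOL-Probability.Probability"
begin

text \<open>All random variables are functions of the outcome of a joint pmf M.
  Logarithms are to base 2.  All pmfs used below have finite support.\<close>

definition mis_pr :: "'o pmf \<Rightarrow> ('o \<Rightarrow> 'a) \<Rightarrow> 'a \<Rightarrow> real" where
  "mis_pr M A a = measure_pmf.prob M {\<omega>. A \<omega> = a}"

definition mis_H :: "'o pmf \<Rightarrow> ('o \<Rightarrow> 'a) \<Rightarrow> real" where
  "mis_H M A = - (\<Sum>a \<in> A ` set_pmf M. mis_pr M A a * log 2 (mis_pr M A a))"

definition mis_condH :: "'o pmf \<Rightarrow> ('o \<Rightarrow> 'a) \<Rightarrow> ('o \<Rightarrow> 'c) \<Rightarrow> real" where
  "mis_condH M A C = - (\<Sum>t \<in> (\<lambda>\<omega>. (A \<omega>, C \<omega>)) ` set_pmf M.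
      mis_pr M (\<lambda>\<omega>. (A \<omega>, C \<omega>)) t * log 2 (mis_pr M (\<lambda>\<omega>. (A \<omega>, C \<omega>)) t / mis_pr M C (snd t)))"

definition mis_I :: "'o pmf \<Rightarrow> ('o \<Rightarrow> 'a) \<Rightarrow> ('o \<Rightarrow> 'b) \<Rightarrow> ('o \<Rightarrow> 'c) \<Rightarrow> real" where
  "mis_I M A B C = (\<Sum>t \<in> (\<lambda>\<omega>. (A \<omega>, B \<omega>, C \<omega>)) ` set_pmf M.
      (case t of (a, b, c) \<Rightarrow>
        mis_pr M (\<lambda>\<omega>. (A \<omega>, B \<omega>, C \<omega>)) (a, b, c) *
        log 2 (mis_pr M (\<lambda>\<omega>. (A \<omega>, B \<omega>, C \<omega>)) (a, b, c) * mis_pr M C c /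
               (mis_pr M (\<lambda>\<omega>. (A \<omega>, C \<omega>)) (a, c) * mis_pr M (\<lambda>\<omega>. (B \<omega>, C \<omega>)) (b, c)))))"

definition mis_markov :: "'o pmf \<Rightarrow> ('o \<Rightarrow> 'a) \<Rightarrow> ('o \<Rightarrow> 'b) \<Rightarrow> ('o \<Rightarrow> 'c) \<Rightarrow> bool" where
  "mis_markov M A B C \<longleftrightarrow> (\<forall>a b c.
      mis_pr M (\<lambda>\<omega>. (A \<omega>, B \<omega>, C \<omega>)) (a, b, c) * mis_pr M B b =
      mis_pr M (\<lambda>\<omega>. (A \<omega>, B \<omega>)) (a, b) * mis_pr M (\<lambda>\<omega>. (B \<omega>, C \<omega>)) (b, c))"

definition mis_src ::
  "('x1 \<times> 'y11 \<times> 'y21) pmf \<Rightarrow> ('x2 \<times> 'y12 \<times> 'y22) pmf \<Rightarrow>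
   (('x1 \<times> 'x2) \<times> ('y11 \<times> 'y12) \<times> ('y21 \<times> 'y22)) pmf" where
  "mis_src P1 P2 = map_pmf (\<lambda>((x1, y11, y21), (x2, y12, y22)). ((x1, x2), (y11, y12), (y21, y22)))
                          (pair_pmf P1 P2)"

text \<open>Outcome: ((X1,Y11,Y21,W1,U1),(X2,Y12,Y22,W2,U2)).\<close>
definition "mX1 \<omega> = fst (fst \<omega>)"
definition "mY11 \<omega> = fst (snd (fst \<omega>))"
definition "mY21 \<omega> = fst (snd (snd (fst \<omega>)))"
definition "mW1 \<omega> = fst (snd (snd (snd (fst \<omega>))))"
definition "mU1 \<omega> = snd (snd (snd (snd (fst \<omega>))))"
definition "mX2 \<omega> = fst (snd \<omega>)"
definition "mY12 \<omega> = fst (snd (snd \<omega>))"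
definition "mY22 \<omega> = fst (snd (snd (snd \<omega>)))"
definition "mW2 \<omega> = fst (snd (snd (snd (snd \<omega>))))"
definition "mU2 \<omega> = snd (snd (snd (snd (snd \<omega>))))"

definition RM_feasible ::
  "('x1::finite \<times> 'y11 \<times> 'y21) pmf \<Rightarrow> ('x2::finite \<times> 'y12 \<times> 'y22) pmf \<Rightarrow>
   ('x1 \<Rightarrow> 'z11 \<Rightarrow> real) \<Rightarrow> ('x2 \<Rightarrow> 'z12 \<Rightarrow> real) \<Rightarrow>
   ('x1 \<Rightarrow> 'z21 \<Rightarrow> real) \<Rightarrow> ('x2 \<Rightarrow> 'z22 \<Rightarrow> real) \<Rightarrow> (nat \<Rightarrow> nat \<Rightarrow> real) \<Rightarrow>
   (('x1 \<times> 'y11 \<times> 'y21 \<times> nat \<times> nat) \<times> ('x2 \<times> 'y12 \<times> 'y22 \<times> nat \<times> nat)) pmf \<Rightarrow> bool" where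
  "RM_feasible P1 P2 d11 d12 d21 d22 D Q \<longleftrightarrow>
     map_pmf (\<lambda>(x, y, y', w, u). (x, y, y')) (map_pmf fst Q) = P1 \<and>
     map_pmf (\<lambda>(x, y, y', w, u). (x, y, y')) (map_pmf snd Q) = P2 \<and>
     \<comment> \<open>(1) Markov chains\<close>
     mis_markov Q (\<lambda>\<omega>. (mW1 \<omega>, mU1 \<omega>)) mX1 (\<lambda>\<omega>. (mY11 \<omega>, mY21 \<omega>)) \<and>
     mis_markov Q (\<lambda>\<omega>. (mW2 \<omega>, mU2 \<omega>)) mX2 (\<lambda>\<omega>. (mY12 \<omega>, mY22 \<omega>)) \<and>
     \<comment> \<open>(2) independence of the two components\<close>
     Q = pair_pmf (map_pmf fst Q) (map_pmf snd Q) \<and>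
     \<comment> \<open>(3) distortion constraints\<close>
     (\<exists>g11 :: nat \<Rightarrow> nat \<Rightarrow> 'y11 \<Rightarrow> 'z11.
        measure_pmf.expectation Q (\<lambda>\<omega>. d11 (mX1 \<omega>) (g11 (mW1 \<omega>) (mU1 \<omega>) (mY11 \<omega>))) \<le> D 1 1) \<and>
     (\<exists>g12 :: nat \<Rightarrow> 'y12 \<Rightarrow> 'z12.
        measure_pmf.expectation Q (\<lambda>\<omega>. d12 (mX2 \<omega>) (g12 (mW2 \<omega>) (mY12 \<omega>))) \<le> D 1 2) \<and>
     (\<exists>g21 :: nat \<Rightarrow> 'y21 \<Rightarrow> 'z21.
        measure_pmf.expectation Q (\<lambda>\<omega>. d21 (mX1 \<omega>) (g21 (mW1 \<omega>) (mY21 \<omega>))) \<le> D 2 1) \<and>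
     (\<exists>g22 :: nat \<Rightarrow> nat \<Rightarrow> 'y22 \<Rightarrow> 'z22.
        measure_pmf.expectation Q (\<lambda>\<omega>. d22 (mX2 \<omega>) (g22 (mW2 \<omega>) (mU2 \<omega>) (mY22 \<omega>))) \<le> D 2 2) \<and>
     \<comment> \<open>(4) cardinality bounds: alphabets are initial segments of nat\<close>
     (\<forall>\<omega> \<in> set_pmf Q.
        mW1 \<omega> < CARD('x1) + 3 \<and> mU1 \<omega> < CARD('x1) * (CARD('x1) + 3) + 1 \<and>
        mW2 \<omega> < CARD('x2) + 3 \<and> mU2 \<omega> < CARD('x2) * (CARD('x2) + 3) + 1)"

definition RM_1 :: "(('x1 \<times> 'y11 \<times> 'y21 \<times> nat \<times> nat) \<times> ('x2 \<times> 'y12 \<times> 'y22 \<times> nat \<times> nat)) pmf \<Rightarrow> real" where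
  "RM_1 Q = mis_I Q mX1 mW1 mY11 + mis_I Q mX2 mW2 mY12
          + mis_I Q mX1 mU1 (\<lambda>\<omega>. (mY11 \<omega>, mW1 \<omega>)) + mis_I Q mX2 mU2 (\<lambda>\<omega>. (mY22 \<omega>, mW2 \<omega>))"

definition RM_2 :: "(('x1 \<times> 'y11 \<times> 'y21 \<times> nat \<times> nat) \<times> ('x2 \<times> 'y12 \<times> 'y22 \<times> nat \<times> nat)) pmf \<Rightarrow> real" where
  "RM_2 Q = mis_I Q mX1 mW1 mY21 + mis_I Q mX2 mW2 mY22
          + mis_I Q mX1 mU1 (\<lambda>\<omega>. (mY11 \<omega>, mW1 \<omega>)) + mis_I Q mX2 mU2 (\<lambda>\<omega>. (mY22 \<omega>, mW2 \<omega>))"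

definition RM ::
  "('x1::finite \<times> 'y11 \<times> 'y21) pmf \<Rightarrow> ('x2::finite \<times> 'y12 \<times> 'y22) pmf \<Rightarrow>
   ('x1 \<Rightarrow> 'z11 \<Rightarrow> real) \<Rightarrow> ('x2 \<Rightarrow> 'z12 \<Rightarrow> real) \<Rightarrow>
   ('x1 \<Rightarrow> 'z21 \<Rightarrow> real) \<Rightarrow> ('x2 \<Rightarrow> 'z22 \<Rightarrow> real) \<Rightarrow> (nat \<Rightarrow> nat \<Rightarrow> real) \<Rightarrow> ereal" where
  "RM P1 P2 d11 d12 d21 d22 D =
     (INF Q \<in> {Q. RM_feasible P1 P2 d11 d12 d21 d22 D Q}. ereal (max (RM_1 Q) (RM_2 Q)))"

text \<open>Outcome: ((X, Y1, Y2), (a, b, c)) with X = (X1,X2), Y1 = (Y11,Y12), Y2 = (Y21,Y22),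
  and three nat-valued auxiliary variables.\<close>
definition "lX \<omega> = fst (fst \<omega>)"
definition "lY1 \<omega> = fst (snd (fst \<omega>))"
definition "lY2 \<omega> = snd (snd (fst \<omega>))"
definition "lA \<omega> = fst (snd \<omega>)"
definition "lB \<omega> = fst (snd (snd \<omega>))"
definition "lC \<omega> = snd (snd (snd \<omega>))"

definition Pbar ::
  "('x1 \<times> 'y11 \<times> 'y21) pmf \<Rightarrow> ('x2 \<times> 'y12 \<times> 'y22) pmf \<Rightarrow>
   (('x1 \<times> 'x2) \<times> ('y11 \<times> 'y12) \<times> ('y21 \<times> 'y22)) pmf set" where
  "Pbar P1 P2 = {Pb.
     map_pmf (\<lambda>(x, y1, y2). (x, y1)) Pb = map_pmf (\<lambda>(x, y1, y2). (x, y1)) (mis_src P1 P2) \<and>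
     map_pmf (\<lambda>(x, y1, y2). (x, y2)) Pb = map_pmf (\<lambda>(x, y1, y2). (x, y2)) (mis_src P1 P2)}"

text \<open>Cbar: V = lA, U_Y1 = lB, U_Y2 = lC; constraints relaxed to D + eps.\<close>
definition Cbar ::
  "('x1 \<Rightarrow> 'z11 \<Rightarrow> real) \<Rightarrow> ('x2 \<Rightarrow> 'z12 \<Rightarrow> real) \<Rightarrow>
   ('x1 \<Rightarrow> 'z21 \<Rightarrow> real) \<Rightarrow> ('x2 \<Rightarrow> 'z22 \<Rightarrow> real) \<Rightarrow> (nat \<Rightarrow> nat \<Rightarrow> real) \<Rightarrow> real \<Rightarrow>
   (('x1 \<times> 'x2) \<times> ('y11 \<times> 'y12) \<times> ('y21 \<times> 'y22)) pmf \<Rightarrow>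
   ((('x1 \<times> 'x2) \<times> ('y11 \<times> 'y12) \<times> ('y21 \<times> 'y22)) \<times> (nat \<times> nat \<times> nat)) pmf set" where
  "Cbar d11 d12 d21 d22 D \<epsilon> Pb = {Q.
     finite (set_pmf Q) \<and> map_pmf fst Q = Pb \<and>
     mis_markov Q (\<lambda>\<omega>. (lY1 \<omega>, lY2 \<omega>)) lX snd \<and>
     (\<exists>g11 :: nat \<Rightarrow> nat \<Rightarrow> 'y11 \<times> 'y12 \<Rightarrow> 'z11.
        measure_pmf.expectation Q (\<lambda>\<omega>. d11 (fst (lX \<omega>)) (g11 (lA \<omega>) (lB \<omega>) (lY1 \<omega>))) \<le> D 1 1 + \<epsilon>) \<and>
     (\<exists>g12 :: nat \<Rightarrow> nat \<Rightarrow> 'y11 \<times> 'y12 \<Rightarrow> 'z12.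
        measure_pmf.expectation Q (\<lambda>\<omega>. d12 (snd (lX \<omega>)) (g12 (lA \<omega>) (lB \<omega>) (lY1 \<omega>))) \<le> D 1 2 + \<epsilon>) \<and>
     (\<exists>g21 :: nat \<Rightarrow> nat \<Rightarrow> 'y21 \<times> 'y22 \<Rightarrow> 'z21.
        measure_pmf.expectation Q (\<lambda>\<omega>. d21 (fst (lX \<omega>)) (g21 (lA \<omega>) (lC \<omega>) (lY2 \<omega>))) \<le> D 2 1 + \<epsilon>) \<and>
     (\<exists>g22 :: nat \<Rightarrow> nat \<Rightarrow> 'y21 \<times> 'y22 \<Rightarrow> 'z22.
        measure_pmf.expectation Q (\<lambda>\<omega>. d22 (snd (lX \<omega>)) (g22 (lA \<omega>) (lC \<omega>) (lY2 \<omega>))) \<le> D 2 2 + \<epsilon>)}"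

text \<open>Rbar_lb: maximum over the two permutations sigma of {1,2}.\<close>
definition Rbar_lb ::
  "((('x1 \<times> 'x2) \<times> ('y11 \<times> 'y12) \<times> ('y21 \<times> 'y22)) \<times> (nat \<times> nat \<times> nat)) pmf \<Rightarrow> real" where
  "Rbar_lb Q = max
     (mis_I Q lX (\<lambda>\<omega>. (lA \<omega>, lB \<omega>)) lY1 +
      mis_I Q lX lC (\<lambda>\<omega>. (lA \<omega>, lB \<omega>, lY1 \<omega>, lY2 \<omega>)))
     (mis_I Q lX (\<lambda>\<omega>. (lA \<omega>, lC \<omega>)) lY2 +
      mis_I Q lX lB (\<lambda>\<omega>. (lA \<omega>, lC \<omega>, lY1 \<omega>, lY2 \<omega>)))"

text \<open>Rlb ... D eps  represents  R^m_lb(D + eps 1).\<close>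
definition Rlb ::
  "('x1 \<times> 'y11 \<times> 'y21) pmf \<Rightarrow> ('x2 \<times> 'y12 \<times> 'y22) pmf \<Rightarrow>
   ('x1 \<Rightarrow> 'z11 \<Rightarrow> real) \<Rightarrow> ('x2 \<Rightarrow> 'z12 \<Rightarrow> real) \<Rightarrow>
   ('x1 \<Rightarrow> 'z21 \<Rightarrow> real) \<Rightarrow> ('x2 \<Rightarrow> 'z22 \<Rightarrow> real) \<Rightarrow> (nat \<Rightarrow> nat \<Rightarrow> real) \<Rightarrow> real \<Rightarrow> ereal" where
  "Rlb P1 P2 d11 d12 d21 d22 D \<epsilon> =
     (SUP Pb \<in> Pbar P1 P2. INF Q \<in> Cbar d11 d12 d21 d22 D \<epsilon> Pb. ereal (Rbar_lb Q)) - ereal \<epsilon>"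

text \<open>Nonempty subsets of {1,2}; U_{1} = lA, U_{2} = lB, U_{1,2} = lC.\<close>
definition subsets12 :: "nat set set" where
  "subsets12 = {{1}, {2}, {1, 2}}"

definition Dset :: "nat \<Rightarrow> nat set set" where
  "Dset l = {S \<in> subsets12. l \<in> S}"

definition usel :: "nat set \<Rightarrow> 'o \<times> (nat \<times> nat \<times> nat) \<Rightarrow> nat" where
  "usel S \<omega> = (if S = {1} then lA \<omega> else if S = {2} then lB \<omega> else lC \<omega>)"

definition UU :: "nat set set \<Rightarrow> 'o \<times> (nat \<times> nat \<times> nat) \<Rightarrow> (nat set \<Rightarrow> nat)" where
  "UU T \<omega> = restrict (\<lambda>S. usel S \<omega>) T"

definition Rach_feasible ::
  "('x1 \<times> 'y11 \<times> 'y21) pmf \<Rightarrow> ('x2 \<times> 'y12 \<times> 'y22) pmf \<Rightarrow>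
   ('x1 \<Rightarrow> 'z11 \<Rightarrow> real) \<Rightarrow> ('x2 \<Rightarrow> 'z12 \<Rightarrow> real) \<Rightarrow>
   ('x1 \<Rightarrow> 'z21 \<Rightarrow> real) \<Rightarrow> ('x2 \<Rightarrow> 'z22 \<Rightarrow> real) \<Rightarrow> (nat \<Rightarrow> nat \<Rightarrow> real) \<Rightarrow>
   ((('x1 \<times> 'x2) \<times> ('y11 \<times> 'y12) \<times> ('y21 \<times> 'y22)) \<times> (nat \<times> nat \<times> nat)) pmf \<Rightarrow> bool" where
  "Rach_feasible P1 P2 d11 d12 d21 d22 D Q \<longleftrightarrow>
     finite (set_pmf Q) \<and> map_pmf fst Q = mis_src P1 P2 \<and>
     mis_markov Q (UU subsets12) lX (\<lambda>\<omega>. (lY1 \<omega>, lY2 \<omega>)) \<and>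
     \<comment> \<open>decoder 1 uses (U_{1}, U_{1,2}, Y1); decoder 2 uses (U_{2}, U_{1,2}, Y2)\<close>
     (\<exists>g11 :: nat \<Rightarrow> nat \<Rightarrow> 'y11 \<times> 'y12 \<Rightarrow> 'z11.
        measure_pmf.expectation Q (\<lambda>\<omega>. d11 (fst (lX \<omega>)) (g11 (lA \<omega>) (lC \<omega>) (lY1 \<omega>))) \<le> D 1 1) \<and>
     (\<exists>g12 :: nat \<Rightarrow> nat \<Rightarrow> 'y11 \<times> 'y12 \<Rightarrow> 'z12.
        measure_pmf.expectation Q (\<lambda>\<omega>. d12 (snd (lX \<omega>)) (g12 (lA \<omega>) (lC \<omega>) (lY1 \<omega>))) \<le> D 1 2) \<and>
     (\<exists>g21 :: nat \<Rightarrow> nat \<Rightarrow> 'y21 \<times> 'y22 \<Rightarrow> 'z21.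
        measure_pmf.expectation Q (\<lambda>\<omega>. d21 (fst (lX \<omega>)) (g21 (lB \<omega>) (lC \<omega>) (lY2 \<omega>))) \<le> D 2 1) \<and>
     (\<exists>g22 :: nat \<Rightarrow> nat \<Rightarrow> 'y21 \<times> 'y22 \<Rightarrow> 'z22.
        measure_pmf.expectation Q (\<lambda>\<omega>. d22 (snd (lX \<omega>)) (g22 (lB \<omega>) (lC \<omega>) (lY2 \<omega>))) \<le> D 2 2)"

definition Rach_rates ::
  "nat set list \<Rightarrow> ((('x1 \<times> 'x2) \<times> ('y11 \<times> 'y12) \<times> ('y21 \<times> 'y22)) \<times> (nat \<times> nat \<times> nat)) pmf \<Rightarrow>
   (nat set \<Rightarrow> real) \<Rightarrow> (nat set \<Rightarrow> real) \<Rightarrow> bool" where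
  "Rach_rates v Q R R' \<longleftrightarrow>
     (\<forall>S \<in> subsets12. 0 \<le> R S \<and> 0 \<le> R' S) \<and>
     (\<forall>j < length v. R (v ! j) + R' (v ! j) \<ge>
        mis_I Q (\<lambda>\<omega>. (lX \<omega>, UU (set (take j v)) \<omega>)) (usel (v ! j)) (\<lambda>_. ())) \<and>
     (\<forall>D'. D' \<subseteq> Dset 1 \<and> D' \<noteq> {} \<longrightarrow>
        (\<Sum>S \<in> D'. R' S) \<le> (\<Sum>S \<in> D'. mis_H Q (usel S))
          - mis_condH Q (UU D') (\<lambda>\<omega>. (UU (Dset 1 - D') \<omega>, lY1 \<omega>))) \<and>
     (\<forall>D'. D' \<subseteq> Dset 2 \<and> D' \<noteq> {} \<longrightarrow>
        (\<Sum>S \<in> D'. R' S) \<le> (\<Sum>S \<in> D'. mis_H Q (usel S))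
          - mis_condH Q (UU D') (\<lambda>\<omega>. (UU (Dset 2 - D') \<omega>, lY2 \<omega>)))"

definition Rach0 ::
  "('x1 \<times> 'y11 \<times> 'y21) pmf \<Rightarrow> ('x2 \<times> 'y12 \<times> 'y22) pmf \<Rightarrow>
   ('x1 \<Rightarrow> 'z11 \<Rightarrow> real) \<Rightarrow> ('x2 \<Rightarrow> 'z12 \<Rightarrow> real) \<Rightarrow>
   ('x1 \<Rightarrow> 'z21 \<Rightarrow> real) \<Rightarrow> ('x2 \<Rightarrow> 'z22 \<Rightarrow> real) \<Rightarrow> (nat \<Rightarrow> nat \<Rightarrow> real) \<Rightarrow> ereal" where
  "Rach0 P1 P2 d11 d12 d21 d22 D =
     (INF v \<in> {v. distinct v \<and> set v = subsets12}.
        INF Q \<in> {Q. Rach_feasible P1 P2 d11 d12 d21 d22 D Q}.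
          INF RR \<in> {(R, R'). Rach_rates v Q R R'}. ereal (\<Sum>S \<in> subsets12. fst RR S))"

definition lower_convex_envelope ::
  "((nat \<Rightarrow> nat \<Rightarrow> real) \<Rightarrow> ereal) \<Rightarrow> (nat \<Rightarrow> nat \<Rightarrow> real) \<Rightarrow> ereal" where
  "lower_convex_envelope f D = Inf {(\<Sum>t<k. ereal (lam t) * f (Ds t)) | (k::nat) lam Ds.
       (\<forall>t<k. 0 \<le> lam t) \<and> (\<Sum>t<k. lam t) = 1 \<and>
       (\<forall>j \<in> {1, 2}. \<forall>i \<in> {1, 2}. (\<Sum>t<k. lam t * Ds t j i) = D j i)}"

definition Rach ::
  "('x1 \<times> 'y11 \<times> 'y21) pmf \<Rightarrow> ('x2 \<times> 'y12 \<times> 'y22) pmf \<Rightarrow>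
   ('x1 \<Rightarrow> 'z11 \<Rightarrow> real) \<Rightarrow> ('x2 \<Rightarrow> 'z12 \<Rightarrow> real) \<Rightarrow>
   ('x1 \<Rightarrow> 'z21 \<Rightarrow> real) \<Rightarrow> ('x2 \<Rightarrow> 'z22 \<Rightarrow> real) \<Rightarrow> (nat \<Rightarrow> nat \<Rightarrow> real) \<Rightarrow> ereal" where
  "Rach P1 P2 d11 d12 d21 d22 D = lower_convex_envelope (Rach0 P1 P2 d11 d12 d21 d22) D"

end

theory Submission
  imports Defs "HOL-Real_Asymp.Real_Asymp"
begin

text \<open>
  Converse: take the given law itself in the supremum. For \<open>(V, U\<^sub>1, U\<^sub>2)\<close> admissible in the lower
  bound put \<open>W\<^sub>1 = (V, U\<^sub>2, Y\<^sub>2\<^sub>2)\<close>, \<open>U\<^sub>1' = (U\<^sub>1, Y\<^sub>1\<^sub>2)\<close> and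
  \<open>W\<^sub>2 = (V, U\<^sub>1, Y\<^sub>1\<^sub>1)\<close>, \<open>U\<^sub>2' = (U\<^sub>2, Y\<^sub>2\<^sub>1)\<close>.
  Degradedness and independence of the components turn the chain rule for the two orders of decoding
  into \<open>R\<^sup>M\<^sub>1\<close> and \<open>R\<^sup>M\<^sub>2\<close> of these variables, and both are sums over the components, so the components
  may be made independent. Cardinalities are reduced by reweighting with a density that depends on
  \<open>W\<close> (then on \<open>U\<close>) only: conditional entropies given \<open>W\<close> are linear in it, so a basic solution of a
  linear program does the job. For bounded alphabets everything is continuous on a compact set, which
  lets the slack in the distortions tend to 0.

  Achievability: \<open>U{1,2} = (W\<^sub>1, W\<^sub>2)\<close>, \<open>U{1} = U\<^sub>1\<close>, \<open>U{2} = U\<^sub>2\<close>, encoded in this order,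
  with binning rates \<open>min (I(W; Y\<^sub>1)) (I(W; Y\<^sub>2))\<close>, \<open>I(U\<^sub>1; W, Y\<^sub>1)\<close> and \<open>I(U\<^sub>2; W, Y\<^sub>2)\<close>.
\<close>

unbundle lattice_syntax

section \<open>Random variables as equivalence relations\<close>

text \<open>Entropy depends on a variable only through the equivalence relation of having the same value.
  Joint variables are infima of such relations, so entropies of tuples of variables of different
  types are identified by rewriting with the semilattice laws.\<close>

typedef 'o eqrel = "{r :: 'o \<Rightarrow> 'o \<Rightarrow> bool. equivp r}"
  morphisms related Abs_eqrel
  using identity_equivp by blast

setup_lifting type_definition_eqrel

instantiation eqrel :: (type) bounded_semilattice_inf_top
begin

lift_definition less_eq_eqrel :: "'a eqrel \<Rightarrow> 'a eqrel \<Rightarrow> bool" is "(\<le>)" .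
lift_definition less_eqrel :: "'a eqrel \<Rightarrow> 'a eqrel \<Rightarrow> bool" is "(<)" .
lift_definition inf_eqrel :: "'a eqrel \<Rightarrow> 'a eqrel \<Rightarrow> 'a eqrel" is inf
  by (intro equivpI reflpI sympI transpI) (auto dest: equivp_reflp equivp_symp equivp_transp)
lift_definition top_eqrel :: "'a eqrel" is top
  by (intro equivpI reflpI sympI transpI) auto

instance
proof
  fix K L N :: "'a eqrel"
  show "K < L \<longleftrightarrow> K \<le> L \<and> \<not> L \<le> K" by transfer (rule less_le_not_le)
  show "K \<le> K" by transfer (rule order.refl)
  show "K \<le> L \<Longrightarrow> L \<le> N \<Longrightarrow> K \<le> N" by transfer (rule order.trans)
  show "K \<le> L \<Longrightarrow> L \<le> K \<Longrightarrow> K = L" by transfer (rule order.antisym)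
  show "K \<sqinter> L \<le> K" by transfer (rule inf_le1)
  show "K \<sqinter> L \<le> L" by transfer (rule inf_le2)
  show "K \<le> L \<Longrightarrow> K \<le> N \<Longrightarrow> K \<le> L \<sqinter> N" by transfer (rule inf_greatest)
  show "K \<le> \<top>" by transfer (rule top_greatest)
qed

end

lift_definition ker :: "('o \<Rightarrow> 'a) \<Rightarrow> 'o eqrel" is "\<lambda>A \<omega> \<omega>'. A \<omega> = A \<omega>'"
  by (intro equivpI reflpI sympI transpI) auto

lift_definition pullback :: "('o \<Rightarrow> 'p) \<Rightarrow> 'p eqrel \<Rightarrow> 'o eqrel" is "\<lambda>f r \<omega> \<omega>'. r (f \<omega>) (f \<omega>')"
  by (intro equivpI reflpI sympI transpI) (auto dest: equivp_reflp equivp_symp equivp_transp)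

definition eqclass :: "'o eqrel \<Rightarrow> 'o \<Rightarrow> 'o set" where
  "eqclass K \<omega> = {\<omega>'. related K \<omega> \<omega>'}"

lemma related_ker [simp]: "related (ker A) \<omega> \<omega>' \<longleftrightarrow> A \<omega> = A \<omega>'"
  by transfer simp

lemma related_inf [simp]: "related (K \<sqinter> L) \<omega> \<omega>' \<longleftrightarrow> related K \<omega> \<omega>' \<and> related L \<omega> \<omega>'"
  by transfer simp

lemma related_top [simp]: "related \<top> \<omega> \<omega>'"
  by (simp add: top_eqrel.rep_eq)

lemma eqrel_eqI: "(\<And>\<omega> \<omega>'. related K \<omega> \<omega>' \<longleftrightarrow> related L \<omega> \<omega>') \<Longrightarrow> K = L"
  by (simp add: related_inject[symmetric] fun_eq_iff)

lemma le_eqrelD: "K \<le> L \<Longrightarrow> related K \<omega> \<omega>' \<Longrightarrow> related L \<omega> \<omega>'"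
  by transfer blast

lemma ker_Pair [simp]: "ker (\<lambda>\<omega>. (A \<omega>, B \<omega>)) = ker A \<sqinter> ker B"
  by (auto intro: eqrel_eqI)

lemma ker_const [simp]: "ker (\<lambda>_. c) = \<top>"
  by (auto intro: eqrel_eqI)

lemma related_pullback [simp]: "related (pullback f K) \<omega> \<omega>' \<longleftrightarrow> related K (f \<omega>) (f \<omega>')"
  by (simp add: pullback.rep_eq)

lemma pullback_ker [simp]: "pullback f (ker A) = ker (\<lambda>\<omega>. A (f \<omega>))"
  and pullback_inf [simp]: "pullback f (K \<sqinter> L) = pullback f K \<sqinter> pullback f L"
  and pullback_top [simp]: "pullback f \<top> = \<top>"
  by (auto intro: eqrel_eqI)

lemma eqclass_ker: "eqclass (ker A) \<omega> = {\<omega>'. A \<omega>' = A \<omega>}"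
  by (auto simp: eqclass_def)

lemma self_in_eqclass: "\<omega> \<in> eqclass K \<omega>"
  unfolding eqclass_def by transfer (simp add: equivp_reflp)

lemma ker_eqclass [simp]: "ker (eqclass K) = K"
proof (rule eqrel_eqI)
  show "related (ker (eqclass K)) \<omega> \<omega>' \<longleftrightarrow> related K \<omega> \<omega>'" for \<omega> \<omega>'
    unfolding related_ker eqclass_def by transfer (auto simp: equivp_def)
qed

section \<open>Entropy\<close>

definition ent :: "'o pmf \<Rightarrow> 'o eqrel \<Rightarrow> real" where
  "ent M K = - measure_pmf.expectation M (\<lambda>\<omega>. log 2 (measure_pmf.prob M (eqclass K \<omega>)))"

definition cond_ent :: "'o pmf \<Rightarrow> 'o eqrel \<Rightarrow> 'o eqrel \<Rightarrow> real" where
  "cond_ent M K L = ent M (K \<sqinter> L) - ent M L"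

definition cond_info :: "'o pmf \<Rightarrow> 'o eqrel \<Rightarrow> 'o eqrel \<Rightarrow> 'o eqrel \<Rightarrow> real" where
  "cond_info M K L N = cond_ent M K N - cond_ent M K (L \<sqinter> N)"

definition cond_indep :: "'o pmf \<Rightarrow> 'o eqrel \<Rightarrow> 'o eqrel \<Rightarrow> 'o eqrel \<Rightarrow> bool" where
  "cond_indep M K L N \<longleftrightarrow> cond_info M K L N = 0"

lemmas info_defs = cond_info_def cond_ent_def

lemma mis_pr_nonneg [simp]: "0 \<le> mis_pr M A a"
  by (simp add: mis_pr_def)

lemma mis_pr_eq_0: "a \<notin> A ` set_pmf M \<Longrightarrow> mis_pr M A a = 0"
  by (auto simp: mis_pr_def measure_pmf_zero_iff)

lemma mis_pr_pos: "\<omega> \<in> set_pmf M \<Longrightarrow> 0 < mis_pr M A (A \<omega>)"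
  unfolding mis_pr_def by (rule measure_pmf_posI) auto

lemma mis_pr_eq_pmf: "mis_pr M A a = pmf (map_pmf A M) a"
  by (simp add: mis_pr_def pmf_map vimage_def)

lemma mis_pr_ker: "mis_pr M A (A \<omega>) = measure_pmf.prob M (eqclass (ker A) \<omega>)"
  by (simp add: mis_pr_def eqclass_ker)

lemma expectation_sum:
  fixes f :: "'o \<Rightarrow> real"
  assumes "finite S" "set_pmf M \<subseteq> S"
  shows "measure_pmf.expectation M f = (\<Sum>\<omega>\<in>S. pmf M \<omega> * f \<omega>)"
  using assms by (subst integral_measure_pmf_real[where A = S]) (auto simp: mult.commute)

lemma prob_sum:
  assumes "finite S" "set_pmf M \<subseteq> S"
  shows "measure_pmf.prob M A = (\<Sum>\<omega>\<in>A \<inter> S. pmf M \<omega>)"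
proof -
  have "measure_pmf.prob M A = measure_pmf.prob M (A \<inter> S)"
    using assms by (intro measure_eq_AE) (auto simp: AE_measure_pmf_iff)
  then show ?thesis using assms by (simp add: measure_measure_pmf_finite)
qed

context
  fixes M :: "'o pmf"
  assumes fin: "finite (set_pmf M)"
begin

lemma sum_mis_pr_mult:
  "(\<Sum>a\<in>A ` set_pmf M. mis_pr M A a * f a) = measure_pmf.expectation M (\<lambda>\<omega>. f (A \<omega>))"
proof -
  have "(\<Sum>a\<in>A ` set_pmf M. mis_pr M A a * f a)
      = measure_pmf.expectation (map_pmf A M) f"
    using fin by (subst expectation_sum[OF _ subset_refl]) (auto simp: mis_pr_eq_pmf)
  then show ?thesis by simp
qed

lemma sum_mis_pr: "(\<Sum>a\<in>A ` set_pmf M. mis_pr M A a) = 1"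
  using sum_mis_pr_mult[of A "\<lambda>_. 1"] by simp

lemma sum_mis_pr_Pair: "(\<Sum>a\<in>A ` set_pmf M. mis_pr M (\<lambda>\<omega>. (A \<omega>, C \<omega>)) (a, c)) = mis_pr M C c"
proof -
  have "mis_pr M (\<lambda>\<omega>. (A \<omega>, C \<omega>)) (a, c)
      = (\<Sum>\<omega>\<in>{\<omega> \<in> {\<omega>\<in>set_pmf M. C \<omega> = c}. A \<omega> = a}. pmf M \<omega>)" for a
    unfolding mis_pr_def prob_sum[OF fin subset_refl] by (intro sum.cong) auto
  then have "(\<Sum>a\<in>A ` set_pmf M. mis_pr M (\<lambda>\<omega>. (A \<omega>, C \<omega>)) (a, c))
      = (\<Sum>\<omega>\<in>{\<omega>\<in>set_pmf M. C \<omega> = c}. pmf M \<omega>)"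
    using fin by (simp only:) (intro sum.group, auto)
  also have "\<dots> = mis_pr M C c"
    unfolding mis_pr_def prob_sum[OF fin subset_refl] by (intro sum.cong) auto
  finally show ?thesis .
qed

lemma mis_H_eq_ent: "mis_H M A = ent M (ker A)"
  unfolding mis_H_def ent_def sum_mis_pr_mult by (simp add: mis_pr_ker)

lemma mis_condH_eq_cond_ent: "mis_condH M A C = cond_ent M (ker A) (ker C)"
proof -
  let ?AC = "\<lambda>\<omega>. (A \<omega>, C \<omega>)"
  have "mis_condH M A C
      = - measure_pmf.expectation M (\<lambda>\<omega>. log 2 (mis_pr M ?AC (?AC \<omega>) / mis_pr M C (C \<omega>)))"
    unfolding mis_condH_def sum_mis_pr_mult by simp
  also have "\<dots> = - measure_pmf.expectation M
      (\<lambda>\<omega>. log 2 (mis_pr M ?AC (?AC \<omega>)) - log 2 (mis_pr M C (C \<omega>)))"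
    using mis_pr_pos[of _ M ?AC] mis_pr_pos[of _ M C]
    by (intro arg_cong[of _ _ uminus] integral_cong_AE) (auto simp: AE_measure_pmf_iff log_divide_pos)
  also have "\<dots> = cond_ent M (ker A) (ker C)"
    unfolding cond_ent_def ent_def ker_Pair[symmetric] mis_pr_ker[symmetric]
    by (simp add: integrable_measure_pmf_finite[OF fin])
  finally show ?thesis .
qed

lemma mis_I_eq_cond_info: "mis_I M A B C = cond_info M (ker A) (ker B) (ker C)"
proof -
  let ?ABC = "\<lambda>\<omega>. (A \<omega>, B \<omega>, C \<omega>)" and ?AC = "\<lambda>\<omega>. (A \<omega>, C \<omega>)" and ?BC = "\<lambda>\<omega>. (B \<omega>, C \<omega>)"
  let ?log = "\<lambda>A \<omega>. log 2 (mis_pr M A (A \<omega>))"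
  have "mis_I M A B C = (\<Sum>t\<in>?ABC ` set_pmf M. mis_pr M ?ABC t * (case t of (a, b, c) \<Rightarrow>
        log 2 (mis_pr M ?ABC (a, b, c) * mis_pr M C c / (mis_pr M ?AC (a, c) * mis_pr M ?BC (b, c)))))"
    unfolding mis_I_def by (intro sum.cong) (auto split: prod.splits)
  also have "\<dots> = measure_pmf.expectation M (\<lambda>\<omega>. log 2 (mis_pr M ?ABC (?ABC \<omega>) * mis_pr M C (C \<omega>) /
      (mis_pr M ?AC (?AC \<omega>) * mis_pr M ?BC (?BC \<omega>))))"
    unfolding sum_mis_pr_mult by simp
  also have "\<dots> = measure_pmf.expectation M
      (\<lambda>\<omega>. ?log ?ABC \<omega> + ?log C \<omega> - ?log ?AC \<omega> - ?log ?BC \<omega>)"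
  proof (intro integral_cong_AE)
    show "AE \<omega> in M. log 2 (mis_pr M ?ABC (?ABC \<omega>) * mis_pr M C (C \<omega>) /
      (mis_pr M ?AC (?AC \<omega>) * mis_pr M ?BC (?BC \<omega>)))
      = ?log ?ABC \<omega> + ?log C \<omega> - ?log ?AC \<omega> - ?log ?BC \<omega>"
      using mis_pr_pos[of _ M ?ABC] mis_pr_pos[of _ M C] mis_pr_pos[of _ M ?AC] mis_pr_pos[of _ M ?BC]
      by (auto simp: AE_measure_pmf_iff log_divide_pos log_mult_pos)
  qed auto
  also have "\<dots> = ent M (ker ?AC) + ent M (ker ?BC) - ent M (ker ?ABC) - ent M (ker C)"
    unfolding ent_def mis_pr_ker[symmetric] by (simp add: integrable_measure_pmf_finite[OF fin])
  also have "\<dots> = cond_info M (ker A) (ker B) (ker C)"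
    by (simp add: info_defs)
  finally show ?thesis .
qed

end

lemma diff_le_mult_ln_divide:
  fixes p q :: real
  assumes "0 \<le> p" "0 \<le> q" "q = 0 \<Longrightarrow> p = 0"
  shows "p - q \<le> p * ln (p / q)" and "p * ln (p / q) = p - q \<Longrightarrow> p = q"
proof -
  have "p - q \<le> p * ln (p / q) \<and> (p * ln (p / q) = p - q \<longrightarrow> p = q)"
  proof (cases "p = 0")
    case False
    with assms have pos: "0 < p" "0 < q" by (auto simp: less_le)
    have ln: "ln (p / q) = - ln (q / p)" using pos by (simp add: ln_div)
    have "p * ln (q / p) \<le> p * (q / p - 1)"
      using pos by (intro mult_left_mono ln_le_minus_one) auto
    moreover have "p = q" if "p * ln (p / q) = p - q"
    proof -
      have "p * ln (q / p) = p * (q / p - 1)" using that pos by (simp add: ln algebra_simps)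
      then have "q / p = 1" using pos by (intro ln_eq_minus_one) auto
      then show ?thesis using pos by simp
    qed
    ultimately show ?thesis using pos by (simp add: ln algebra_simps)
  qed (use assms in auto)
  then show "p - q \<le> p * ln (p / q)" "p * ln (p / q) = p - q \<Longrightarrow> p = q" by auto
qed

lemma gibbs_inequality:
  fixes p q :: "'a \<Rightarrow> real"
  assumes fin: "finite S" and nonneg: "\<And>t. t \<in> S \<Longrightarrow> 0 \<le> p t" "\<And>t. t \<in> S \<Longrightarrow> 0 \<le> q t"
    and dom: "\<And>t. t \<in> S \<Longrightarrow> q t = 0 \<Longrightarrow> p t = 0" and sums: "sum p S = sum q S"
  shows "0 \<le> (\<Sum>t\<in>S. p t * ln (p t / q t))"
    and "(\<Sum>t\<in>S. p t * ln (p t / q t)) = 0 \<Longrightarrow> t \<in> S \<Longrightarrow> p t = q t"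
proof -
  have sum_eq: "(\<Sum>t\<in>S. p t * ln (p t / q t)) = (\<Sum>t\<in>S. p t * ln (p t / q t) - (p t - q t))"
    using sums by (simp add: sum_subtractf)
  have pointwise: "0 \<le> p t * ln (p t / q t) - (p t - q t)" if "t \<in> S" for t
    using diff_le_mult_ln_divide(1)[OF nonneg dom, of t] that by simp
  show "0 \<le> (\<Sum>t\<in>S. p t * ln (p t / q t))"
    unfolding sum_eq by (intro sum_nonneg pointwise)
  assume "(\<Sum>t\<in>S. p t * ln (p t / q t)) = 0" "t \<in> S"
  then have "p t * ln (p t / q t) = p t - q t"
    unfolding sum_eq using sum_nonneg_eq_0_iff[OF fin pointwise] by simp
  then show "p t = q t"
    using diff_le_mult_ln_divide(2)[OF nonneg dom, of t] \<open>t \<in> S\<close> by simp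
qed

definition markov_prod :: "'o pmf \<Rightarrow> ('o \<Rightarrow> 'a) \<Rightarrow> ('o \<Rightarrow> 'b) \<Rightarrow> ('o \<Rightarrow> 'c) \<Rightarrow> 'a \<times> 'b \<times> 'c \<Rightarrow> real" where
  "markov_prod M A B C = (\<lambda>(a, b, c).
     mis_pr M (\<lambda>\<omega>. (A \<omega>, C \<omega>)) (a, c) * mis_pr M (\<lambda>\<omega>. (B \<omega>, C \<omega>)) (b, c) / mis_pr M C c)"

lemma mis_pr_eq_0_mono:
  assumes "mis_pr M B (f a) = 0" "\<And>\<omega>. B \<omega> = f (A \<omega>)"
  shows "mis_pr M A a = 0"
  using assms by (auto simp: mis_pr_def measure_pmf_zero_iff)

lemma mis_markov_iff_markov_prod:
  "mis_markov M A C B \<longleftrightarrow> (\<forall>t. mis_pr M (\<lambda>\<omega>. (A \<omega>, B \<omega>, C \<omega>)) t = markov_prod M A B C t)"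
proof -
  have perm: "mis_pr M (\<lambda>\<omega>. (A \<omega>, C \<omega>, B \<omega>)) (a, c, b) = mis_pr M (\<lambda>\<omega>. (A \<omega>, B \<omega>, C \<omega>)) (a, b, c)"
    "mis_pr M (\<lambda>\<omega>. (C \<omega>, B \<omega>)) (c, b) = mis_pr M (\<lambda>\<omega>. (B \<omega>, C \<omega>)) (b, c)" for a b c
    unfolding mis_pr_def by (auto intro!: arg_cong[of _ _ "measure_pmf.prob M"])
  have "mis_pr M (\<lambda>\<omega>. (A \<omega>, C \<omega>, B \<omega>)) (a, c, b) * mis_pr M C c
        = mis_pr M (\<lambda>\<omega>. (A \<omega>, C \<omega>)) (a, c) * mis_pr M (\<lambda>\<omega>. (C \<omega>, B \<omega>)) (c, b)
      \<longleftrightarrow> mis_pr M (\<lambda>\<omega>. (A \<omega>, B \<omega>, C \<omega>)) (a, b, c) = markov_prod M A B C (a, b, c)" for a b c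
  proof (cases "mis_pr M C c = 0")
    case True
    then have "mis_pr M (\<lambda>\<omega>. (A \<omega>, C \<omega>)) (a, c) = 0" "mis_pr M (\<lambda>\<omega>. (A \<omega>, B \<omega>, C \<omega>)) (a, b, c) = 0"
      using mis_pr_eq_0_mono[of M C snd "(a, c)" "\<lambda>\<omega>. (A \<omega>, C \<omega>)"]
        mis_pr_eq_0_mono[of M C "\<lambda>t. snd (snd t)" "(a, b, c)" "\<lambda>\<omega>. (A \<omega>, B \<omega>, C \<omega>)"] by simp_all
    with True show ?thesis by (simp add: markov_prod_def)
  qed (simp add: markov_prod_def perm field_simps)
  then show ?thesis unfolding mis_markov_def by auto
qed

context
  fixes M :: "'o pmf" and A :: "'o \<Rightarrow> 'a" and B :: "'o \<Rightarrow> 'b" and C :: "'o \<Rightarrow> 'c"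
  assumes fin: "finite (set_pmf M)"
begin

lemma sum_markov_prod: "sum (markov_prod M A B C) (A ` set_pmf M \<times> B ` set_pmf M \<times> C ` set_pmf M) = 1"
proof -
  let ?S = "set_pmf M"
  let ?ac = "mis_pr M (\<lambda>\<omega>. (A \<omega>, C \<omega>))" and ?bc = "mis_pr M (\<lambda>\<omega>. (B \<omega>, C \<omega>))" and ?c = "mis_pr M C"
  have "sum (markov_prod M A B C) (A ` ?S \<times> B ` ?S \<times> C ` ?S)
      = (\<Sum>a\<in>A ` ?S. \<Sum>b\<in>B ` ?S. \<Sum>c\<in>C ` ?S. ?ac (a, c) * ?bc (b, c) / ?c c)"
    by (simp add: sum.cartesian_product markov_prod_def)
  also have "\<dots> = (\<Sum>a\<in>A ` ?S. \<Sum>c\<in>C ` ?S. \<Sum>b\<in>B ` ?S. ?ac (a, c) * ?bc (b, c) / ?c c)"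
    by (intro sum.cong sum.swap refl)
  also have "\<dots> = (\<Sum>c\<in>C ` ?S. \<Sum>a\<in>A ` ?S. \<Sum>b\<in>B ` ?S. ?ac (a, c) * ?bc (b, c) / ?c c)"
    by (rule sum.swap)
  also have "\<dots> = (\<Sum>c\<in>C ` ?S. (\<Sum>a\<in>A ` ?S. ?ac (a, c)) * (\<Sum>b\<in>B ` ?S. ?bc (b, c)) / ?c c)"
    by (simp add: sum_product sum_divide_distrib)
  also have "\<dots> = (\<Sum>c\<in>C ` ?S. ?c c)"
    unfolding sum_mis_pr_Pair[OF fin] by (intro sum.cong) auto
  also have "\<dots> = 1" by (rule sum_mis_pr[OF fin])
  finally show ?thesis .
qed

lemma mis_pr_eq_0_if_markov_prod_eq_0:
  assumes "markov_prod M A B C t = 0"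
  shows "mis_pr M (\<lambda>\<omega>. (A \<omega>, B \<omega>, C \<omega>)) t = 0"
proof -
  obtain a b c where t: "t = (a, b, c)" by (cases t)
  with assms consider "mis_pr M (\<lambda>\<omega>. (A \<omega>, C \<omega>)) (a, c) = 0" | "mis_pr M (\<lambda>\<omega>. (B \<omega>, C \<omega>)) (b, c) = 0"
    | "mis_pr M C c = 0"
    by (auto simp: markov_prod_def)
  then show ?thesis
    unfolding t
    by cases (rule mis_pr_eq_0_mono[where f = "\<lambda>(a, b, c). (a, c)"]
      mis_pr_eq_0_mono[where f = "\<lambda>(a, b, c). (b, c)"] mis_pr_eq_0_mono[where f = "\<lambda>(a, b, c). c"]; simp)+
qed

text \<open>Up to the factor \<open>ln 2\<close>, the conditional mutual information is the divergence of the joint law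
  from \<open>markov_prod\<close>.\<close>

lemma
  fixes p q Box
  defines "p \<equiv> mis_pr M (\<lambda>\<omega>. (A \<omega>, B \<omega>, C \<omega>))" and "q \<equiv> markov_prod M A B C"
    and "Box \<equiv> A ` set_pmf M \<times> B ` set_pmf M \<times> C ` set_pmf M"
  shows ln_2_mult_mis_I: "ln 2 * mis_I M A B C = (\<Sum>t\<in>Box. p t * ln (p t / q t))"
    and sum_mis_pr_eq_sum_markov_prod: "sum p Box = sum q Box"
proof -
  let ?T = "(\<lambda>\<omega>. (A \<omega>, B \<omega>, C \<omega>)) ` set_pmf M"
  have Box: "finite Box" "?T \<subseteq> Box" using fin by (auto simp: Box_def)
  have p_0: "p t = 0" if "t \<notin> ?T" for t using that by (simp add: p_def mis_pr_eq_0)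
  have "ln 2 * mis_I M A B C = (\<Sum>t\<in>?T. p t * ln (p t / q t))"
    unfolding mis_I_def sum_distrib_left
    by (intro sum.cong) (auto simp: p_def q_def markov_prod_def log_def)
  also have "\<dots> = (\<Sum>t\<in>Box. p t * ln (p t / q t))"
    using Box p_0 by (intro sum.mono_neutral_left) auto
  finally show "ln 2 * mis_I M A B C = (\<Sum>t\<in>Box. p t * ln (p t / q t))" .
  have "sum p Box = sum p ?T"
    using Box p_0 by (intro sum.mono_neutral_right) auto
  then show "sum p Box = sum q Box"
    unfolding p_def q_def Box_def sum_markov_prod sum_mis_pr[OF fin] .
qed

lemma mis_I_nonneg: "0 \<le> mis_I M A B C"
  and mis_I_eq_0_iff: "mis_I M A B C = 0 \<longleftrightarrow> mis_markov M A C B"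
proof -
  let ?p = "mis_pr M (\<lambda>\<omega>. (A \<omega>, B \<omega>, C \<omega>))" and ?q = "markov_prod M A B C"
  let ?Box = "A ` set_pmf M \<times> B ` set_pmf M \<times> C ` set_pmf M"
  have q_nonneg: "0 \<le> ?q t" for t by (auto simp: markov_prod_def split: prod.splits)
  note gibbs = gibbs_inequality[OF _ mis_pr_nonneg q_nonneg mis_pr_eq_0_if_markov_prod_eq_0
      sum_mis_pr_eq_sum_markov_prod, folded ln_2_mult_mis_I]
  show "0 \<le> mis_I M A B C" using gibbs(1) fin by (simp add: zero_le_mult_iff)
  show "mis_I M A B C = 0 \<longleftrightarrow> mis_markov M A C B"
  proof
    assume zero: "mis_I M A B C = 0"
    have "?p t = ?q t" for t
    proof (cases "t \<in> ?Box")
      case True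
      with zero fin show ?thesis using gibbs(2) by simp
    next
      case False
      then have "?p t = 0" by (intro mis_pr_eq_0) auto
      moreover have "?q t = 0"
        using False mis_pr_eq_0[of _ "\<lambda>\<omega>. (A \<omega>, C \<omega>)" M] mis_pr_eq_0[of _ "\<lambda>\<omega>. (B \<omega>, C \<omega>)" M]
        by (fastforce simp: markov_prod_def split: prod.splits)
      ultimately show ?thesis by simp
    qed
    then show "mis_markov M A C B" by (simp add: mis_markov_iff_markov_prod)
  next
    assume "mis_markov M A C B"
    then have "?p = ?q" by (auto simp: mis_markov_iff_markov_prod)
    then have "ln 2 * mis_I M A B C = 0" unfolding ln_2_mult_mis_I by (intro sum.neutral) auto
    then show "mis_I M A B C = 0" by simp
  qed
qed

lemma mis_markov_iff_cond_indep: "mis_markov M A C B \<longleftrightarrow> cond_indep M (ker A) (ker B) (ker C)"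
  using mis_I_eq_0_iff by (simp add: cond_indep_def mis_I_eq_cond_info[OF fin])

end

lemma ent_top [simp]: "ent M \<top> = 0"
  by (simp add: ent_def eqclass_def)

lemma ent_map: "ent (map_pmf f M) K = ent M (pullback f K)"
  by (simp add: ent_def eqclass_def vimage_def)

lemma cond_info_map:
  "cond_info (map_pmf f M) K L N = cond_info M (pullback f K) (pullback f L) (pullback f N)"
  by (simp add: info_defs ent_map)

lemma ent_cong_law:
  assumes "map_pmf A M = map_pmf A' M'"
  shows "ent M (ker A) = ent M' (ker A')"
  using ent_map[of A M "ker id"] ent_map[of A' M' "ker id"] assms by simp

lemma cond_ent_cong_law:
  assumes "map_pmf (\<lambda>\<omega>. (A \<omega>, B \<omega>)) M = map_pmf (\<lambda>\<omega>. (A' \<omega>, B' \<omega>)) M'"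
  shows "cond_ent M (ker A) (ker B) = cond_ent M' (ker A') (ker B')"
proof -
  have "map_pmf B M = map_pmf B' M'"
    using arg_cong[OF assms, of "map_pmf snd"] by (simp add: map_pmf_comp)
  then show ?thesis
    using ent_cong_law[OF assms] ent_cong_law[of B M B' M'] by (simp add: cond_ent_def)
qed

definition agree_on :: "'o set \<Rightarrow> 'o eqrel \<Rightarrow> 'o eqrel \<Rightarrow> bool" where
  "agree_on S K L \<longleftrightarrow> (\<forall>\<omega>\<in>S. \<forall>\<omega>'\<in>S. related K \<omega> \<omega>' \<longleftrightarrow> related L \<omega> \<omega>')"

lemma agree_on_refl: "agree_on S K K"
  by (simp add: agree_on_def)

lemma agree_on_inf: "agree_on S K K' \<Longrightarrow> agree_on S L L' \<Longrightarrow> agree_on S (K \<sqinter> L) (K' \<sqinter> L')"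
  by (simp add: agree_on_def)

lemma agree_on_ker_inj: "inj_on f (A ` S) \<Longrightarrow> agree_on S (ker (\<lambda>\<omega>. f (A \<omega>))) (ker A)"
  by (auto simp: agree_on_def dest: inj_onD)

lemma ent_agree_on:
  assumes "agree_on (set_pmf M) K L"
  shows "ent M K = ent M L"
proof -
  have "measure_pmf.prob M (eqclass K \<omega>) = measure_pmf.prob M (eqclass L \<omega>)" if "\<omega> \<in> set_pmf M" for \<omega>
    using assms that by (intro measure_eq_AE) (auto simp: AE_measure_pmf_iff eqclass_def agree_on_def)
  then show ?thesis
    unfolding ent_def by (intro arg_cong[of _ _ uminus] integral_cong_AE) (auto simp: AE_measure_pmf_iff)
qed

lemma cond_info_agree_on:
  assumes "agree_on (set_pmf M) K K'" "agree_on (set_pmf M) L L'" "agree_on (set_pmf M) N N'"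
  shows "cond_info M K L N = cond_info M K' L' N'"
proof -
  have "ent M (K \<sqinter> N) = ent M (K' \<sqinter> N')" "ent M N = ent M N'" "ent M (L \<sqinter> N) = ent M (L' \<sqinter> N')"
    "ent M (K \<sqinter> (L \<sqinter> N)) = ent M (K' \<sqinter> (L' \<sqinter> N'))"
    using assms by (intro ent_agree_on agree_on_inf; simp)+
  then show ?thesis by (simp add: info_defs)
qed

lemma cond_info_commute: "cond_info M K L N = cond_info M L K N"
  by (simp add: info_defs inf_aci)

lemma cond_info_chain: "cond_info M K (L \<sqinter> L') N = cond_info M K L N + cond_info M K L' (L \<sqinter> N)"
  by (simp add: info_defs inf_aci)

lemma cond_info_chain_left: "cond_info M (K \<sqinter> K') L N = cond_info M K L N + cond_info M K' L (K \<sqinter> N)"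
  by (simp add: info_defs inf_aci)

lemma cond_indep_commute: "cond_indep M K L N \<longleftrightarrow> cond_indep M L K N"
  by (simp add: cond_indep_def cond_info_commute)

lemma cond_indep_imp_cond_ent: "cond_indep M K L N \<Longrightarrow> cond_ent M K (L \<sqinter> N) = cond_ent M K N"
  by (simp add: cond_indep_def cond_info_def)

lemma cond_indep_contraction:
  "cond_indep M K L N \<Longrightarrow> cond_indep M K L' (L \<sqinter> N) \<Longrightarrow> cond_indep M K (L \<sqinter> L') N"
  by (simp add: cond_indep_def cond_info_chain)

lemma cond_info_diff_markov:
  assumes "cond_indep M W Y X"
  shows "cond_info M X W \<top> - cond_info M W Y \<top> = cond_info M X W Y"
proof -
  have "cond_info M X W \<top> + cond_info M W Y X = cond_info M W Y \<top> + cond_info M X W Y"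
    by (simp add: info_defs inf_aci)
  with assms show ?thesis by (simp add: cond_indep_def)
qed

context
  fixes M :: "'o pmf"
  assumes fin: "finite (set_pmf M)"
begin

lemma cond_info_nonneg: "0 \<le> cond_info M K L N"
  using mis_I_nonneg[OF fin, of "eqclass K" "eqclass L" "eqclass N"]
  by (simp add: mis_I_eq_cond_info[OF fin])

lemma cond_ent_mono: "L \<le> L' \<Longrightarrow> cond_ent M K L \<le> cond_ent M K L'"
  using cond_info_nonneg[of K L L'] by (simp add: cond_info_def inf_absorb1)

lemma cond_indep_weak_union: "cond_indep M K (L \<sqinter> L') N \<Longrightarrow> cond_indep M K L' (L \<sqinter> N)"
  using cond_info_nonneg[of K L N] cond_info_nonneg[of K L' "L \<sqinter> N"]
  by (simp add: cond_indep_def cond_info_chain)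

lemma cond_indep_mono_right:
  assumes "cond_indep M K L N" "L \<le> L'"
  shows "cond_indep M K L' N"
  using cond_info_nonneg[of K L' N] cond_info_nonneg[of K L "L' \<sqinter> N"]
    cond_info_chain[of M K L' L N] assms
  by (simp add: cond_indep_def inf_absorb2)

lemma cond_indep_condition:
  assumes "cond_indep M K L N" "L \<le> A \<sqinter> B"
  shows "cond_indep M B K (A \<sqinter> N)"
  using cond_indep_weak_union[OF cond_indep_mono_right[OF assms]] by (simp add: cond_indep_commute)

lemma cond_indep_mono:
  assumes "cond_indep M K L N" "K \<le> K'" "L \<le> L'"
  shows "cond_indep M K' L' N"
  using assms cond_indep_mono_right cond_indep_commute by meson

lemma ent_inf_indep:
  assumes "cond_indep M E F \<top>" "E \<le> K" "F \<le> L"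
  shows "ent M (K \<sqinter> L) = ent M K + ent M L"
  using cond_indep_mono[OF assms] by (simp add: cond_indep_def info_defs)

lemma cond_info_inf_indep:
  assumes indep: "cond_indep M E F \<top>"
    and E: "E \<le> K" "E \<le> L" "E \<le> N" and F: "F \<le> K'" "F \<le> L'" "F \<le> N'"
  shows "cond_info M (K \<sqinter> K') (L \<sqinter> L') (N \<sqinter> N') = cond_info M K L N + cond_info M K' L' N'"
proof -
  have "ent M ((K \<sqinter> N) \<sqinter> (K' \<sqinter> N')) = ent M (K \<sqinter> N) + ent M (K' \<sqinter> N')"
    "ent M (N \<sqinter> N') = ent M N + ent M N'"
    "ent M ((L \<sqinter> N) \<sqinter> (L' \<sqinter> N')) = ent M (L \<sqinter> N) + ent M (L' \<sqinter> N')"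
    "ent M ((K \<sqinter> (L \<sqinter> N)) \<sqinter> (K' \<sqinter> (L' \<sqinter> N'))) = ent M (K \<sqinter> (L \<sqinter> N)) + ent M (K' \<sqinter> (L' \<sqinter> N'))"
    using E F by (intro ent_inf_indep[OF indep]; simp)+
  then show ?thesis by (simp add: info_defs inf_aci)
qed

end

lemma mis_markov_map:
  "mis_markov (map_pmf f M) A B C \<longleftrightarrow> mis_markov M (\<lambda>\<omega>. A (f \<omega>)) (\<lambda>\<omega>. B (f \<omega>)) (\<lambda>\<omega>. C (f \<omega>))"
  by (simp add: mis_markov_def mis_pr_eq_pmf map_pmf_comp)

lemma map_pmf_factor:
  assumes "map_pmf A M = map_pmf A' M'"
  shows "map_pmf (\<lambda>\<omega>. f (A \<omega>)) M = map_pmf (\<lambda>\<omega>. f (A' \<omega>)) M'"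
  using arg_cong[OF assms, of "map_pmf f"] by (simp add: map_pmf_comp)

lemma mis_markov_cong_law:
  assumes "map_pmf (\<lambda>\<omega>. (A \<omega>, B \<omega>, C \<omega>)) M = map_pmf (\<lambda>\<omega>. (A' \<omega>, B' \<omega>, C' \<omega>)) M'"
  shows "mis_markov M A B C \<longleftrightarrow> mis_markov M' A' B' C'"
  using arg_cong[OF assms, of "\<lambda>P. mis_markov P fst (\<lambda>t. fst (snd t)) (\<lambda>t. snd (snd t))"]
  by (simp add: mis_markov_map)

lemma pair_pmf_marginals_iff_cond_indep:
  assumes fin: "finite (set_pmf M)"
  shows "M = pair_pmf (map_pmf fst M) (map_pmf snd M) \<longleftrightarrow> cond_indep M (ker fst) (ker snd) \<top>"
proof -
  have "mis_pr M (\<lambda>\<omega>. (fst \<omega>, (), snd \<omega>)) (a, u, b) = pmf M (a, b)"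
    "mis_pr M (\<lambda>\<omega>. (fst \<omega>, ())) (a, u) = pmf (map_pmf fst M) a"
    "mis_pr M (\<lambda>\<omega>. ((), snd \<omega>)) (u, b) = pmf (map_pmf snd M) b"
    "mis_pr M (\<lambda>\<omega>. ()) u = 1" for a b u
    by (auto simp: mis_pr_def pmf_map vimage_def prod_eq_iff simp flip: measure_pmf_single
        intro!: arg_cong[of _ _ "measure_pmf.prob M"])
  then have "mis_markov M fst (\<lambda>_. ()) snd \<longleftrightarrow> M = pair_pmf (map_pmf fst M) (map_pmf snd M)"
    by (auto simp: mis_markov_def pmf_pair pmf_eq_iff)
  then show ?thesis using mis_markov_iff_cond_indep[OF fin, of fst "\<lambda>_. ()" snd] by simp
qed

lemma cond_indep_pair_pmf:
  assumes "finite (set_pmf A)" "finite (set_pmf B)"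
  shows "cond_indep (pair_pmf A B) (ker fst) (ker snd) \<top>"
  by (subst pair_pmf_marginals_iff_cond_indep[symmetric])
    (use assms in \<open>simp_all add: map_fst_pair_pmf map_snd_pair_pmf\<close>)

section \<open>Reconstruction within a distortion\<close>

definition reconstructible :: "'o pmf \<Rightarrow> ('x \<Rightarrow> 'z \<Rightarrow> real) \<Rightarrow> ('o \<Rightarrow> 'x) \<Rightarrow> ('o \<Rightarrow> 't) \<Rightarrow> real \<Rightarrow> bool" where
  "reconstructible M d X T \<delta> \<longleftrightarrow> (\<exists>g. measure_pmf.expectation M (\<lambda>\<omega>. d (X \<omega>) (g (T \<omega>))) \<le> \<delta>)"

lemma reconstructible_Pair:
  "reconstructible M d X (\<lambda>\<omega>. (A \<omega>, B \<omega>)) \<delta>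
    \<longleftrightarrow> (\<exists>g. measure_pmf.expectation M (\<lambda>\<omega>. d (X \<omega>) (g (A \<omega>) (B \<omega>))) \<le> \<delta>)"
proof
  assume "reconstructible M d X (\<lambda>\<omega>. (A \<omega>, B \<omega>)) \<delta>"
  then show "\<exists>g. measure_pmf.expectation M (\<lambda>\<omega>. d (X \<omega>) (g (A \<omega>) (B \<omega>))) \<le> \<delta>"
    unfolding reconstructible_def by (elim exE) (rule exI[of _ "curry _"], simp)
next
  assume "\<exists>g. measure_pmf.expectation M (\<lambda>\<omega>. d (X \<omega>) (g (A \<omega>) (B \<omega>))) \<le> \<delta>"
  then show "reconstructible M d X (\<lambda>\<omega>. (A \<omega>, B \<omega>)) \<delta>"
    unfolding reconstructible_def by (elim exE) (rule exI[of _ "case_prod _"], simp)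
qed

lemma reconstructible_triple:
  "reconstructible M d X (\<lambda>\<omega>. (A \<omega>, B \<omega>, C \<omega>)) \<delta>
    \<longleftrightarrow> (\<exists>g. measure_pmf.expectation M (\<lambda>\<omega>. d (X \<omega>) (g (A \<omega>) (B \<omega>) (C \<omega>))) \<le> \<delta>)"
proof
  assume "reconstructible M d X (\<lambda>\<omega>. (A \<omega>, B \<omega>, C \<omega>)) \<delta>"
  then show "\<exists>g. measure_pmf.expectation M (\<lambda>\<omega>. d (X \<omega>) (g (A \<omega>) (B \<omega>) (C \<omega>))) \<le> \<delta>"
    unfolding reconstructible_Pair by (elim exE) (rule exI[of _ "\<lambda>a. curry (_ a)"], simp)
next
  assume "\<exists>g. measure_pmf.expectation M (\<lambda>\<omega>. d (X \<omega>) (g (A \<omega>) (B \<omega>) (C \<omega>))) \<le> \<delta>"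
  then show "reconstructible M d X (\<lambda>\<omega>. (A \<omega>, B \<omega>, C \<omega>)) \<delta>"
    unfolding reconstructible_Pair by (elim exE) (rule exI[of _ "\<lambda>a. case_prod (_ a)"], simp)
qed

lemma reconstructible_map:
  "reconstructible (map_pmf f M) d X T \<delta> \<longleftrightarrow> reconstructible M d (\<lambda>\<omega>. X (f \<omega>)) (\<lambda>\<omega>. T (f \<omega>)) \<delta>"
  by (simp add: reconstructible_def)

lemma reconstructible_cong_law:
  assumes "map_pmf (\<lambda>\<omega>. (X \<omega>, T \<omega>)) M = map_pmf (\<lambda>\<omega>. (X' \<omega>, T' \<omega>)) M'"
  shows "reconstructible M d X T \<delta> \<longleftrightarrow> reconstructible M' d X' T' \<delta>"
  using arg_cong[OF assms, of "\<lambda>P. reconstructible P d fst snd \<delta>"] by (simp add: reconstructible_map)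

lemma reconstructible_factor:
  assumes "reconstructible M d X T \<delta>" "\<And>\<omega>. \<omega> \<in> set_pmf M \<Longrightarrow> T \<omega> = h (T' \<omega>)"
  shows "reconstructible M d X T' \<delta>"
proof -
  obtain g where g: "measure_pmf.expectation M (\<lambda>\<omega>. d (X \<omega>) (g (T \<omega>))) \<le> \<delta>"
    using assms(1) by (auto simp: reconstructible_def)
  have "measure_pmf.expectation M (\<lambda>\<omega>. d (X \<omega>) (g (h (T' \<omega>))))
      = measure_pmf.expectation M (\<lambda>\<omega>. d (X \<omega>) (g (T \<omega>)))"
    using assms(2) by (intro integral_cong_AE) (auto simp: AE_measure_pmf_iff)
  with g show ?thesis unfolding reconstructible_def by (intro exI[of _ "\<lambda>t. g (h t)"]) simp
qed

section \<open>Compactness\<close>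

lemma tendsto_mult_log:
  fixes p :: "nat \<Rightarrow> real"
  assumes "p \<longlonglongrightarrow> l" "\<And>n. 0 \<le> p n"
  shows "(\<lambda>n. p n * log 2 (p n)) \<longlonglongrightarrow> l * log 2 l"
proof -
  have "continuous_on {0..} (\<lambda>x::real. x * log 2 x)"
    unfolding continuous_on_def
  proof
    fix x :: real assume "x \<in> {0..}"
    then consider (zero) "x = 0" | (pos) "0 < x" by force
    then show "((\<lambda>x. x * log 2 x) \<longlongrightarrow> x * log 2 x) (at x within {0..})"
    proof cases
      case zero
      have "((\<lambda>x::real. x * log 2 x) \<longlongrightarrow> 0) (at_right 0)" by real_asymp
      with zero show ?thesis by (simp add: at_within_Ici_at_right)
    qed (auto intro!: tendsto_intros)
  qed
  moreover have "0 \<le> l" using assms by (intro LIMSEQ_le_const) auto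
  ultimately show ?thesis
    using assms by (intro continuous_on_tendsto_compose[of "{0..}" "\<lambda>x. x * log 2 x"]) auto
qed

locale finite_pmf_limit =
  fixes S :: "'o set" and Ms :: "nat \<Rightarrow> 'o pmf" and M :: "'o pmf"
  assumes finite_carrier: "finite S" and support: "\<And>n. set_pmf (Ms n) \<subseteq> S"
    and tendsto_pmf: "\<And>\<omega>. (\<lambda>n. pmf (Ms n) \<omega>) \<longlonglongrightarrow> pmf M \<omega>"
begin

lemma support_limit: "set_pmf M \<subseteq> S"
proof
  fix \<omega> assume "\<omega> \<in> set_pmf M"
  moreover have "pmf M \<omega> = 0" if "\<omega> \<notin> S"
  proof -
    have "pmf (Ms n) \<omega> = 0" for n using that support[of n] by (auto simp: set_pmf_iff)
    then show ?thesis using tendsto_pmf[of \<omega>] by (simp add: LIMSEQ_const_iff)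
  qed
  ultimately show "\<omega> \<in> S" by (auto simp: set_pmf_iff)
qed

lemma finite_support: "finite (set_pmf (Ms n))"
  and finite_support_limit: "finite (set_pmf M)"
  using support support_limit finite_carrier finite_subset by blast+

lemma tendsto_expectation:
  fixes f :: "'o \<Rightarrow> real"
  shows "(\<lambda>n. measure_pmf.expectation (Ms n) f) \<longlonglongrightarrow> measure_pmf.expectation M f"
  unfolding expectation_sum[OF finite_carrier support] expectation_sum[OF finite_carrier support_limit]
  by (intro tendsto_intros tendsto_pmf)

lemma tendsto_mis_pr: "(\<lambda>n. mis_pr (Ms n) A a) \<longlonglongrightarrow> mis_pr M A a"
  unfolding mis_pr_def prob_sum[OF finite_carrier support] prob_sum[OF finite_carrier support_limit]
  by (intro tendsto_intros tendsto_pmf)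

lemma tendsto_ent: "(\<lambda>n. ent (Ms n) K) \<longlonglongrightarrow> ent M K"
proof -
  let ?A = "eqclass K"
  have ent: "ent N K = - (\<Sum>a\<in>?A ` S. mis_pr N ?A a * log 2 (mis_pr N ?A a))" if "set_pmf N \<subseteq> S" for N
  proof -
    have "finite (set_pmf N)" using that finite_carrier finite_subset by blast
    from mis_H_eq_ent[OF this, of ?A] have "ent N K = mis_H N ?A" by simp
    also have "\<dots> = - (\<Sum>a\<in>?A ` S. mis_pr N ?A a * log 2 (mis_pr N ?A a))"
      unfolding mis_H_def using that finite_carrier
      by (intro arg_cong[of _ _ uminus] sum.mono_neutral_left) (auto simp: mis_pr_eq_0)
    finally show ?thesis .
  qed
  show ?thesis
    unfolding ent[OF support] ent[OF support_limit]
    by (intro tendsto_intros tendsto_mult_log tendsto_mis_pr) auto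
qed

lemma tendsto_cond_info: "(\<lambda>n. cond_info (Ms n) K L N) \<longlonglongrightarrow> cond_info M K L N"
  unfolding info_defs by (intro tendsto_intros tendsto_ent)

lemma cond_indep_limit: "(\<And>n. cond_indep (Ms n) K L N) \<Longrightarrow> cond_indep M K L N"
  using tendsto_cond_info[of K L N] by (simp add: cond_indep_def LIMSEQ_const_iff)

lemma law_limit:
  assumes "\<And>n. map_pmf A (Ms n) = P"
  shows "map_pmf A M = P"
proof (rule pmf_eqI)
  show "pmf (map_pmf A M) a = pmf P a" for a
    using tendsto_mis_pr[of A a] by (simp add: mis_pr_eq_pmf assms LIMSEQ_const_iff)
qed

lemma reconstructible_limit:
  fixes d :: "'x \<Rightarrow> 'z::finite \<Rightarrow> real" and \<delta> :: "nat \<Rightarrow> real"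
  assumes rec: "\<And>n. reconstructible (Ms n) d X T (\<delta> n)" and \<delta>: "\<delta> \<longlonglongrightarrow> \<delta>'"
  shows "reconstructible M d X T \<delta>'"
proof (rule ccontr)
  define G where "G = T ` S \<rightarrow>\<^sub>E (UNIV :: 'z set)"
  let ?E = "\<lambda>M g. measure_pmf.expectation M (\<lambda>\<omega>. d (X \<omega>) (g (T \<omega>)))"
  assume "\<not> reconstructible M d X T \<delta>'"
  then have "0 < ?E M g - \<delta>'" for g by (auto simp: reconstructible_def not_le)
  moreover have "(\<lambda>n. ?E (Ms n) g - \<delta> n) \<longlonglongrightarrow> ?E M g - \<delta>'" for g
    by (intro tendsto_diff tendsto_expectation \<delta>)
  ultimately have "\<forall>\<^sub>F n in sequentially. 0 < ?E (Ms n) g - \<delta> n" for g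
    by (blast dest: order_tendstoD(1))
  moreover have "finite G" using finite_carrier by (auto simp: G_def intro: finite_PiE)
  ultimately have "\<forall>\<^sub>F n in sequentially. \<forall>g\<in>G. 0 < ?E (Ms n) g - \<delta> n"
    by (simp add: eventually_ball_finite)
  then obtain n where n: "\<And>g. g \<in> G \<Longrightarrow> \<delta> n < ?E (Ms n) g"
    by (auto simp: eventually_sequentially)
  obtain g where g: "?E (Ms n) g \<le> \<delta> n" using rec[of n] by (auto simp: reconstructible_def)
  have "?E (Ms n) (restrict g (T ` S)) = ?E (Ms n) g"
    using support[of n] by (intro integral_cong_AE) (auto simp: AE_measure_pmf_iff)
  with g n[of "restrict g (T ` S)"] show False by (simp add: G_def)
qed

end

lemma pmf_of_weights:
  fixes f :: "'o \<Rightarrow> real"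
  assumes "finite S" "\<And>\<omega>. 0 \<le> f \<omega>" "\<And>\<omega>. \<omega> \<notin> S \<Longrightarrow> f \<omega> = 0" "(\<Sum>\<omega>\<in>S. f \<omega>) = 1"
  obtains M where "\<And>\<omega>. pmf M \<omega> = f \<omega>"
proof
  have "(\<integral>\<^sup>+\<omega>. ennreal (f \<omega>) \<partial>count_space UNIV) = (\<Sum>\<omega>\<in>S. ennreal (f \<omega>))"
    using assms by (intro nn_integral_count_space') auto
  also have "\<dots> = 1" using assms by (subst sum_ennreal) auto
  finally show "pmf (embed_pmf f) \<omega> = f \<omega>" for \<omega> using assms(2) by (intro pmf_embed_pmf) auto
qed

lemma convergent_subsequence_pointwise:
  fixes f :: "nat \<Rightarrow> 'a \<Rightarrow> real"
  assumes "finite S" "\<And>a. a \<in> S \<Longrightarrow> bounded (range (\<lambda>n. f n a))"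
  obtains r :: "nat \<Rightarrow> nat" and l where "strict_mono r" "\<And>a. a \<in> S \<Longrightarrow> (\<lambda>n. f (r n) a) \<longlonglongrightarrow> l a"
proof -
  have "\<forall>T\<subseteq>S. \<exists>l r. strict_mono (r :: nat \<Rightarrow> nat) \<and>
      (\<forall>e>0. \<forall>\<^sub>F n in sequentially. \<forall>a\<in>T. dist (f (r n) a) (l a) < e)"
    by (rule compact_lemma_general[where unproj = id]) (use assms in \<open>auto simp: image_image\<close>)
  then obtain l r where r: "strict_mono (r :: nat \<Rightarrow> nat)"
    and l: "\<And>e. 0 < e \<Longrightarrow> \<forall>\<^sub>F n in sequentially. \<forall>a\<in>S. dist (f (r n) a) (l a) < e" by blast
  have "(\<lambda>n. f (r n) a) \<longlonglongrightarrow> l a" if "a \<in> S" for a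
    using that by (intro tendstoI) (auto intro: eventually_mono[OF l])
  with r show thesis by (rule that)
qed

lemma pmf_convergent_subsequence:
  fixes Ms :: "nat \<Rightarrow> 'o pmf"
  assumes fin: "finite S" and supp: "\<And>n. set_pmf (Ms n) \<subseteq> S"
  obtains r M where "strict_mono (r :: nat \<Rightarrow> nat)" "finite_pmf_limit S (\<lambda>n. Ms (r n)) M"
proof -
  have "bounded (range (\<lambda>n. pmf (Ms n) \<omega>))" for \<omega>
    by (intro boundedI[of _ 1]) (auto simp: pmf_le_1)
  then obtain r :: "nat \<Rightarrow> nat" and l where r: "strict_mono r"
    and l: "\<And>\<omega>. \<omega> \<in> S \<Longrightarrow> (\<lambda>n. pmf (Ms (r n)) \<omega>) \<longlonglongrightarrow> l \<omega>"
    using convergent_subsequence_pointwise[OF fin, of "\<lambda>n. pmf (Ms n)"] by blast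
  let ?f = "\<lambda>\<omega>. if \<omega> \<in> S then l \<omega> else 0"
  have "pmf (Ms n) \<omega> = 0" if "\<omega> \<notin> S" for n \<omega>
    using supp[of n] that by (auto simp: set_pmf_iff)
  with l have f: "(\<lambda>n. pmf (Ms (r n)) \<omega>) \<longlonglongrightarrow> ?f \<omega>" for \<omega> by auto
  have "(\<lambda>n. \<Sum>\<omega>\<in>S. pmf (Ms (r n)) \<omega>) \<longlonglongrightarrow> (\<Sum>\<omega>\<in>S. ?f \<omega>)" by (intro tendsto_sum f)
  then have "(\<Sum>\<omega>\<in>S. ?f \<omega>) = 1" using fin supp by (simp add: sum_pmf_eq_1 LIMSEQ_const_iff)
  moreover have "0 \<le> ?f \<omega>" for \<omega> by (rule LIMSEQ_le_const[OF f]) auto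
  ultimately obtain M where "\<And>\<omega>. pmf M \<omega> = ?f \<omega>"
    using pmf_of_weights[OF fin, of ?f] by auto
  then have "finite_pmf_limit S (\<lambda>n. Ms (r n)) M" using fin supp f by unfold_locales auto
  with r show thesis by (rule that)
qed

section \<open>Basic solutions of linear programs\<close>

lemma exists_null_combination:
  fixes f :: "'i \<Rightarrow> 's \<Rightarrow> real"
  assumes "finite I" "finite S" "card I < card S"
  shows "\<exists>c. (\<exists>s\<in>S. c s \<noteq> 0) \<and> (\<forall>i\<in>I. (\<Sum>s\<in>S. c s * f i s) = 0)"
  using assms
proof (induction I arbitrary: S f rule: finite_induct)
  case empty
  then have "S \<noteq> {}" by auto
  then show ?case by (intro exI[of _ "\<lambda>_. 1"]) auto
next
  case (insert i I)
  show ?case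
  proof (cases "\<forall>s\<in>S. f i s = 0")
    case True
    have "card I < card S" using insert by simp
    from insert.IH[OF insert.prems(1) this, of f] True show ?thesis by auto
  next
    case False
    then obtain r where r: "r \<in> S" "f i r \<noteq> 0" by auto
    define f' where "f' j s = f i r * f j s - f i s * f j r" for j s
    have "card I < card (S - {r})" using insert r by (simp add: card_Diff_singleton)
    from insert.IH[OF _ this, of f'] insert.prems obtain c where
      c: "\<exists>s\<in>S - {r}. c s \<noteq> 0" "\<forall>j\<in>I. (\<Sum>s\<in>S - {r}. c s * f' j s) = 0" by blast
    define c' where "c' = c(r := - (\<Sum>s\<in>S - {r}. c s * f i s) / f i r)"
    have "(\<Sum>s\<in>S. c' s * f j s) = (\<Sum>s\<in>S - {r}. c s * f' j s) / f i r" for j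
    proof -
      have "(\<Sum>s\<in>S. c' s * f j s) = c' r * f j r + (\<Sum>s\<in>S - {r}. c s * f j s)"
        using insert.prems r by (subst sum.remove[of _ r]) (auto simp: c'_def)
      also have "\<dots> = (\<Sum>s\<in>S - {r}. c s * f j s - c s * f i s * f j r / f i r)"
        by (simp add: c'_def sum_subtractf sum_distrib_right sum_divide_distrib)
      also have "\<dots> = (\<Sum>s\<in>S - {r}. c s * f' j s) / f i r"
        using r by (simp add: f'_def sum_divide_distrib field_simps)
      finally show ?thesis .
    qed
    moreover have "(\<Sum>s\<in>S - {r}. c s * f' i s) = 0" by (simp add: f'_def mult.commute)
    moreover have "\<exists>s\<in>S. c' s \<noteq> 0" using c(1) by (auto simp: c'_def)
    ultimately show ?thesis using c(2) by (intro exI[of _ c']) auto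
  qed
qed

lemma exists_descent_direction:
  fixes f :: "'i \<Rightarrow> 's \<Rightarrow> real" and h :: "'s \<Rightarrow> real"
  assumes "finite I" and T: "finite T" "card I < card T"
    and pos: "\<And>s. s \<in> T \<Longrightarrow> 0 < (\<Sum>i\<in>I. l i * f i s)"
  obtains c where "\<exists>s\<in>T. c s < 0" "\<And>i. i \<in> I \<Longrightarrow> (\<Sum>s\<in>T. c s * f i s) = 0" "(\<Sum>s\<in>T. c s * h s) \<le> 0"
proof -
  obtain c0 where c0: "\<exists>s\<in>T. c0 s \<noteq> 0" "\<And>i. i \<in> I \<Longrightarrow> (\<Sum>s\<in>T. c0 s * f i s) = 0"
    using exists_null_combination[OF assms(1-3), of f] by blast
  define \<sigma> :: real where "\<sigma> = (if (\<Sum>s\<in>T. c0 s * h s) \<le> 0 then 1 else -1)"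
  define c where "c s = \<sigma> * c0 s" for s
  have scale: "(\<Sum>s\<in>T. c s * k s) = \<sigma> * (\<Sum>s\<in>T. c0 s * k s)" for k
    by (simp add: c_def sum_distrib_left mult.assoc)
  have null: "(\<Sum>s\<in>T. c s * f i s) = 0" if "i \<in> I" for i using c0(2)[OF that] by (simp add: scale)
  have "\<exists>s\<in>T. c s < 0"
  proof (rule ccontr)
    assume "\<not> (\<exists>s\<in>T. c s < 0)"
    then have nonneg: "0 \<le> c s * (\<Sum>i\<in>I. l i * f i s)" if "s \<in> T" for s
      using that pos[OF that] by (intro mult_nonneg_nonneg) (auto simp: not_less)
    have "(\<Sum>s\<in>T. c s * (\<Sum>i\<in>I. l i * f i s)) = (\<Sum>i\<in>I. l i * (\<Sum>s\<in>T. c s * f i s))"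
      by (simp add: sum_distrib_left mult.left_commute) (rule sum.swap)
    also have "\<dots> = 0" using null by simp
    finally have "\<forall>s\<in>T. c s * (\<Sum>i\<in>I. l i * f i s) = 0"
      using T(1) nonneg by (subst (asm) sum_nonneg_eq_0_iff) auto
    then have "\<forall>s\<in>T. c s = 0" using pos by force
    then show False using c0(1) by (auto simp: c_def \<sigma>_def split: if_splits)
  qed
  moreover have "(\<Sum>s\<in>T. c s * h s) \<le> 0" by (simp add: scale \<sigma>_def)
  ultimately show thesis using null that by blast
qed

lemma exists_boundary_step:
  fixes p c :: "'s \<Rightarrow> real"
  assumes fin: "finite T" and pos: "\<And>s. s \<in> T \<Longrightarrow> 0 < p s" and neg: "\<exists>s\<in>T. c s < 0"
  obtains t r where "0 \<le> t" "\<And>s. s \<in> T \<Longrightarrow> 0 \<le> p s + t * c s" "r \<in> T" "p r + t * c r = 0"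
proof -
  define N where "N = {s\<in>T. c s < 0}"
  have "finite N" "N \<noteq> {}" using fin neg by (auto simp: N_def)
  then obtain r where r: "r \<in> N" "\<And>s. s \<in> N \<Longrightarrow> p r / - c r \<le> p s / - c s"
    using ex_is_arg_min_if_finite[of N "\<lambda>s. p s / - c s"] by (auto simp: is_arg_min_linorder)
  define t where "t = p r / - c r"
  have t: "0 \<le> t" using r(1) pos[of r] by (auto simp: N_def t_def divide_nonneg_neg)
  have "0 \<le> p s + t * c s" if "s \<in> T" for s
  proof (cases "c s < 0")
    case True
    then have "t \<le> p s / - c s" using r(2)[of s] that by (simp add: N_def t_def)
    then have "t * - c s \<le> p s" using True by (subst (asm) pos_le_divide_eq) auto
    then show ?thesis by simp
  qed (use t pos[OF that] in simp)
  moreover have "r \<in> T" "p r + t * c r = 0" using r(1) by (auto simp: N_def t_def)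
  ultimately show thesis using t that by blast
qed

lemma basic_solution:
  fixes f :: "'i \<Rightarrow> 's \<Rightarrow> real" and h p :: "'s \<Rightarrow> real"
  assumes I: "finite I" and S: "finite S" and nonneg: "\<And>s. s \<in> S \<Longrightarrow> 0 \<le> p s"
    and pos: "\<forall>s\<in>S. 0 < (\<Sum>i\<in>I. l i * f i s)"
  shows "\<exists>q. (\<forall>s\<in>S. 0 \<le> q s) \<and> card {s\<in>S. q s \<noteq> 0} \<le> card I \<and>
      (\<forall>i\<in>I. (\<Sum>s\<in>S. q s * f i s) = (\<Sum>s\<in>S. p s * f i s)) \<and>
      (\<Sum>s\<in>S. q s * h s) \<le> (\<Sum>s\<in>S. p s * h s)"
  using nonneg
proof (induction "card {s\<in>S. p s \<noteq> 0}" arbitrary: p rule: less_induct)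
  case less
  let ?T = "{s\<in>S. p s \<noteq> 0}"
  have T: "finite ?T" using S by simp
  show ?case
  proof (cases "card ?T \<le> card I")
    case True
    then show ?thesis using less.prems by (intro exI[of _ p]) auto
  next
    case False
    then obtain c where neg: "\<exists>s\<in>?T. c s < 0" and null: "\<And>i. i \<in> I \<Longrightarrow> (\<Sum>s\<in>?T. c s * f i s) = 0"
      and descent: "(\<Sum>s\<in>?T. c s * h s) \<le> 0"
      using exists_descent_direction[OF I T, of l f h] pos by (auto simp: not_le)
    have "0 < p s" if "s \<in> ?T" for s using that less.prems by (auto simp: less_le)
    then obtain t r where t: "0 \<le> t" and step: "\<And>s. s \<in> ?T \<Longrightarrow> 0 \<le> p s + t * c s"
      and r: "r \<in> ?T" "p r + t * c r = 0"
      using exists_boundary_step[OF T _ neg, of p] by blast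
    define q where "q s = p s + (if s \<in> ?T then t * c s else 0)" for s
    have "q s = 0" if "s \<in> S" "s \<notin> ?T" for s using that by (simp add: q_def)
    moreover have "q r = 0" using r by (simp add: q_def)
    ultimately have "{s\<in>S. q s \<noteq> 0} \<subset> ?T" using r(1) by blast
    then have "card {s\<in>S. q s \<noteq> 0} < card ?T" using T by (intro psubset_card_mono)
    moreover have "0 \<le> q s" if "s \<in> S" for s using step[of s] that by (auto simp: q_def)
    ultimately obtain q' where q': "\<forall>s\<in>S. 0 \<le> q' s" "card {s\<in>S. q' s \<noteq> 0} \<le> card I"
      "\<forall>i\<in>I. (\<Sum>s\<in>S. q' s * f i s) = (\<Sum>s\<in>S. q s * f i s)"
      "(\<Sum>s\<in>S. q' s * h s) \<le> (\<Sum>s\<in>S. q s * h s)" using less.hyps by blast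
    have q: "(\<Sum>s\<in>S. q s * k s) = (\<Sum>s\<in>S. p s * k s) + t * (\<Sum>s\<in>?T. c s * k s)" for k :: "'s \<Rightarrow> real"
    proof -
      have "(\<Sum>s\<in>S. q s * k s) = (\<Sum>s\<in>S. p s * k s) + (\<Sum>s\<in>S. if s \<in> ?T then t * (c s * k s) else 0)"
        unfolding sum.distrib[symmetric] by (intro sum.cong) (auto simp: q_def algebra_simps)
      also have "(\<Sum>s\<in>S. if s \<in> ?T then t * (c s * k s) else 0) = (\<Sum>s\<in>?T. t * (c s * k s))"
        using S by (intro sum.mono_neutral_cong_right) auto
      finally show ?thesis by (simp add: sum_distrib_left)
    qed
    have "t * (\<Sum>s\<in>?T. c s * h s) \<le> 0" using t descent by (simp add: mult_nonneg_nonpos)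
    then show ?thesis using q' by (intro exI[of _ q']) (simp add: q null)
  qed
qed

section \<open>Reweighting\<close>

definition reweighting :: "('o \<Rightarrow> 's) \<Rightarrow> 'o pmf \<Rightarrow> 'o pmf \<Rightarrow> bool" where
  "reweighting S M M' \<longleftrightarrow> (\<exists>t. (\<forall>s. 0 \<le> t s) \<and> (\<forall>\<omega>. pmf M' \<omega> = t (S \<omega>) * pmf M \<omega>))"

lemma reweighting_refl: "reweighting S M M"
  unfolding reweighting_def by (intro exI[of _ "\<lambda>_. 1"]) simp

lemma exists_basic_density:
  fixes M :: "'o pmf" and e :: "'i \<Rightarrow> 'o \<Rightarrow> real" and h :: "'o \<Rightarrow> real"
  assumes fin: "finite (set_pmf M)" and I: "finite I"
    and pos: "\<And>\<omega>. \<omega> \<in> set_pmf M \<Longrightarrow> 0 < (\<Sum>i\<in>I. l i * e i \<omega>)"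
  obtains t where "\<forall>s. 0 \<le> t s" "card {s \<in> S ` set_pmf M. t s \<noteq> 0} \<le> card I"
    "\<forall>i\<in>I. (\<Sum>\<omega>\<in>set_pmf M. t (S \<omega>) * pmf M \<omega> * e i \<omega>) = (\<Sum>\<omega>\<in>set_pmf M. pmf M \<omega> * e i \<omega>)"
    "(\<Sum>\<omega>\<in>set_pmf M. t (S \<omega>) * pmf M \<omega> * h \<omega>) \<le> (\<Sum>\<omega>\<in>set_pmf M. pmf M \<omega> * h \<omega>)"
proof -
  let ?\<Omega> = "set_pmf M"
  define fibre where "fibre g s = (\<Sum>\<omega>\<in>{\<omega>\<in>?\<Omega>. S \<omega> = s}. pmf M \<omega> * g \<omega>)" for g s
  have sum_fibre: "(\<Sum>s\<in>S ` ?\<Omega>. q s * fibre g s) = (\<Sum>\<omega>\<in>?\<Omega>. q (S \<omega>) * pmf M \<omega> * g \<omega>)" for q g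
    by (subst sum.image_gen[OF fin, of _ S])
      (auto intro!: sum.cong simp: fibre_def sum_distrib_left mult.assoc)
  have pos_fibre: "\<forall>s\<in>S ` ?\<Omega>. 0 < (\<Sum>i\<in>I. l i * fibre (e i) s)"
  proof
    fix s assume s: "s \<in> S ` ?\<Omega>"
    have "(\<Sum>i\<in>I. l i * fibre (e i) s) = (\<Sum>\<omega>\<in>{\<omega>\<in>?\<Omega>. S \<omega> = s}. pmf M \<omega> * (\<Sum>i\<in>I. l i * e i \<omega>))"
      unfolding fibre_def sum_distrib_left by (subst sum.swap) (simp add: mult.left_commute)
    also have "\<dots> > 0" using s fin by (intro sum_pos) (auto intro!: mult_pos_pos pos pmf_positive)
    finally show "0 < (\<Sum>i\<in>I. l i * fibre (e i) s)" .
  qed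
  obtain q where q: "\<forall>s\<in>S ` ?\<Omega>. 0 \<le> q s" "card {s\<in>S ` ?\<Omega>. q s \<noteq> 0} \<le> card I"
    "\<forall>i\<in>I. (\<Sum>\<omega>\<in>?\<Omega>. q (S \<omega>) * pmf M \<omega> * e i \<omega>) = (\<Sum>\<omega>\<in>?\<Omega>. 1 * pmf M \<omega> * e i \<omega>)"
    "(\<Sum>\<omega>\<in>?\<Omega>. q (S \<omega>) * pmf M \<omega> * h \<omega>) \<le> (\<Sum>\<omega>\<in>?\<Omega>. 1 * pmf M \<omega> * h \<omega>)"
    using basic_solution[where S = "S ` ?\<Omega>" and p = "\<lambda>_. 1" and f = "\<lambda>i. fibre (e i)" and h = "fibre h",
        OF I finite_imageI[OF fin] zero_le_one pos_fibre]
    unfolding sum_fibre by (elim exE conjE) (rule that)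
  define t where "t s = (if s \<in> S ` ?\<Omega> then q s else 0)" for s
  have "\<forall>s. 0 \<le> t s" using q(1) by (metis t_def order.refl)
  moreover have "{s \<in> S ` ?\<Omega>. t s \<noteq> 0} = {s \<in> S ` ?\<Omega>. q s \<noteq> 0}" by (auto simp: t_def)
  moreover have "(\<Sum>\<omega>\<in>?\<Omega>. t (S \<omega>) * pmf M \<omega> * g \<omega>) = (\<Sum>\<omega>\<in>?\<Omega>. q (S \<omega>) * pmf M \<omega> * g \<omega>)" for g
    by (intro sum.cong) (auto simp: t_def)
  ultimately show thesis using that[of t] q(2-4) by simp
qed

lemma exists_basic_reweighting:
  fixes M :: "'o pmf" and e :: "'i \<Rightarrow> 'o \<Rightarrow> real" and h :: "'o \<Rightarrow> real"
  assumes fin: "finite (set_pmf M)" and I: "finite I"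
    and unit: "\<And>\<omega>. \<omega> \<in> set_pmf M \<Longrightarrow> (\<Sum>i\<in>I. l i * e i \<omega>) = 1"
  obtains M' where "reweighting S M M'" "card (S ` set_pmf M') \<le> card I"
    "\<And>i. i \<in> I \<Longrightarrow> measure_pmf.expectation M' (e i) = measure_pmf.expectation M (e i)"
    "measure_pmf.expectation M' h \<le> measure_pmf.expectation M h"
proof -
  let ?\<Omega> = "set_pmf M"
  obtain t where t: "\<forall>s. 0 \<le> t s" "card {s \<in> S ` ?\<Omega>. t s \<noteq> 0} \<le> card I"
    and t_e: "\<forall>i\<in>I. (\<Sum>\<omega>\<in>?\<Omega>. t (S \<omega>) * pmf M \<omega> * e i \<omega>) = (\<Sum>\<omega>\<in>?\<Omega>. pmf M \<omega> * e i \<omega>)"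
    and t_h: "(\<Sum>\<omega>\<in>?\<Omega>. t (S \<omega>) * pmf M \<omega> * h \<omega>) \<le> (\<Sum>\<omega>\<in>?\<Omega>. pmf M \<omega> * h \<omega>)"
    by (rule exists_basic_density[OF fin I, of l e]) (simp add: unit)
  have "(\<Sum>\<omega>\<in>?\<Omega>. w \<omega>) = (\<Sum>i\<in>I. l i * (\<Sum>\<omega>\<in>?\<Omega>. w \<omega> * e i \<omega>))" for w
  proof -
    have "(\<Sum>\<omega>\<in>?\<Omega>. w \<omega>) = (\<Sum>\<omega>\<in>?\<Omega>. w \<omega> * (\<Sum>i\<in>I. l i * e i \<omega>))" using unit by simp
    also have "\<dots> = (\<Sum>i\<in>I. l i * (\<Sum>\<omega>\<in>?\<Omega>. w \<omega> * e i \<omega>))"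
      unfolding sum_distrib_left by (subst sum.swap) (simp add: mult.left_commute)
    finally show ?thesis .
  qed
  from this[of "\<lambda>\<omega>. t (S \<omega>) * pmf M \<omega>"] this[of "pmf M"] fin
  have "(\<Sum>\<omega>\<in>?\<Omega>. t (S \<omega>) * pmf M \<omega>) = 1" by (simp add: t_e sum_pmf_eq_1)
  then obtain M' where M': "\<And>\<omega>. pmf M' \<omega> = t (S \<omega>) * pmf M \<omega>"
    using pmf_of_weights[OF fin, of "\<lambda>\<omega>. t (S \<omega>) * pmf M \<omega>"] t(1) by (auto simp: set_pmf_iff)
  have supp: "set_pmf M' \<subseteq> ?\<Omega>" by (auto simp: set_pmf_iff M')
  have "S ` set_pmf M' \<subseteq> {s \<in> S ` ?\<Omega>. t s \<noteq> 0}" using supp by (auto simp: set_pmf_iff M')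
  then have "card (S ` set_pmf M') \<le> card {s \<in> S ` ?\<Omega>. t s \<noteq> 0}" using fin by (intro card_mono) auto
  with t(2) have "card (S ` set_pmf M') \<le> card I" by simp
  moreover have "reweighting S M M'" using M' t(1) by (auto simp: reweighting_def)
  ultimately show thesis
    using that t_e t_h by (simp add: expectation_sum[OF fin supp] expectation_sum[OF fin subset_refl] M')
qed

lemma exists_law_preserving_reweighting:
  fixes M :: "'o pmf" and e :: "'i \<Rightarrow> 'o \<Rightarrow> real" and h :: "'o \<Rightarrow> real"
  assumes fin: "finite (set_pmf M)" and I: "finite I"
  obtains M' where "reweighting S M M'" "map_pmf F M' = map_pmf F M"
    "card (S ` set_pmf M') \<le> card (F ` set_pmf M) + card I"
    "\<And>i. i \<in> I \<Longrightarrow> measure_pmf.expectation M' (e i) = measure_pmf.expectation M (e i)"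
    "measure_pmf.expectation M' h \<le> measure_pmf.expectation M h"
proof -
  let ?F = "F ` set_pmf M"
  define e' where "e' = case_sum (\<lambda>x. indicator (F -` {x})) e"
  have "(\<Sum>k\<in>?F <+> I. case_sum (\<lambda>_. 1) (\<lambda>_. 0) k * e' k \<omega>) = 1" if "\<omega> \<in> set_pmf M" for \<omega>
  proof -
    have "(\<Sum>k\<in>?F <+> I. case_sum (\<lambda>_. 1) (\<lambda>_. 0) k * e' k \<omega>) = (\<Sum>x\<in>?F. indicator (F -` {x}) \<omega>)"
      using fin I by (simp add: sum.Plus e'_def)
    also have "\<dots> = (\<Sum>x\<in>?F. if F \<omega> = x then 1 else 0)"
      by (intro sum.cong) (auto simp: indicator_def)
    also have "\<dots> = 1" using fin that by (simp add: sum.delta')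
    finally show ?thesis .
  qed
  then obtain M' where M': "reweighting S M M'" "card (S ` set_pmf M') \<le> card (?F <+> I)"
    "\<And>k. k \<in> ?F <+> I \<Longrightarrow> measure_pmf.expectation M' (e' k) = measure_pmf.expectation M (e' k)"
    "measure_pmf.expectation M' h \<le> measure_pmf.expectation M h"
    using exists_basic_reweighting[of M "?F <+> I" "case_sum (\<lambda>_. 1) (\<lambda>_. 0)" e' S h] fin I by auto
  have supp: "set_pmf M' \<subseteq> set_pmf M" using M'(1) by (auto simp: reweighting_def set_pmf_iff)
  have "pmf (map_pmf F M') x = pmf (map_pmf F M) x" for x
  proof (cases "x \<in> ?F")
    case True
    then show ?thesis using M'(3)[OF InlI] by (simp add: e'_def pmf_map)
  next
    case False
    then have "x \<notin> set_pmf (map_pmf F M)" "x \<notin> set_pmf (map_pmf F M')" using supp by auto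
    then show ?thesis by (simp only: set_pmf_iff) simp
  qed
  then have "map_pmf F M' = map_pmf F M" by (rule pmf_eqI)
  moreover have "card (S ` set_pmf M') \<le> card ?F + card I"
    using M'(2) fin I by (simp add: card_Plus)
  moreover have "measure_pmf.expectation M' (e i) = measure_pmf.expectation M (e i)" if "i \<in> I" for i
    using M'(3)[OF InrI] that by (simp add: e'_def)
  ultimately show thesis using that M'(1,4) by blast
qed

definition cond_self_info :: "'o pmf \<Rightarrow> 'o eqrel \<Rightarrow> 'o eqrel \<Rightarrow> 'o \<Rightarrow> real" where
  "cond_self_info M K L \<omega> =
    log 2 (measure_pmf.prob M (eqclass L \<omega>)) - log 2 (measure_pmf.prob M (eqclass (K \<sqinter> L) \<omega>))"

context
  fixes M M' :: "'o pmf" and S :: "'o \<Rightarrow> 's"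
  assumes fin: "finite (set_pmf M)" and rew: "reweighting S M M'"
begin

lemma set_pmf_reweighting: "set_pmf M' \<subseteq> set_pmf M"
  using rew by (auto simp: reweighting_def set_pmf_iff)

lemma finite_reweighting: "finite (set_pmf M')"
  using set_pmf_reweighting fin by (rule finite_subset)

lemma prob_reweighting:
  obtains t where "\<forall>\<omega>\<in>set_pmf M'. 0 < t (S \<omega>)"
    "\<forall>A s. (\<forall>\<omega>\<in>A. S \<omega> = s) \<longrightarrow> measure_pmf.prob M' A = t s * measure_pmf.prob M A"
proof -
  obtain t where t: "\<And>s. 0 \<le> t s" "\<And>\<omega>. pmf M' \<omega> = t (S \<omega>) * pmf M \<omega>"
    using rew by (auto simp: reweighting_def)
  have "\<forall>\<omega>\<in>set_pmf M'. 0 < t (S \<omega>)"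
    using t by (auto simp: set_pmf_iff less_le)
  moreover have "measure_pmf.prob M' A = t s * measure_pmf.prob M A" if "\<forall>\<omega>\<in>A. S \<omega> = s" for A s
    unfolding prob_sum[OF fin set_pmf_reweighting] prob_sum[OF fin subset_refl] sum_distrib_left
    using that by (intro sum.cong) (auto simp: t)
  ultimately show thesis using that by blast
qed

text \<open>The density cancels in the conditional law given any variable that determines \<open>S\<close>, so
  conditional entropies become linear in the reweighted law.\<close>

lemma cond_ent_reweighting:
  assumes "L \<le> ker S"
  shows "cond_ent M' K L = measure_pmf.expectation M' (cond_self_info M K L)"
proof -
  obtain t where t: "\<forall>\<omega>\<in>set_pmf M'. 0 < t (S \<omega>)"
    "\<forall>A s. (\<forall>\<omega>\<in>A. S \<omega> = s) \<longrightarrow> measure_pmf.prob M' A = t s * measure_pmf.prob M A"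
    by (rule prob_reweighting)
  have log_prob: "log 2 (measure_pmf.prob M' (eqclass N \<omega>))
      = log 2 (t (S \<omega>)) + log 2 (measure_pmf.prob M (eqclass N \<omega>))"
    if "N \<le> L" "\<omega> \<in> set_pmf M'" for N \<omega>
  proof -
    have "S \<omega>' = S \<omega>" if "\<omega>' \<in> eqclass N \<omega>" for \<omega>'
      using that le_eqrelD[OF order.trans[OF \<open>N \<le> L\<close> assms], of \<omega> \<omega>'] by (simp add: eqclass_def)
    then have "measure_pmf.prob M' (eqclass N \<omega>) = t (S \<omega>) * measure_pmf.prob M (eqclass N \<omega>)"
      using t(2) by blast
    moreover have "0 < measure_pmf.prob M (eqclass N \<omega>)"
      using that set_pmf_reweighting by (intro measure_pmf_posI[OF _ self_in_eqclass]) auto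
    ultimately show ?thesis using t(1) that(2) by (simp add: log_mult_pos)
  qed
  have "cond_ent M' K L = measure_pmf.expectation M'
      (\<lambda>\<omega>. log 2 (measure_pmf.prob M' (eqclass L \<omega>)) - log 2 (measure_pmf.prob M' (eqclass (K \<sqinter> L) \<omega>)))"
    by (simp add: cond_ent_def ent_def integrable_measure_pmf_finite[OF finite_reweighting])
  also have "\<dots> = measure_pmf.expectation M' (cond_self_info M K L)"
    by (intro integral_cong_AE) (auto simp: AE_measure_pmf_iff log_prob cond_self_info_def)
  finally show ?thesis .
qed

lemma mis_markov_reweighting:
  assumes mk: "mis_markov M A B C" and S: "\<And>\<omega>. S \<omega> = s (A \<omega>)" and B: "map_pmf B M' = map_pmf B M"
  shows "map_pmf (\<lambda>\<omega>. (B \<omega>, C \<omega>)) M' = map_pmf (\<lambda>\<omega>. (B \<omega>, C \<omega>)) M" and "mis_markov M' A B C"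
proof -
  let ?p = "mis_pr M" and ?p' = "mis_pr M'"
  let ?ABC = "\<lambda>\<omega>. (A \<omega>, B \<omega>, C \<omega>)" and ?AB = "\<lambda>\<omega>. (A \<omega>, B \<omega>)" and ?BC = "\<lambda>\<omega>. (B \<omega>, C \<omega>)"
  obtain t where t: "\<forall>A s. (\<forall>\<omega>\<in>A. S \<omega> = s) \<longrightarrow> measure_pmf.prob M' A = t s * measure_pmf.prob M A"
    using prob_reweighting by metis
  have mk': "?p ?ABC (a, b, c) * ?p B b = ?p ?AB (a, b) * ?p ?BC (b, c)" for a b c
    using mk by (simp add: mis_markov_def)
  have ABC: "?p' ?ABC (a, b, c) = t (s a) * ?p ?ABC (a, b, c)" for a b c
    unfolding mis_pr_def by (intro t[rule_format]) (auto simp: S)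
  have AB: "?p' ?AB (a, b) = t (s a) * ?p ?AB (a, b)" for a b
    unfolding mis_pr_def by (intro t[rule_format]) (auto simp: S)
  have B: "?p' B b = ?p B b" for b using B by (simp add: mis_pr_eq_pmf)
  have BC: "?p' ?BC (b, c) = ?p ?BC (b, c)" for b c
  proof (cases "?p B b = 0")
    case True
    then have "mis_pr N ?BC (b, c) = 0" if "N = M \<or> N = M'" for N
      using that B[of b] by (intro mis_pr_eq_0_mono[of N B fst]) auto
    then show ?thesis by simp
  next
    case False
    have "?p' ?BC (b, c) * ?p B b = (\<Sum>a\<in>A ` set_pmf M'. ?p' ?ABC (a, b, c)) * ?p B b"
      using sum_mis_pr_Pair[OF finite_reweighting, of A ?BC "(b, c)"] by simp
    also have "\<dots> = (\<Sum>a\<in>A ` set_pmf M'. ?p' ?AB (a, b)) * ?p ?BC (b, c)"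
      unfolding sum_distrib_right ABC AB mult.assoc mk' ..
    also have "\<dots> = ?p B b * ?p ?BC (b, c)"
      unfolding sum_mis_pr_Pair[OF finite_reweighting] B ..
    finally show ?thesis using False by simp
  qed
  then show "map_pmf ?BC M' = map_pmf ?BC M"
    by (intro pmf_eqI) (auto simp: mis_pr_eq_pmf)
  show "mis_markov M' A B C"
    unfolding mis_markov_def ABC AB B BC using mk' by (simp add: mult.assoc)
qed

end

section \<open>Layered codes\<close>

text \<open>A coarse description \<open>W\<close> of \<open>X\<close> is decoded with side information \<open>Z\<close>, a refinement \<open>U\<close> only
  with side information \<open>Y\<close>. In \<open>RM_1\<close> and \<open>RM_2\<close> each component of the source contributes the rate
  of such a code, with \<open>Z\<close> either its weaker side information or \<open>Y\<close> itself.\<close>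

definition layered_rate :: "'o pmf \<Rightarrow> 'o eqrel \<Rightarrow> 'o eqrel \<Rightarrow> 'o eqrel \<Rightarrow> 'o eqrel \<Rightarrow> 'o eqrel \<Rightarrow> real" where
  "layered_rate M x w u y z = cond_info M x w z + cond_info M x u (y \<sqinter> w)"

abbreviation code_rate ::
  "'o pmf \<Rightarrow> ('o \<Rightarrow> 'x) \<Rightarrow> ('o \<Rightarrow> 'w) \<Rightarrow> ('o \<Rightarrow> 'u) \<Rightarrow> ('o \<Rightarrow> 'y) \<Rightarrow> ('o \<Rightarrow> 'z) \<Rightarrow> real" where
  "code_rate M X W U Y Z \<equiv> layered_rate M (ker X) (ker W) (ker U) (ker Y) (ker Z)"

lemma layered_rate_eq:
  "layered_rate M x w u y z =
    cond_ent M x z - cond_ent M x (w \<sqinter> z) + cond_ent M x (y \<sqinter> w) - cond_ent M x (u \<sqinter> (y \<sqinter> w))"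
  by (simp add: layered_rate_def cond_info_def)

lemma layered_rate_map:
  "layered_rate (map_pmf f M) x w u y z =
    layered_rate M (pullback f x) (pullback f w) (pullback f u) (pullback f y) (pullback f z)"
  by (simp add: layered_rate_def cond_info_map)

locale layered_code =
  fixes M :: "'o pmf" and X :: "'o \<Rightarrow> 'x::finite" and Y :: "'o \<Rightarrow> 'y" and Z :: "'o \<Rightarrow> 'z"
    and W :: "'o \<Rightarrow> 'w" and U :: "'o \<Rightarrow> 'u"
    and d :: "'x \<Rightarrow> 'r \<Rightarrow> real" and \<delta> :: real and d' :: "'x \<Rightarrow> 's \<Rightarrow> real" and \<delta>' :: real
  assumes finite_law: "finite (set_pmf M)"
    and markov: "mis_markov M (\<lambda>\<omega>. (W \<omega>, U \<omega>)) X (\<lambda>\<omega>. (Y \<omega>, Z \<omega>))"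
    and fine_reconstruction: "reconstructible M d X (\<lambda>\<omega>. (W \<omega>, U \<omega>, Y \<omega>)) \<delta>"
    and coarse_reconstruction: "reconstructible M d' X (\<lambda>\<omega>. (W \<omega>, Z \<omega>)) \<delta>'"

lemma layered_code_map:
  assumes "finite (set_pmf M)"
  shows "layered_code (map_pmf f M) X Y Z W U d \<delta> d' \<delta>' \<longleftrightarrow>
    layered_code M (\<lambda>\<omega>. X (f \<omega>)) (\<lambda>\<omega>. Y (f \<omega>)) (\<lambda>\<omega>. Z (f \<omega>)) (\<lambda>\<omega>. W (f \<omega>)) (\<lambda>\<omega>. U (f \<omega>)) d \<delta> d' \<delta>'"
  using assms by (simp add: layered_code_def mis_markov_map reconstructible_map)

lemma (in finite_pmf_limit) layered_code_limit:
  fixes d :: "'x::finite \<Rightarrow> 'r::finite \<Rightarrow> real" and d' :: "'x \<Rightarrow> 's::finite \<Rightarrow> real"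
  assumes codes: "\<And>n. layered_code (Ms n) X Y Z W U d (\<delta> n) d' (\<delta>' n)"
    and lim: "\<delta> \<longlonglongrightarrow> \<delta>0" "\<delta>' \<longlonglongrightarrow> \<delta>0'"
  shows "layered_code M X Y Z W U d \<delta>0 d' \<delta>0'"
proof
  show "finite (set_pmf M)" by (rule finite_support_limit)
  show "mis_markov M (\<lambda>\<omega>. (W \<omega>, U \<omega>)) X (\<lambda>\<omega>. (Y \<omega>, Z \<omega>))"
    using layered_code.markov[OF codes] cond_indep_limit
    unfolding mis_markov_iff_cond_indep[OF finite_support]
      mis_markov_iff_cond_indep[OF finite_support_limit]
    by blast
  show "reconstructible M d X (\<lambda>\<omega>. (W \<omega>, U \<omega>, Y \<omega>)) \<delta>0"
    using layered_code.fine_reconstruction[OF codes] lim(1) by (rule reconstructible_limit)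
  show "reconstructible M d' X (\<lambda>\<omega>. (W \<omega>, Z \<omega>)) \<delta>0'"
    using layered_code.coarse_reconstruction[OF codes] lim(2) by (rule reconstructible_limit)
qed

lemma (in finite_pmf_limit) tendsto_layered_rate:
  "(\<lambda>n. layered_rate (Ms n) x w u y z) \<longlonglongrightarrow> layered_rate M x w u y z"
  unfolding layered_rate_def by (intro tendsto_intros tendsto_cond_info)

definition layered_self_info ::
  "'o pmf \<Rightarrow> 'o eqrel \<Rightarrow> 'o eqrel \<Rightarrow> 'o eqrel \<Rightarrow> 'o eqrel \<Rightarrow> 'o eqrel \<Rightarrow> 'o \<Rightarrow> real" where
  "layered_self_info M x w u y z \<omega> =
    cond_self_info M x (y \<sqinter> w) \<omega> - cond_self_info M x (w \<sqinter> z) \<omega> - cond_self_info M x (u \<sqinter> (y \<sqinter> w)) \<omega>"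

lemma layered_rate_reweighting:
  assumes fin: "finite (set_pmf M)" and rew: "reweighting W M N"
  shows "layered_rate N x (ker W) u y z
    = cond_ent N x z + measure_pmf.expectation N (layered_self_info M x (ker W) u y z)"
  using finite_reweighting[OF fin rew]
  by (simp add: layered_rate_eq layered_self_info_def[abs_def] cond_ent_reweighting[OF fin rew]
      le_infI1 le_infI2 integrable_measure_pmf_finite)

lemma layered_rate_refinement_cong_law:
  assumes law: "map_pmf (\<lambda>\<omega>. (X \<omega>, W \<omega>, Y \<omega>, Z \<omega>)) M' = map_pmf (\<lambda>\<omega>. (X \<omega>, W \<omega>, Y \<omega>, Z \<omega>)) M"
  shows "layered_rate M' (ker X) (ker W) u (ker Y) (ker Z) + cond_ent M' (ker X) (u \<sqinter> (ker Y \<sqinter> ker W))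
    = layered_rate M (ker X) (ker W) u (ker Y) (ker Z) + cond_ent M (ker X) (u \<sqinter> (ker Y \<sqinter> ker W))"
proof -
  note law_factor = map_pmf_factor[OF law]
  have "cond_ent M' (ker X) (ker Z) = cond_ent M (ker X) (ker Z)"
    "cond_ent M' (ker X) (ker (\<lambda>\<omega>. (Y \<omega>, W \<omega>))) = cond_ent M (ker X) (ker (\<lambda>\<omega>. (Y \<omega>, W \<omega>)))"
    "cond_ent M' (ker X) (ker (\<lambda>\<omega>. (W \<omega>, Z \<omega>))) = cond_ent M (ker X) (ker (\<lambda>\<omega>. (W \<omega>, Z \<omega>)))"
    using law_factor[of "\<lambda>(x, w, y, z). (x, z)"] law_factor[of "\<lambda>(x, w, y, z). (x, y, w)"]
      law_factor[of "\<lambda>(x, w, y, z). (x, w, z)"]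
    by - (intro cond_ent_cong_law; simp)+
  then show ?thesis by (simp add: layered_rate_eq)
qed

context layered_code
begin

abbreviation law :: "'o pmf \<Rightarrow> ('x \<times> 'y \<times> 'z) pmf" where
  "law N \<equiv> map_pmf (\<lambda>\<omega>. (X \<omega>, Y \<omega>, Z \<omega>)) N"

abbreviation fine_rate :: "'o pmf \<Rightarrow> real" where
  "fine_rate N \<equiv> code_rate N X W U Y Y"

abbreviation coarse_rate :: "'o pmf \<Rightarrow> real" where
  "coarse_rate N \<equiv> code_rate N X W U Y Z"

text \<open>Preserving the law of \<open>X\<close>, \<open>coarse_rate\<close> and the two distortions, with \<open>fine_rate\<close> as the
  objective, yields the bound \<open>CARD('x) + 3\<close>.\<close>

lemma exists_small_W:
  obtains M' where "layered_code M' X Y Z W U d \<delta> d' \<delta>'" "law M' = law M"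
    "card (W ` set_pmf M') \<le> CARD('x) + 3" "fine_rate M' \<le> fine_rate M" "coarse_rate M' \<le> coarse_rate M"
proof -
  obtain g where g: "measure_pmf.expectation M (\<lambda>\<omega>. d (X \<omega>) (g (W \<omega>, U \<omega>, Y \<omega>))) \<le> \<delta>"
    using fine_reconstruction by (auto simp: reconstructible_def)
  obtain g' where g': "measure_pmf.expectation M (\<lambda>\<omega>. d' (X \<omega>) (g' (W \<omega>, Z \<omega>))) \<le> \<delta>'"
    using coarse_reconstruction by (auto simp: reconstructible_def)
  let ?info = "layered_self_info M (ker X) (ker W) (ker U) (ker Y)"
  define e where "e = (!) [?info (ker Z), \<lambda>\<omega>. d (X \<omega>) (g (W \<omega>, U \<omega>, Y \<omega>)), \<lambda>\<omega>. d' (X \<omega>) (g' (W \<omega>, Z \<omega>))]"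
  obtain M' where M': "reweighting W M M'" "map_pmf X M' = map_pmf X M"
    "card (W ` set_pmf M') \<le> card (X ` set_pmf M) + card {..<3::nat}"
    "\<And>i. i \<in> {..<3} \<Longrightarrow> measure_pmf.expectation M' (e i) = measure_pmf.expectation M (e i)"
    "measure_pmf.expectation M' (?info (ker Y)) \<le> measure_pmf.expectation M (?info (ker Y))"
    using exists_law_preserving_reweighting[OF finite_law finite_lessThan] by blast
  have law: "law M' = law M" and markov': "mis_markov M' (\<lambda>\<omega>. (W \<omega>, U \<omega>)) X (\<lambda>\<omega>. (Y \<omega>, Z \<omega>))"
    using mis_markov_reweighting[OF finite_law M'(1) markov _ M'(2), of fst] by simp_all
  note rate = layered_rate_reweighting[OF finite_law M'(1)]
    layered_rate_reweighting[OF finite_law reweighting_refl]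
  have preserved: "cond_ent M' (ker X) (ker Y) = cond_ent M (ker X) (ker Y)"
    "cond_ent M' (ker X) (ker Z) = cond_ent M (ker X) (ker Z)"
    using map_pmf_factor[OF law, of "\<lambda>(x, y, z). (x, y)"] map_pmf_factor[OF law, of "\<lambda>(x, y, z). (x, z)"]
    by (auto intro: cond_ent_cong_law)
  show thesis
  proof
    show "layered_code M' X Y Z W U d \<delta> d' \<delta>'"
    proof
      show "reconstructible M' d X (\<lambda>\<omega>. (W \<omega>, U \<omega>, Y \<omega>)) \<delta>"
        unfolding reconstructible_def using g M'(4)[of 1] by (intro exI[of _ g]) (simp add: e_def)
      show "reconstructible M' d' X (\<lambda>\<omega>. (W \<omega>, Z \<omega>)) \<delta>'"
        unfolding reconstructible_def using g' M'(4)[of 2] by (intro exI[of _ g']) (simp add: e_def)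
    qed (use markov' finite_reweighting[OF finite_law M'(1)] in auto)
    have "card (X ` set_pmf M) \<le> CARD('x)" by (intro card_mono) auto
    then show "card (W ` set_pmf M') \<le> CARD('x) + 3" using M'(3) by simp
    show "fine_rate M' \<le> fine_rate M"
      using M'(5) by (simp add: rate preserved)
    show "coarse_rate M' \<le> coarse_rate M"
      using M'(4)[of 0] by (simp add: rate preserved e_def)
  qed (rule law)
qed

lemma markov_U: "mis_markov M U (\<lambda>\<omega>. (X \<omega>, W \<omega>)) (\<lambda>\<omega>. (Y \<omega>, Z \<omega>))"
  and markov_W: "mis_markov M W X (\<lambda>\<omega>. (Y \<omega>, Z \<omega>))"
proof -
  have "cond_indep M (ker Y \<sqinter> ker Z) (ker W \<sqinter> ker U) (ker X)"
    using markov by (simp add: mis_markov_iff_cond_indep[OF finite_law] cond_indep_commute)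
  then have "cond_indep M (ker Y \<sqinter> ker Z) (ker U) (ker W \<sqinter> ker X)"
    "cond_indep M (ker Y \<sqinter> ker Z) (ker W) (ker X)"
    using cond_indep_weak_union[OF finite_law] cond_indep_mono_right[OF finite_law]
    by (blast intro: inf_le1)+
  then show "mis_markov M U (\<lambda>\<omega>. (X \<omega>, W \<omega>)) (\<lambda>\<omega>. (Y \<omega>, Z \<omega>))" "mis_markov M W X (\<lambda>\<omega>. (Y \<omega>, Z \<omega>))"
    by (simp_all add: mis_markov_iff_cond_indep[OF finite_law] cond_indep_commute inf_commute)
qed

lemma reweighting_U:
  assumes rew: "reweighting U M M'" and XW: "map_pmf (\<lambda>\<omega>. (X \<omega>, W \<omega>)) M' = map_pmf (\<lambda>\<omega>. (X \<omega>, W \<omega>)) M"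
  shows "map_pmf (\<lambda>\<omega>. ((X \<omega>, W \<omega>), Y \<omega>, Z \<omega>)) M' = map_pmf (\<lambda>\<omega>. ((X \<omega>, W \<omega>), Y \<omega>, Z \<omega>)) M"
    and "mis_markov M' (\<lambda>\<omega>. (W \<omega>, U \<omega>)) X (\<lambda>\<omega>. (Y \<omega>, Z \<omega>))"
proof -
  note reweighted = mis_markov_reweighting[OF finite_law rew markov_U _ XW, of "\<lambda>u. u"]
  show law: "map_pmf (\<lambda>\<omega>. ((X \<omega>, W \<omega>), Y \<omega>, Z \<omega>)) M' = map_pmf (\<lambda>\<omega>. ((X \<omega>, W \<omega>), Y \<omega>, Z \<omega>)) M"
    using reweighted(1) by simp
  have markov_U': "mis_markov M' U (\<lambda>\<omega>. (X \<omega>, W \<omega>)) (\<lambda>\<omega>. (Y \<omega>, Z \<omega>))"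
    using reweighted(2) by simp
  have "mis_markov M' W X (\<lambda>\<omega>. (Y \<omega>, Z \<omega>))"
    using mis_markov_cong_law[OF map_pmf_factor[OF law, of "\<lambda>((x, w), y, z). (w, x, y, z)", simplified]]
      markov_W by simp
  then show "mis_markov M' (\<lambda>\<omega>. (W \<omega>, U \<omega>)) X (\<lambda>\<omega>. (Y \<omega>, Z \<omega>))"
    using markov_U' cond_indep_contraction[of M' "ker Y \<sqinter> ker Z" "ker W" "ker X" "ker U"]
    by (simp add: mis_markov_iff_cond_indep[OF finite_reweighting[OF finite_law rew]]
        cond_indep_commute inf_commute)
qed

text \<open>Here the joint law of \<open>X\<close>, \<open>W\<close> and the side informations is preserved, hence the coarse
  distortion and all terms of the rates but the last.\<close>

lemma exists_small_U:
  obtains M' where "layered_code M' X Y Z W U d \<delta> d' \<delta>'" "law M' = law M" "set_pmf M' \<subseteq> set_pmf M"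
    "card (U ` set_pmf M') \<le> CARD('x) * card (W ` set_pmf M) + 1"
    "fine_rate M' \<le> fine_rate M" "coarse_rate M' \<le> coarse_rate M"
proof -
  let ?XW = "\<lambda>\<omega>. (X \<omega>, W \<omega>)" and ?L = "ker U \<sqinter> (ker Y \<sqinter> ker W)"
  obtain g where g: "measure_pmf.expectation M (\<lambda>\<omega>. d (X \<omega>) (g (W \<omega>, U \<omega>, Y \<omega>))) \<le> \<delta>"
    using fine_reconstruction by (auto simp: reconstructible_def)
  obtain M' where rew: "reweighting U M M'" and XW: "map_pmf ?XW M' = map_pmf ?XW M"
    and card: "card (U ` set_pmf M') \<le> card (?XW ` set_pmf M) + 1"
    and distortion: "measure_pmf.expectation M' (\<lambda>\<omega>. d (X \<omega>) (g (W \<omega>, U \<omega>, Y \<omega>)))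
      = measure_pmf.expectation M (\<lambda>\<omega>. d (X \<omega>) (g (W \<omega>, U \<omega>, Y \<omega>)))"
    and descent: "measure_pmf.expectation M' (\<lambda>\<omega>. - cond_self_info M (ker X) ?L \<omega>)
      \<le> measure_pmf.expectation M (\<lambda>\<omega>. - cond_self_info M (ker X) ?L \<omega>)"
    using exists_law_preserving_reweighting[OF finite_law, of "{()}" U ?XW
        "\<lambda>_ \<omega>. d (X \<omega>) (g (W \<omega>, U \<omega>, Y \<omega>))" "\<lambda>\<omega>. - cond_self_info M (ker X) ?L \<omega>"] by auto
  note law_factor = map_pmf_factor[OF reweighting_U(1)[OF rew XW]]
  have cond_ent_le: "cond_ent M (ker X) ?L \<le> cond_ent M' (ker X) ?L"
    using descent cond_ent_reweighting[OF finite_law rew, of ?L "ker X"]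
      cond_ent_reweighting[OF finite_law reweighting_refl, of ?L U "ker X"] by simp
  show thesis
  proof
    show "layered_code M' X Y Z W U d \<delta> d' \<delta>'"
    proof
      show "reconstructible M' d X (\<lambda>\<omega>. (W \<omega>, U \<omega>, Y \<omega>)) \<delta>"
        unfolding reconstructible_def using g distortion by (intro exI[of _ g]) simp
      show "reconstructible M' d' X (\<lambda>\<omega>. (W \<omega>, Z \<omega>)) \<delta>'"
        using law_factor[of "\<lambda>((x, w), y, z). (x, w, z)"]
        by (intro iffD2[OF reconstructible_cong_law coarse_reconstruction]) simp
    qed (use reweighting_U(2)[OF rew XW] finite_reweighting[OF finite_law rew] in auto)
    show "law M' = law M" using law_factor[of "\<lambda>((x, w), y, z). (x, y, z)"] by simp
    show "set_pmf M' \<subseteq> set_pmf M" by (rule set_pmf_reweighting[OF finite_law rew])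
    have "card (?XW ` set_pmf M) \<le> card ((UNIV :: 'x set) \<times> W ` set_pmf M)"
      using finite_law by (intro card_mono) auto
    then show "card (U ` set_pmf M') \<le> CARD('x) * card (W ` set_pmf M) + 1"
      using card by (simp add: card_cartesian_product)
    show "fine_rate M' \<le> fine_rate M"
      using cond_ent_le layered_rate_refinement_cong_law[of X W Y Y M' M "ker U"]
        law_factor[of "\<lambda>((x, w), y, z). (x, w, y, y)"] by simp
    show "coarse_rate M' \<le> coarse_rate M"
      using cond_ent_le layered_rate_refinement_cong_law[of X W Y Z M' M "ker U"]
        law_factor[of "\<lambda>((x, w), y, z). (x, w, y, z)"] by simp
  qed
qed

lemma exists_nat_labels:
  obtains W' U' :: "'o \<Rightarrow> nat" where "layered_code M X Y Z W' U' d \<delta> d' \<delta>'"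
    "\<And>\<omega>. \<omega> \<in> set_pmf M \<Longrightarrow> W' \<omega> < card (W ` set_pmf M)" "\<And>\<omega>. \<omega> \<in> set_pmf M \<Longrightarrow> U' \<omega> < card (U ` set_pmf M)"
    "\<And>z. layered_rate M (ker X) (ker W') (ker U') (ker Y) z
      = layered_rate M (ker X) (ker W) (ker U) (ker Y) z"
proof -
  let ?A = "W ` set_pmf M" and ?B = "U ` set_pmf M"
  define W' where "W' \<omega> = to_nat_on ?A (W \<omega>)" for \<omega>
  define U' where "U' \<omega> = to_nat_on ?B (U \<omega>)" for \<omega>
  have fin: "finite ?A" "finite ?B" using finite_law by auto
  have agree: "agree_on (set_pmf M) (ker W') (ker W)" "agree_on (set_pmf M) (ker U') (ker U)"
    unfolding W'_def[abs_def] U'_def[abs_def]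
    using fin by (auto intro!: agree_on_ker_inj inj_on_to_nat_on countable_finite)
  have decode: "from_nat_into ?A (W' \<omega>) = W \<omega>" "from_nat_into ?B (U' \<omega>) = U \<omega>" if "\<omega> \<in> set_pmf M" for \<omega>
    using that fin by (auto simp: W'_def U'_def countable_finite)
  show thesis
  proof
    show "layered_code M X Y Z W' U' d \<delta> d' \<delta>'"
    proof
      have "cond_info M (ker W' \<sqinter> ker U') (ker Y \<sqinter> ker Z) (ker X)
          = cond_info M (ker W \<sqinter> ker U) (ker Y \<sqinter> ker Z) (ker X)"
        by (intro cond_info_agree_on agree_on_inf agree agree_on_refl)
      then show "mis_markov M (\<lambda>\<omega>. (W' \<omega>, U' \<omega>)) X (\<lambda>\<omega>. (Y \<omega>, Z \<omega>))"
        using markov by (simp add: mis_markov_iff_cond_indep[OF finite_law] cond_indep_def)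
      show "reconstructible M d X (\<lambda>\<omega>. (W' \<omega>, U' \<omega>, Y \<omega>)) \<delta>"
        by (rule reconstructible_factor[OF fine_reconstruction,
              where h = "\<lambda>(w, u, y). (from_nat_into ?A w, from_nat_into ?B u, y)"]) (simp add: decode)
      show "reconstructible M d' X (\<lambda>\<omega>. (W' \<omega>, Z \<omega>)) \<delta>'"
        by (rule reconstructible_factor[OF coarse_reconstruction,
              where h = "\<lambda>(w, z). (from_nat_into ?A w, z)"]) (simp add: decode)
    qed (rule finite_law)
    show "W' \<omega> < card ?A" "U' \<omega> < card ?B" if "\<omega> \<in> set_pmf M" for \<omega>
      using that to_nat_on_finite[OF fin(1)] to_nat_on_finite[OF fin(2)]
      by (auto simp: W'_def U'_def bij_betw_def)
    show "layered_rate M (ker X) (ker W') (ker U') (ker Y) z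
        = layered_rate M (ker X) (ker W) (ker U) (ker Y) z" for z
      unfolding layered_rate_def
      by (intro arg_cong2[of _ _ _ _ "(+)"] cond_info_agree_on agree_on_inf agree agree_on_refl)
  qed
qed

lemma cardinality_bound:
  obtains M' and W' U' :: "'o \<Rightarrow> nat" where "layered_code M' X Y Z W' U' d \<delta> d' \<delta>'" "law M' = law M"
    "\<forall>\<omega>\<in>set_pmf M'. W' \<omega> < CARD('x) + 3 \<and> U' \<omega> < CARD('x) * (CARD('x) + 3) + 1"
    "code_rate M' X W' U' Y Y \<le> fine_rate M"
    "code_rate M' X W' U' Y Z \<le> coarse_rate M"
proof -
  obtain M1 where M1: "layered_code M1 X Y Z W U d \<delta> d' \<delta>'" "law M1 = law M"
    "card (W ` set_pmf M1) \<le> CARD('x) + 3" "fine_rate M1 \<le> fine_rate M" "coarse_rate M1 \<le> coarse_rate M"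
    by (rule exists_small_W)
  obtain M2 where M2: "layered_code M2 X Y Z W U d \<delta> d' \<delta>'" "law M2 = law M1" "set_pmf M2 \<subseteq> set_pmf M1"
    "card (U ` set_pmf M2) \<le> CARD('x) * card (W ` set_pmf M1) + 1"
    "fine_rate M2 \<le> fine_rate M1" "coarse_rate M2 \<le> coarse_rate M1"
    by (rule layered_code.exists_small_U[OF M1(1)])
  obtain W' U' :: "'o \<Rightarrow> nat" where labels: "layered_code M2 X Y Z W' U' d \<delta> d' \<delta>'"
    "\<And>\<omega>. \<omega> \<in> set_pmf M2 \<Longrightarrow> W' \<omega> < card (W ` set_pmf M2)"
    "\<And>\<omega>. \<omega> \<in> set_pmf M2 \<Longrightarrow> U' \<omega> < card (U ` set_pmf M2)"
    "\<And>z. layered_rate M2 (ker X) (ker W') (ker U') (ker Y) z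
      = layered_rate M2 (ker X) (ker W) (ker U) (ker Y) z"
    using layered_code.exists_nat_labels[OF M2(1)] by blast
  have "card (W ` set_pmf M2) \<le> CARD('x) + 3"
    using M1(3) card_mono[OF _ image_mono[OF M2(3)], of W] layered_code.finite_law[OF M1(1)] by simp
  moreover have "card (U ` set_pmf M2) \<le> CARD('x) * (CARD('x) + 3) + 1"
    by (rule order.trans[OF M2(4)]) (intro add_right_mono mult_le_mono2 M1(3))
  ultimately show thesis
    using that[OF labels(1)] labels(2-4) M1 M2 by (fastforce elim: less_le_trans)
qed

end

section \<open>Continuity of the rate in the distortions\<close>

lemmas m_defs = mX1_def mY11_def mY21_def mW1_def mU1_def mX2_def mY12_def mY22_def mW2_def mU2_def

definition RM_alphabet ::
  "(('x1::finite \<times> 'y11 \<times> 'y21 \<times> nat \<times> nat) \<times> ('x2::finite \<times> 'y12 \<times> 'y22 \<times> nat \<times> nat)) set" where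
  "RM_alphabet = (UNIV \<times> UNIV \<times> UNIV \<times> {..<CARD('x1) + 3} \<times> {..<CARD('x1) * (CARD('x1) + 3) + 1}) \<times>
    (UNIV \<times> UNIV \<times> UNIV \<times> {..<CARD('x2) + 3} \<times> {..<CARD('x2) * (CARD('x2) + 3) + 1})"

lemma finite_RM_alphabet: "finite (RM_alphabet ::
  (('x1::finite \<times> 'y11::finite \<times> 'y21::finite \<times> nat \<times> nat) \<times>
   ('x2::finite \<times> 'y12::finite \<times> 'y22::finite \<times> nat \<times> nat)) set)"
  by (simp add: RM_alphabet_def)

lemma RM_feasible_iff_layered_codes:
  fixes P1 :: "('x1::finite \<times> 'y11::finite \<times> 'y21::finite) pmf"
    and P2 :: "('x2::finite \<times> 'y12::finite \<times> 'y22::finite) pmf"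
  shows "RM_feasible P1 P2 d11 d12 d21 d22 D Q \<longleftrightarrow>
    map_pmf (\<lambda>\<omega>. (mX1 \<omega>, mY11 \<omega>, mY21 \<omega>)) Q = P1 \<and> map_pmf (\<lambda>\<omega>. (mX2 \<omega>, mY12 \<omega>, mY22 \<omega>)) Q = P2 \<and>
    cond_indep Q (ker fst) (ker snd) \<top> \<and>
    layered_code Q mX1 mY11 mY21 mW1 mU1 d11 (D 1 1) d21 (D 2 1) \<and>
    layered_code Q mX2 mY22 mY12 mW2 mU2 d22 (D 2 2) d12 (D 1 2) \<and>
    set_pmf Q \<subseteq> RM_alphabet"
proof -
  have laws: "map_pmf (\<lambda>(x, y, y', w, u). (x, y, y')) (map_pmf fst Q)
      = map_pmf (\<lambda>\<omega>. (mX1 \<omega>, mY11 \<omega>, mY21 \<omega>)) Q"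
    "map_pmf (\<lambda>(x, y, y', w, u). (x, y, y')) (map_pmf snd Q)
      = map_pmf (\<lambda>\<omega>. (mX2 \<omega>, mY12 \<omega>, mY22 \<omega>)) Q"
    by (simp_all add: map_pmf_comp m_defs case_prod_unfold)
  have alphabet: "(\<forall>\<omega>\<in>set_pmf Q. mW1 \<omega> < CARD('x1) + 3 \<and> mU1 \<omega> < CARD('x1) * (CARD('x1) + 3) + 1 \<and>
      mW2 \<omega> < CARD('x2) + 3 \<and> mU2 \<omega> < CARD('x2) * (CARD('x2) + 3) + 1) \<longleftrightarrow> set_pmf Q \<subseteq> RM_alphabet"
    unfolding RM_alphabet_def subset_iff Ball_def by (simp add: m_defs mem_Times_iff)
  show ?thesis
  proof (cases "set_pmf Q \<subseteq> RM_alphabet")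
    case True
    then have fin: "finite (set_pmf Q)" using finite_RM_alphabet finite_subset by blast
    show ?thesis
      unfolding RM_feasible_def laws alphabet pair_pmf_marginals_iff_cond_indep[OF fin] layered_code_def
        reconstructible_triple mis_markov_iff_cond_indep[OF fin] ker_Pair
        inf_commute[of "ker mY12" "ker mY22"]
      unfolding reconstructible_Pair using True fin by blast
  next
    case False
    then show ?thesis unfolding RM_feasible_def alphabet by blast
  qed
qed

lemma RM_1_eq_layered_rate:
  assumes "finite (set_pmf Q)"
  shows "RM_1 Q = code_rate Q mX1 mW1 mU1 mY11 mY11 + code_rate Q mX2 mW2 mU2 mY22 mY12"
  by (simp add: RM_1_def layered_rate_def mis_I_eq_cond_info[OF assms])

lemma RM_2_eq_layered_rate:
  assumes "finite (set_pmf Q)"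
  shows "RM_2 Q = code_rate Q mX1 mW1 mU1 mY11 mY21 + code_rate Q mX2 mW2 mU2 mY22 mY22"
  by (simp add: RM_2_def layered_rate_def mis_I_eq_cond_info[OF assms])

context
  fixes P1 :: "('x1::finite \<times> 'y11::finite \<times> 'y21::finite) pmf"
    and P2 :: "('x2::finite \<times> 'y12::finite \<times> 'y22::finite) pmf"
    and d11 :: "'x1 \<Rightarrow> 'z11::finite \<Rightarrow> real" and d12 :: "'x2 \<Rightarrow> 'z12::finite \<Rightarrow> real"
    and d21 :: "'x1 \<Rightarrow> 'z21::finite \<Rightarrow> real" and d22 :: "'x2 \<Rightarrow> 'z22::finite \<Rightarrow> real"
begin

lemma RM_feasible_limit:
  assumes lim: "finite_pmf_limit RM_alphabet Qs Q"
    and feasible: "\<And>n. RM_feasible P1 P2 d11 d12 d21 d22 (Ds n) (Qs n)"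
    and D: "\<And>j i. (\<lambda>n. Ds n j i) \<longlonglongrightarrow> D j i"
  shows "RM_feasible P1 P2 d11 d12 d21 d22 D Q"
proof -
  interpret finite_pmf_limit RM_alphabet Qs Q by (rule lim)
  note feasible' = feasible[unfolded RM_feasible_iff_layered_codes]
  show ?thesis
    unfolding RM_feasible_iff_layered_codes
  proof (intro conjI)
    show "map_pmf (\<lambda>\<omega>. (mX1 \<omega>, mY11 \<omega>, mY21 \<omega>)) Q = P1" "map_pmf (\<lambda>\<omega>. (mX2 \<omega>, mY12 \<omega>, mY22 \<omega>)) Q = P2"
      "cond_indep Q (ker fst) (ker snd) \<top>"
      using feasible' by (auto intro!: law_limit cond_indep_limit)
    show "layered_code Q mX1 mY11 mY21 mW1 mU1 d11 (D 1 1) d21 (D 2 1)"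
      by (rule layered_code_limit[OF _ D D]) (use feasible' in blast)
    show "layered_code Q mX2 mY22 mY12 mW2 mU2 d22 (D 2 2) d12 (D 1 2)"
      by (rule layered_code_limit[OF _ D D]) (use feasible' in blast)
    show "set_pmf Q \<subseteq> RM_alphabet" by (rule support_limit)
  qed
qed

lemma RM_le_limit:
  assumes feasible: "\<And>n. RM_feasible P1 P2 d11 d12 d21 d22 (Ds n) (Qs n)"
    and rates: "\<And>n. max (RM_1 (Qs n)) (RM_2 (Qs n)) \<le> cs n"
    and D: "\<And>j i. (\<lambda>n. Ds n j i) \<longlonglongrightarrow> D j i" and c: "cs \<longlonglongrightarrow> c"
  shows "RM P1 P2 d11 d12 d21 d22 D \<le> ereal c"
proof -
  have "set_pmf (Qs n) \<subseteq> RM_alphabet" for n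
    using feasible[of n] by (simp add: RM_feasible_iff_layered_codes)
  then obtain r Q where r: "strict_mono (r :: nat \<Rightarrow> nat)"
    and lim: "finite_pmf_limit RM_alphabet (\<lambda>n. Qs (r n)) Q"
    using pmf_convergent_subsequence[OF finite_RM_alphabet] by blast
  interpret finite_pmf_limit RM_alphabet "\<lambda>n. Qs (r n)" Q by (rule lim)
  have "(\<lambda>n. Ds (r n) j i) \<longlonglongrightarrow> D j i" for j i
    using LIMSEQ_subseq_LIMSEQ[OF D r] by (simp add: o_def)
  then have "RM_feasible P1 P2 d11 d12 d21 d22 D Q"
    using feasible by (intro RM_feasible_limit[OF lim])
  then have "RM P1 P2 d11 d12 d21 d22 D \<le> ereal (max (RM_1 Q) (RM_2 Q))"
    unfolding RM_def by (intro INF_lower) simp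
  also have "max (RM_1 Q) (RM_2 Q) \<le> c"
  proof (rule LIMSEQ_le)
    show "(\<lambda>n. max (RM_1 (Qs (r n))) (RM_2 (Qs (r n)))) \<longlonglongrightarrow> max (RM_1 Q) (RM_2 Q)"
      unfolding RM_1_eq_layered_rate[OF finite_support] RM_1_eq_layered_rate[OF finite_support_limit]
        RM_2_eq_layered_rate[OF finite_support] RM_2_eq_layered_rate[OF finite_support_limit]
      by (intro tendsto_intros tendsto_layered_rate)
    show "(\<lambda>n. cs (r n)) \<longlonglongrightarrow> c" using LIMSEQ_subseq_LIMSEQ[OF c r] by (simp add: o_def)
  qed (use rates in blast)
  finally show ?thesis by simp
qed

lemma RM_le_Liminf_RM:
  shows "RM P1 P2 d11 d12 d21 d22 D
    \<le> Liminf (at_right 0) (\<lambda>\<epsilon>. RM P1 P2 d11 d12 d21 d22 (\<lambda>j i. D j i + \<epsilon>) - ereal \<epsilon>)"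
  unfolding le_Liminf_iff
proof (intro allI impI)
  let ?RM = "RM P1 P2 d11 d12 d21 d22"
  let ?R = "\<lambda>\<epsilon>. ?RM (\<lambda>j i. D j i + \<epsilon>) - ereal \<epsilon>"
  fix y assume "y < ?RM D"
  then obtain c where c: "y < ereal c" "ereal c < ?RM D" using ereal_dense2 by blast
  show "\<forall>\<^sub>F \<epsilon> in at_right 0. y < ?R \<epsilon>"
  proof (rule sequentially_imp_eventually_at_right[of 0 1])
    fix \<epsilon> :: "nat \<Rightarrow> real" assume \<epsilon>: "\<epsilon> \<longlonglongrightarrow> 0"
    show "\<forall>\<^sub>F n in sequentially. y < ?R (\<epsilon> n)"
    proof (rule ccontr)
      assume "\<not> (\<forall>\<^sub>F n in sequentially. y < ?R (\<epsilon> n))"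
      then obtain r :: "nat \<Rightarrow> nat" where r: "strict_mono r" "\<And>n. ?R (\<epsilon> (r n)) \<le> y"
        by (auto dest: not_eventually_sequentiallyD simp: not_less)
      have \<epsilon>_r: "(\<lambda>n. a + \<epsilon> (r n)) \<longlonglongrightarrow> a" for a
        using tendsto_add[OF tendsto_const LIMSEQ_subseq_LIMSEQ[OF \<epsilon> r(1)], of a] by (simp add: o_def)
      have "\<exists>Q. RM_feasible P1 P2 d11 d12 d21 d22 (\<lambda>j i. D j i + \<epsilon> (r n)) Q \<and>
          max (RM_1 Q) (RM_2 Q) \<le> c + \<epsilon> (r n)" for n
      proof -
        have "?R (\<epsilon> (r n)) < ereal c" using r(2) c(1) by (rule order.strict_trans1)
        then have "?RM (\<lambda>j i. D j i + \<epsilon> (r n)) < ereal (c + \<epsilon> (r n))"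
          by (cases "?RM (\<lambda>j i. D j i + \<epsilon> (r n))") auto
        then show ?thesis unfolding RM_def INF_less_iff by (auto intro: less_imp_le)
      qed
      then obtain Qs where Qs: "\<And>n. RM_feasible P1 P2 d11 d12 d21 d22 (\<lambda>j i. D j i + \<epsilon> (r n)) (Qs n)"
        "\<And>n. max (RM_1 (Qs n)) (RM_2 (Qs n)) \<le> c + \<epsilon> (r n)" by metis
      from RM_le_limit[OF Qs \<epsilon>_r \<epsilon>_r] c(2) show False by simp
    qed
  qed simp
qed

end

section \<open>Converse\<close>

locale mismatched_kernels =
  fixes M :: "'o pmf" and x1 y11 y21 x2 y12 y22 v u1 u2 :: "'o eqrel"
  assumes finite_law: "finite (set_pmf M)"
    and indep: "cond_indep M (x1 \<sqinter> y11 \<sqinter> y21) (x2 \<sqinter> y12 \<sqinter> y22) \<top>"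
    and markov: "cond_indep M (v \<sqinter> u1 \<sqinter> u2) (y11 \<sqinter> y21 \<sqinter> y12 \<sqinter> y22) (x1 \<sqinter> x2)"
    and degraded1: "cond_indep M x1 y21 y11"
    and degraded2: "cond_indep M x2 y12 y22"
begin

lemma swap: "mismatched_kernels M x2 y22 y12 x1 y21 y11 v u2 u1"
  using finite_law indep markov degraded1 degraded2
  by unfold_locales (simp_all add: cond_indep_commute inf_aci)

lemma component_markov: "cond_indep M (y11 \<sqinter> y21) (x2 \<sqinter> y12 \<sqinter> y22 \<sqinter> v \<sqinter> u1 \<sqinter> u2) x1"
proof -
  have "cond_indep M (x2 \<sqinter> y12 \<sqinter> y22) (x1 \<sqinter> y11 \<sqinter> y21) \<top>"
    using indep by (simp add: cond_indep_commute)
  from cond_indep_condition[OF finite_law this, of x1 "y11 \<sqinter> y21"]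
  have source: "cond_indep M (y11 \<sqinter> y21) (x2 \<sqinter> y12 \<sqinter> y22) x1" by (simp add: inf_aci)
  have "cond_indep M (y11 \<sqinter> y21) (v \<sqinter> u1 \<sqinter> u2) ((x2 \<sqinter> y12 \<sqinter> y22) \<sqinter> x1)"
    using cond_indep_condition[OF finite_law markov, of "y12 \<sqinter> y22" "y11 \<sqinter> y21"] by (simp add: inf_aci)
  from cond_indep_contraction[OF source this] show ?thesis by (simp add: inf_aci)
qed

lemma component_degraded: "cond_indep M y21 (x1 \<sqinter> x2 \<sqinter> y12 \<sqinter> y22 \<sqinter> v \<sqinter> u1 \<sqinter> u2) y11"
proof -
  have "cond_indep M y21 (x2 \<sqinter> y12 \<sqinter> y22 \<sqinter> v \<sqinter> u1 \<sqinter> u2) (x1 \<sqinter> y11)"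
    using cond_indep_condition[OF finite_law iffD1[OF cond_indep_commute component_markov], of y11 y21]
    by (simp add: inf_aci)
  from cond_indep_contraction[OF iffD1[OF cond_indep_commute degraded1] this]
  show ?thesis by (simp add: inf_aci)
qed

lemma fine_component_rate_le:
  "layered_rate M x1 (v \<sqinter> u2 \<sqinter> y22) (u1 \<sqinter> y12) y11 y11
    \<le> cond_info M x1 (v \<sqinter> u1) (x2 \<sqinter> y11 \<sqinter> y12) + cond_info M x1 u2 (x2 \<sqinter> v \<sqinter> u1 \<sqinter> y11 \<sqinter> y12 \<sqinter> y21 \<sqinter> y22)"
proof -
  interpret sw: mismatched_kernels M x2 y22 y12 x1 y21 y11 v u2 u1 by (rule swap)
  have "cond_indep M (x2 \<sqinter> y12) (x1 \<sqinter> y11 \<sqinter> y21) \<top>"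
    by (rule cond_indep_mono[OF finite_law sw.indep]) (simp_all add: le_infI1 le_infI2)
  from cond_indep_condition[OF finite_law this, of y11 x1]
  have side: "cond_ent M x1 y11 = cond_ent M x1 (x2 \<sqinter> y12 \<sqinter> y11)"
    by (auto dest!: cond_indep_imp_cond_ent simp: le_infI1 le_infI2 inf_aci)
  have "cond_indep M y22 (x1 \<sqinter> y21 \<sqinter> y11 \<sqinter> v \<sqinter> u2 \<sqinter> u1) (y12 \<sqinter> x2)"
    using cond_indep_condition[OF finite_law iffD1[OF cond_indep_commute sw.component_markov], of y12 y22]
    by (simp add: inf_aci)
  from cond_indep_condition[OF finite_law this, of "v \<sqinter> u1 \<sqinter> y11" x1]
  have strong: "cond_ent M x1 (v \<sqinter> u1 \<sqinter> x2 \<sqinter> y11 \<sqinter> y12)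
      = cond_ent M x1 (y22 \<sqinter> (v \<sqinter> u1 \<sqinter> x2 \<sqinter> y11 \<sqinter> y12))"
    by (auto dest!: cond_indep_imp_cond_ent simp: le_infI1 le_infI2 inf_aci)
  from cond_indep_condition[OF finite_law component_degraded, of "v \<sqinter> u1 \<sqinter> x2 \<sqinter> y12 \<sqinter> y22" x1]
  have weak: "cond_ent M x1 (y22 \<sqinter> (v \<sqinter> u1 \<sqinter> x2 \<sqinter> y11 \<sqinter> y12))
      = cond_ent M x1 (y21 \<sqinter> y22 \<sqinter> (v \<sqinter> u1 \<sqinter> x2 \<sqinter> y11 \<sqinter> y12))"
    by (auto dest!: cond_indep_imp_cond_ent simp: le_infI1 le_infI2 inf_aci)
  have "layered_rate M x1 (v \<sqinter> u2 \<sqinter> y22) (u1 \<sqinter> y12) y11 y11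
      = cond_ent M x1 y11 - cond_ent M x1 (v \<sqinter> u1 \<sqinter> u2 \<sqinter> y11 \<sqinter> y12 \<sqinter> y22)"
    by (simp add: layered_rate_eq inf_aci)
  also have "\<dots> \<le> cond_ent M x1 y11 - cond_ent M x1 (x2 \<sqinter> v \<sqinter> u1 \<sqinter> u2 \<sqinter> y11 \<sqinter> y12 \<sqinter> y21 \<sqinter> y22)"
    by (intro diff_left_mono cond_ent_mono[OF finite_law]) (simp add: le_infI1 le_infI2)
  also have "\<dots> = cond_info M x1 (v \<sqinter> u1) (x2 \<sqinter> y11 \<sqinter> y12)
      + cond_info M x1 u2 (x2 \<sqinter> v \<sqinter> u1 \<sqinter> y11 \<sqinter> y12 \<sqinter> y21 \<sqinter> y22)"
    using side strong weak by (simp add: cond_info_def inf_aci)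
  finally show ?thesis .
qed

lemma coarse_component_rate_le:
  "layered_rate M x2 (v \<sqinter> u1 \<sqinter> y11) (u2 \<sqinter> y21) y22 y12
    \<le> cond_info M x2 (v \<sqinter> u1) (y11 \<sqinter> y12) + cond_info M x2 u2 (v \<sqinter> u1 \<sqinter> y11 \<sqinter> y12 \<sqinter> y21 \<sqinter> y22)"
proof -
  interpret sw: mismatched_kernels M x2 y22 y12 x1 y21 y11 v u2 u1 by (rule swap)
  have "cond_indep M y11 (x2 \<sqinter> y12 \<sqinter> y22) \<top>"
    by (rule cond_indep_mono[OF finite_law indep]) (simp_all add: le_infI1 le_infI2)
  from cond_indep_condition[OF finite_law this, of y12 x2]
  have side: "cond_ent M x2 y12 = cond_ent M x2 (y11 \<sqinter> y12)"
    by (auto dest!: cond_indep_imp_cond_ent simp: le_infI1 le_infI2 inf_aci)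
  from cond_indep_condition[OF finite_law component_degraded, of "v \<sqinter> u1 \<sqinter> y22" x2]
  have weak: "cond_ent M x2 (y22 \<sqinter> v \<sqinter> u1 \<sqinter> y11) = cond_ent M x2 (y21 \<sqinter> (y22 \<sqinter> v \<sqinter> u1 \<sqinter> y11))"
    by (auto dest!: cond_indep_imp_cond_ent simp: le_infI1 le_infI2 inf_aci)
  from cond_indep_condition[OF finite_law sw.component_degraded, of "v \<sqinter> u1 \<sqinter> y11 \<sqinter> y21" x2]
  have strong: "cond_ent M x2 (y21 \<sqinter> (y22 \<sqinter> v \<sqinter> u1 \<sqinter> y11))
      = cond_ent M x2 (v \<sqinter> u1 \<sqinter> y11 \<sqinter> y12 \<sqinter> y21 \<sqinter> y22)"
    by (auto dest!: cond_indep_imp_cond_ent simp: le_infI1 le_infI2 inf_aci)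
  have "layered_rate M x2 (v \<sqinter> u1 \<sqinter> y11) (u2 \<sqinter> y21) y22 y12
      = cond_ent M x2 (y11 \<sqinter> y12) - cond_ent M x2 (v \<sqinter> u1 \<sqinter> y11 \<sqinter> y12)
        + cond_ent M x2 (v \<sqinter> u1 \<sqinter> y11 \<sqinter> y12 \<sqinter> y21 \<sqinter> y22) - cond_ent M x2 (u2 \<sqinter> y21 \<sqinter> y22 \<sqinter> v \<sqinter> u1 \<sqinter> y11)"
    using side weak strong by (simp add: layered_rate_eq inf_aci)
  also have "\<dots> \<le> cond_ent M x2 (y11 \<sqinter> y12) - cond_ent M x2 (v \<sqinter> u1 \<sqinter> y11 \<sqinter> y12)
        + cond_ent M x2 (v \<sqinter> u1 \<sqinter> y11 \<sqinter> y12 \<sqinter> y21 \<sqinter> y22)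
        - cond_ent M x2 (u2 \<sqinter> (v \<sqinter> u1 \<sqinter> y11 \<sqinter> y12 \<sqinter> y21 \<sqinter> y22))"
    by (intro diff_left_mono cond_ent_mono[OF finite_law]) (simp add: le_infI1 le_infI2)
  also have "\<dots> = cond_info M x2 (v \<sqinter> u1) (y11 \<sqinter> y12)
      + cond_info M x2 u2 (v \<sqinter> u1 \<sqinter> y11 \<sqinter> y12 \<sqinter> y21 \<sqinter> y22)"
    by (simp add: cond_info_def inf_aci)
  finally show ?thesis .
qed

lemma layered_rates_le:
  "layered_rate M x1 (v \<sqinter> u2 \<sqinter> y22) (u1 \<sqinter> y12) y11 y11
      + layered_rate M x2 (v \<sqinter> u1 \<sqinter> y11) (u2 \<sqinter> y21) y22 y12
    \<le> cond_info M (x1 \<sqinter> x2) (v \<sqinter> u1) (y11 \<sqinter> y12)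
      + cond_info M (x1 \<sqinter> x2) u2 (v \<sqinter> u1 \<sqinter> (y11 \<sqinter> y12) \<sqinter> (y21 \<sqinter> y22))"
  using fine_component_rate_le coarse_component_rate_le
    cond_info_chain_left[of M x2 x1 "v \<sqinter> u1" "y11 \<sqinter> y12"]
    cond_info_chain_left[of M x2 x1 u2 "v \<sqinter> u1 \<sqinter> (y11 \<sqinter> y12) \<sqinter> (y21 \<sqinter> y22)"]
  by (simp add: inf_aci)

end

lemma layered_code_component:
  fixes X1 :: "'o \<Rightarrow> 'x1::finite"
  assumes kernels: "mismatched_kernels Q (ker X1) (ker Y11) (ker Y21) (ker X2) (ker Y12) (ker Y22)
      (ker V) (ker U1) (ker U2)"
    and fine: "reconstructible Q d X1 (\<lambda>\<omega>. (V \<omega>, U1 \<omega>, Y11 \<omega>, Y12 \<omega>)) \<delta>"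
    and coarse: "reconstructible Q d' X1 (\<lambda>\<omega>. (V \<omega>, U2 \<omega>, Y21 \<omega>, Y22 \<omega>)) \<delta>'"
  shows "layered_code Q X1 Y11 Y21 (\<lambda>\<omega>. (V \<omega>, U2 \<omega>, Y22 \<omega>)) (\<lambda>\<omega>. (U1 \<omega>, Y12 \<omega>)) d \<delta> d' \<delta>'"
proof
  interpret mismatched_kernels Q "ker X1" "ker Y11" "ker Y21" "ker X2" "ker Y12" "ker Y22"
    "ker V" "ker U1" "ker U2"
    by (rule kernels)
  show "finite (set_pmf Q)" by (rule finite_law)
  have "cond_indep Q (ker V \<sqinter> ker U2 \<sqinter> ker Y22 \<sqinter> ker U1 \<sqinter> ker Y12) (ker Y11 \<sqinter> ker Y21) (ker X1)"
    by (rule cond_indep_mono[OF finite_law iffD1[OF cond_indep_commute component_markov]])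
      (simp_all add: le_infI1 le_infI2)
  then show "mis_markov Q (\<lambda>\<omega>. ((V \<omega>, U2 \<omega>, Y22 \<omega>), U1 \<omega>, Y12 \<omega>)) X1 (\<lambda>\<omega>. (Y11 \<omega>, Y21 \<omega>))"
    by (simp add: mis_markov_iff_cond_indep[OF finite_law] inf_aci)
  show "reconstructible Q d X1 (\<lambda>\<omega>. ((V \<omega>, U2 \<omega>, Y22 \<omega>), (U1 \<omega>, Y12 \<omega>), Y11 \<omega>)) \<delta>"
    by (rule reconstructible_factor[OF fine,
          where h = "\<lambda>((v, u2, y22), (u1, y12), y11). (v, u1, y11, y12)"]) simp
  show "reconstructible Q d' X1 (\<lambda>\<omega>. ((V \<omega>, U2 \<omega>, Y22 \<omega>), Y21 \<omega>)) \<delta>'"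
    by (rule reconstructible_factor[OF coarse, where h = "\<lambda>((v, u2, y22), y21). (v, u2, y21, y22)"]) simp
qed

type_synonym ('x1, 'x2, 'y11, 'y12, 'y21, 'y22) outcome =
  "(('x1 \<times> 'x2) \<times> ('y11 \<times> 'y12) \<times> ('y21 \<times> 'y22)) \<times> (nat \<times> nat \<times> nat)"

definition lX1 :: "('x1, 'x2, 'y11, 'y12, 'y21, 'y22) outcome \<Rightarrow> 'x1" where
  "lX1 \<omega> = fst (lX \<omega>)"

definition lX2 :: "('x1, 'x2, 'y11, 'y12, 'y21, 'y22) outcome \<Rightarrow> 'x2" where
  "lX2 \<omega> = snd (lX \<omega>)"

definition lY11 :: "('x1, 'x2, 'y11, 'y12, 'y21, 'y22) outcome \<Rightarrow> 'y11" where
  "lY11 \<omega> = fst (lY1 \<omega>)"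

definition lY12 :: "('x1, 'x2, 'y11, 'y12, 'y21, 'y22) outcome \<Rightarrow> 'y12" where
  "lY12 \<omega> = snd (lY1 \<omega>)"

definition lY21 :: "('x1, 'x2, 'y11, 'y12, 'y21, 'y22) outcome \<Rightarrow> 'y21" where
  "lY21 \<omega> = fst (lY2 \<omega>)"

definition lY22 :: "('x1, 'x2, 'y11, 'y12, 'y21, 'y22) outcome \<Rightarrow> 'y22" where
  "lY22 \<omega> = snd (lY2 \<omega>)"

lemmas component_defs = lX1_def lX2_def lY11_def lY12_def lY21_def lY22_def

lemma ker_components:
  "ker lX = ker lX1 \<sqinter> ker lX2" "ker lY1 = ker lY11 \<sqinter> ker lY12" "ker lY2 = ker lY21 \<sqinter> ker lY22"
  "ker snd = ker lA \<sqinter> ker lB \<sqinter> ker lC"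
  by (auto intro!: eqrel_eqI simp: component_defs prod_eq_iff lA_def lB_def lC_def)

lemma mis_src_component_laws:
  assumes "map_pmf fst Q = mis_src P1 P2"
  shows "map_pmf (\<lambda>\<omega>. ((lX1 \<omega>, lY11 \<omega>, lY21 \<omega>), (lX2 \<omega>, lY12 \<omega>, lY22 \<omega>))) Q = pair_pmf P1 P2"
    and "map_pmf (\<lambda>\<omega>. (lX1 \<omega>, lY11 \<omega>, lY21 \<omega>)) Q = P1" and "map_pmf (\<lambda>\<omega>. (lX2 \<omega>, lY12 \<omega>, lY22 \<omega>)) Q = P2"
proof -
  have "map_pmf (\<lambda>\<omega>. ((lX1 \<omega>, lY11 \<omega>, lY21 \<omega>), (lX2 \<omega>, lY12 \<omega>, lY22 \<omega>))) Q
      = map_pmf (\<lambda>((x1, x2), (y11, y12), (y21, y22)). ((x1, y11, y21), (x2, y12, y22))) (map_pmf fst Q)"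
    by (simp add: map_pmf_comp component_defs lX_def lY1_def lY2_def case_prod_unfold)
  also have "\<dots> = pair_pmf P1 P2"
    unfolding assms mis_src_def by (simp add: map_pmf_comp case_prod_unfold)
  finally show joint:
    "map_pmf (\<lambda>\<omega>. ((lX1 \<omega>, lY11 \<omega>, lY21 \<omega>), (lX2 \<omega>, lY12 \<omega>, lY22 \<omega>))) Q = pair_pmf P1 P2" .
  show "map_pmf (\<lambda>\<omega>. (lX1 \<omega>, lY11 \<omega>, lY21 \<omega>)) Q = P1" "map_pmf (\<lambda>\<omega>. (lX2 \<omega>, lY12 \<omega>, lY22 \<omega>)) Q = P2"
    using arg_cong[OF joint, of "map_pmf fst"] arg_cong[OF joint, of "map_pmf snd"]
    by (simp_all add: map_pmf_comp map_fst_pair_pmf map_snd_pair_pmf)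
qed

lemma exists_RM_feasible_of_small_codes:
  fixes M1 :: "'a pmf" and M2 :: "'b pmf"
    and X1 :: "'a \<Rightarrow> 'x1::finite" and Y11 :: "'a \<Rightarrow> 'y11::finite" and Y21 :: "'a \<Rightarrow> 'y21::finite"
    and X2 :: "'b \<Rightarrow> 'x2::finite" and Y12 :: "'b \<Rightarrow> 'y12::finite" and Y22 :: "'b \<Rightarrow> 'y22::finite"
  assumes code1: "layered_code M1 X1 Y11 Y21 W1 U1 d11 (D 1 1) d21 (D 2 1)"
    and law1: "map_pmf (\<lambda>\<omega>. (X1 \<omega>, Y11 \<omega>, Y21 \<omega>)) M1 = P1"
    and small1: "\<forall>\<omega>\<in>set_pmf M1. W1 \<omega> < CARD('x1) + 3 \<and> U1 \<omega> < CARD('x1) * (CARD('x1) + 3) + 1"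
    and code2: "layered_code M2 X2 Y22 Y12 W2 U2 d22 (D 2 2) d12 (D 1 2)"
    and law2: "map_pmf (\<lambda>\<omega>. (X2 \<omega>, Y12 \<omega>, Y22 \<omega>)) M2 = P2"
    and small2: "\<forall>\<omega>\<in>set_pmf M2. W2 \<omega> < CARD('x2) + 3 \<and> U2 \<omega> < CARD('x2) * (CARD('x2) + 3) + 1"
  obtains Q where "RM_feasible P1 P2 d11 d12 d21 d22 D Q"
    "RM_1 Q = code_rate M1 X1 W1 U1 Y11 Y11 + code_rate M2 X2 W2 U2 Y22 Y12"
    "RM_2 Q = code_rate M1 X1 W1 U1 Y11 Y21 + code_rate M2 X2 W2 U2 Y22 Y22"
proof -
  define \<phi> where "\<phi> = map_prod (\<lambda>\<omega>. (X1 \<omega>, Y11 \<omega>, Y21 \<omega>, W1 \<omega>, U1 \<omega>))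
      (\<lambda>\<omega>. (X2 \<omega>, Y12 \<omega>, Y22 \<omega>, W2 \<omega>, U2 \<omega>))"
  let ?M = "pair_pmf M1 M2"
  have fin: "finite (set_pmf M1)" "finite (set_pmf M2)"
    using layered_code.finite_law[OF code1] layered_code.finite_law[OF code2] by simp_all
  have \<phi>: "mX1 (\<phi> \<omega>) = X1 (fst \<omega>)" "mY11 (\<phi> \<omega>) = Y11 (fst \<omega>)" "mY21 (\<phi> \<omega>) = Y21 (fst \<omega>)"
    "mW1 (\<phi> \<omega>) = W1 (fst \<omega>)" "mU1 (\<phi> \<omega>) = U1 (fst \<omega>)" "mX2 (\<phi> \<omega>) = X2 (snd \<omega>)" "mY12 (\<phi> \<omega>) = Y12 (snd \<omega>)"
    "mY22 (\<phi> \<omega>) = Y22 (snd \<omega>)" "mW2 (\<phi> \<omega>) = W2 (snd \<omega>)" "mU2 (\<phi> \<omega>) = U2 (snd \<omega>)" for \<omega>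
    by (simp_all add: \<phi>_def m_defs map_prod_def split_beta)
  note marginals = map_fst_pair_pmf[of M1 M2] map_snd_pair_pmf[of M1 M2]
  show thesis
  proof
    show "RM_feasible P1 P2 d11 d12 d21 d22 D (map_pmf \<phi> ?M)"
      unfolding RM_feasible_iff_layered_codes
    proof (intro conjI)
      show "map_pmf (\<lambda>\<omega>. (mX1 \<omega>, mY11 \<omega>, mY21 \<omega>)) (map_pmf \<phi> ?M) = P1"
        "map_pmf (\<lambda>\<omega>. (mX2 \<omega>, mY12 \<omega>, mY22 \<omega>)) (map_pmf \<phi> ?M) = P2"
        using law1 map_pmf_comp[of "\<lambda>\<omega>. (X1 \<omega>, Y11 \<omega>, Y21 \<omega>)" fst ?M]
          law2 map_pmf_comp[of "\<lambda>\<omega>. (X2 \<omega>, Y12 \<omega>, Y22 \<omega>)" snd ?M]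
        by (simp_all add: map_pmf_comp \<phi> marginals)
      show "cond_indep (map_pmf \<phi> ?M) (ker fst) (ker snd) \<top>"
        unfolding \<phi>_def map_prod_def map_pair using fin by (intro cond_indep_pair_pmf) auto
      show "layered_code (map_pmf \<phi> ?M) mX1 mY11 mY21 mW1 mU1 d11 (D 1 1) d21 (D 2 1)"
        using code1 fin layered_code_map[of ?M fst X1 Y11 Y21 W1 U1 d11 "D 1 1" d21 "D 2 1"]
        by (simp add: layered_code_map \<phi> marginals)
      show "layered_code (map_pmf \<phi> ?M) mX2 mY22 mY12 mW2 mU2 d22 (D 2 2) d12 (D 1 2)"
        using code2 fin layered_code_map[of ?M snd X2 Y22 Y12 W2 U2 d22 "D 2 2" d12 "D 1 2"]
        by (simp add: layered_code_map \<phi> marginals)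
      show "set_pmf (map_pmf \<phi> ?M) \<subseteq> RM_alphabet"
        using small1 small2 by (auto simp: RM_alphabet_def \<phi>_def)
    qed
    show "RM_1 (map_pmf \<phi> ?M) = code_rate M1 X1 W1 U1 Y11 Y11 + code_rate M2 X2 W2 U2 Y22 Y12"
      using fin layered_rate_map[of fst ?M "ker X1" "ker W1" "ker U1" "ker Y11" "ker Y11"]
        layered_rate_map[of snd ?M "ker X2" "ker W2" "ker U2" "ker Y22" "ker Y12"]
      by (simp add: RM_1_eq_layered_rate layered_rate_map \<phi> marginals)
    show "RM_2 (map_pmf \<phi> ?M) = code_rate M1 X1 W1 U1 Y11 Y21 + code_rate M2 X2 W2 U2 Y22 Y22"
      using fin layered_rate_map[of fst ?M "ker X1" "ker W1" "ker U1" "ker Y11" "ker Y21"]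
        layered_rate_map[of snd ?M "ker X2" "ker W2" "ker U2" "ker Y22" "ker Y22"]
      by (simp add: RM_2_eq_layered_rate layered_rate_map \<phi> marginals)
  qed
qed

lemma RM_le_of_layered_codes:
  fixes M1 :: "'a pmf" and M2 :: "'b pmf"
    and X1 :: "'a \<Rightarrow> 'x1::finite" and Y11 :: "'a \<Rightarrow> 'y11::finite" and Y21 :: "'a \<Rightarrow> 'y21::finite"
    and X2 :: "'b \<Rightarrow> 'x2::finite" and Y12 :: "'b \<Rightarrow> 'y12::finite" and Y22 :: "'b \<Rightarrow> 'y22::finite"
  assumes code1: "layered_code M1 X1 Y11 Y21 W1 U1 d11 (D 1 1) d21 (D 2 1)"
    and law1: "map_pmf (\<lambda>\<omega>. (X1 \<omega>, Y11 \<omega>, Y21 \<omega>)) M1 = P1"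
    and code2: "layered_code M2 X2 Y22 Y12 W2 U2 d22 (D 2 2) d12 (D 1 2)"
    and law2: "map_pmf (\<lambda>\<omega>. (X2 \<omega>, Y12 \<omega>, Y22 \<omega>)) M2 = P2"
  shows "RM P1 P2 d11 d12 d21 d22 D \<le> ereal (max
      (code_rate M1 X1 W1 U1 Y11 Y11 + code_rate M2 X2 W2 U2 Y22 Y12)
      (code_rate M1 X1 W1 U1 Y11 Y21 + code_rate M2 X2 W2 U2 Y22 Y22))"
proof -
  obtain M1' and W1' U1' :: "'a \<Rightarrow> nat" where M1':
    "layered_code M1' X1 Y11 Y21 W1' U1' d11 (D 1 1) d21 (D 2 1)"
    "map_pmf (\<lambda>\<omega>. (X1 \<omega>, Y11 \<omega>, Y21 \<omega>)) M1' = map_pmf (\<lambda>\<omega>. (X1 \<omega>, Y11 \<omega>, Y21 \<omega>)) M1"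
    "\<forall>\<omega>\<in>set_pmf M1'. W1' \<omega> < CARD('x1) + 3 \<and> U1' \<omega> < CARD('x1) * (CARD('x1) + 3) + 1"
    "code_rate M1' X1 W1' U1' Y11 Y11 \<le> code_rate M1 X1 W1 U1 Y11 Y11"
    "code_rate M1' X1 W1' U1' Y11 Y21 \<le> code_rate M1 X1 W1 U1 Y11 Y21"
    by (rule layered_code.cardinality_bound[OF code1])
  obtain M2' and W2' U2' :: "'b \<Rightarrow> nat" where M2':
    "layered_code M2' X2 Y22 Y12 W2' U2' d22 (D 2 2) d12 (D 1 2)"
    "map_pmf (\<lambda>\<omega>. (X2 \<omega>, Y22 \<omega>, Y12 \<omega>)) M2' = map_pmf (\<lambda>\<omega>. (X2 \<omega>, Y22 \<omega>, Y12 \<omega>)) M2"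
    "\<forall>\<omega>\<in>set_pmf M2'. W2' \<omega> < CARD('x2) + 3 \<and> U2' \<omega> < CARD('x2) * (CARD('x2) + 3) + 1"
    "code_rate M2' X2 W2' U2' Y22 Y22 \<le> code_rate M2 X2 W2 U2 Y22 Y22"
    "code_rate M2' X2 W2' U2' Y22 Y12 \<le> code_rate M2 X2 W2 U2 Y22 Y12"
    by (rule layered_code.cardinality_bound[OF code2])
  have "map_pmf (\<lambda>\<omega>. (X2 \<omega>, Y12 \<omega>, Y22 \<omega>)) M2' = P2"
    using map_pmf_factor[OF M2'(2), of "\<lambda>(x, y, z). (x, z, y)"] law2 by simp
  then obtain Q where "RM_feasible P1 P2 d11 d12 d21 d22 D Q"
    and RM: "RM_1 Q = code_rate M1' X1 W1' U1' Y11 Y11 + code_rate M2' X2 W2' U2' Y22 Y12"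
    "RM_2 Q = code_rate M1' X1 W1' U1' Y11 Y21 + code_rate M2' X2 W2' U2' Y22 Y22"
    by (rule exists_RM_feasible_of_small_codes[OF M1'(1) M1'(2)[unfolded law1] M1'(3) M2'(1) _ M2'(3)])
  then have "RM P1 P2 d11 d12 d21 d22 D \<le> ereal (max (RM_1 Q) (RM_2 Q))"
    unfolding RM_def by (intro INF_lower) simp
  also have "\<dots> \<le> ereal (max
      (code_rate M1 X1 W1 U1 Y11 Y11 + code_rate M2 X2 W2 U2 Y22 Y12)
      (code_rate M1 X1 W1 U1 Y11 Y21 + code_rate M2 X2 W2 U2 Y22 Y22))"
    unfolding RM ereal_less_eq(3) by (intro max.mono add_mono M1' M2')
  finally show ?thesis .
qed

context
  fixes P1 :: "('x1::finite \<times> 'y11::finite \<times> 'y21::finite) pmf"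
    and P2 :: "('x2::finite \<times> 'y12::finite \<times> 'y22::finite) pmf"
    and d11 :: "'x1 \<Rightarrow> 'z11 \<Rightarrow> real" and d12 :: "'x2 \<Rightarrow> 'z12 \<Rightarrow> real"
    and d21 :: "'x1 \<Rightarrow> 'z21 \<Rightarrow> real" and d22 :: "'x2 \<Rightarrow> 'z22 \<Rightarrow> real"
    and D :: "nat \<Rightarrow> nat \<Rightarrow> real" and \<epsilon> :: real
    and Q :: "('x1, 'x2, 'y11, 'y12, 'y21, 'y22) outcome pmf"
  assumes degraded: "mis_markov P1 (\<lambda>(x, y11, y21). x) (\<lambda>(x, y11, y21). y11) (\<lambda>(x, y11, y21). y21)"
      "mis_markov P2 (\<lambda>(x, y12, y22). x) (\<lambda>(x, y12, y22). y22) (\<lambda>(x, y12, y22). y12)"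
    and Q: "Q \<in> Cbar d11 d12 d21 d22 D \<epsilon> (mis_src P1 P2)"
begin

lemma Cbar_mismatched_kernels:
  "mismatched_kernels Q (ker lX1) (ker lY11) (ker lY21) (ker lX2) (ker lY12) (ker lY22)
    (ker lA) (ker lB) (ker lC)"
proof
  show fin: "finite (set_pmf Q)" using Q by (simp add: Cbar_def)
  note laws = mis_src_component_laws[of Q P1 P2]
  have src: "map_pmf fst Q = mis_src P1 P2" using Q by (simp add: Cbar_def)
  have "cond_indep (pair_pmf P1 P2) (ker fst) (ker snd) \<top>"
    by (rule cond_indep_pair_pmf) simp_all
  then show "cond_indep Q (ker lX1 \<sqinter> ker lY11 \<sqinter> ker lY21) (ker lX2 \<sqinter> ker lY12 \<sqinter> ker lY22) \<top>"
    unfolding laws(1)[OF src, symmetric] cond_indep_def cond_info_map by (simp add: inf_assoc)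
  have "mis_markov Q (\<lambda>\<omega>. (lY1 \<omega>, lY2 \<omega>)) lX snd" using Q by (simp add: Cbar_def)
  then show "cond_indep Q (ker lA \<sqinter> ker lB \<sqinter> ker lC) (ker lY11 \<sqinter> ker lY21 \<sqinter> ker lY12 \<sqinter> ker lY22)
      (ker lX1 \<sqinter> ker lX2)"
    by (simp add: mis_markov_iff_cond_indep[OF fin] ker_components cond_indep_commute inf_aci)
  show "cond_indep Q (ker lX1) (ker lY21) (ker lY11)"
    using degraded(1) unfolding laws(2)[OF src, symmetric] mis_markov_map
    by (simp add: mis_markov_iff_cond_indep[OF fin])
  show "cond_indep Q (ker lX2) (ker lY12) (ker lY22)"
    using degraded(2) unfolding laws(3)[OF src, symmetric] mis_markov_map
    by (simp add: mis_markov_iff_cond_indep[OF fin])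
qed

interpretation mismatched_kernels Q "ker lX1" "ker lY11" "ker lY21" "ker lX2" "ker lY12" "ker lY22"
  "ker lA" "ker lB" "ker lC"
  by (rule Cbar_mismatched_kernels)

lemma Cbar_layered_codes:
  shows "layered_code Q lX1 lY11 lY21 (\<lambda>\<omega>. (lA \<omega>, lC \<omega>, lY22 \<omega>)) (\<lambda>\<omega>. (lB \<omega>, lY12 \<omega>))
      d11 (D 1 1 + \<epsilon>) d21 (D 2 1 + \<epsilon>)"
    and "layered_code Q lX2 lY22 lY12 (\<lambda>\<omega>. (lA \<omega>, lB \<omega>, lY11 \<omega>)) (\<lambda>\<omega>. (lC \<omega>, lY21 \<omega>))
      d22 (D 2 2 + \<epsilon>) d12 (D 1 2 + \<epsilon>)"
proof -
  have rec: "reconstructible Q d11 lX1 (\<lambda>\<omega>. (lA \<omega>, lB \<omega>, lY1 \<omega>)) (D 1 1 + \<epsilon>)"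
    "reconstructible Q d12 lX2 (\<lambda>\<omega>. (lA \<omega>, lB \<omega>, lY1 \<omega>)) (D 1 2 + \<epsilon>)"
    "reconstructible Q d21 lX1 (\<lambda>\<omega>. (lA \<omega>, lC \<omega>, lY2 \<omega>)) (D 2 1 + \<epsilon>)"
    "reconstructible Q d22 lX2 (\<lambda>\<omega>. (lA \<omega>, lC \<omega>, lY2 \<omega>)) (D 2 2 + \<epsilon>)"
    using Q unfolding Cbar_def reconstructible_triple lX1_def lX2_def by blast+
  show "layered_code Q lX1 lY11 lY21 (\<lambda>\<omega>. (lA \<omega>, lC \<omega>, lY22 \<omega>)) (\<lambda>\<omega>. (lB \<omega>, lY12 \<omega>))
      d11 (D 1 1 + \<epsilon>) d21 (D 2 1 + \<epsilon>)"
    by (rule layered_code_component[OF Cbar_mismatched_kernels])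
      (use rec(1,3) in \<open>simp_all add: component_defs\<close>)
  show "layered_code Q lX2 lY22 lY12 (\<lambda>\<omega>. (lA \<omega>, lB \<omega>, lY11 \<omega>)) (\<lambda>\<omega>. (lC \<omega>, lY21 \<omega>))
      d22 (D 2 2 + \<epsilon>) d12 (D 1 2 + \<epsilon>)"
  proof (rule layered_code_component[OF swap])
    show "reconstructible Q d22 lX2 (\<lambda>\<omega>. (lA \<omega>, lC \<omega>, lY22 \<omega>, lY21 \<omega>)) (D 2 2 + \<epsilon>)"
      by (rule reconstructible_factor[OF rec(4), where h = "\<lambda>(a, c, y22, y21). (a, c, y21, y22)"])
        (simp add: component_defs)
    show "reconstructible Q d12 lX2 (\<lambda>\<omega>. (lA \<omega>, lB \<omega>, lY12 \<omega>, lY11 \<omega>)) (D 1 2 + \<epsilon>)"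
      by (rule reconstructible_factor[OF rec(2), where h = "\<lambda>(a, b, y12, y11). (a, b, y11, y12)"])
        (simp add: component_defs)
  qed
qed

lemma RM_le_Rbar_lb:
  shows "RM P1 P2 d11 d12 d21 d22 (\<lambda>j i. D j i + \<epsilon>) \<le> ereal (Rbar_lb Q)"
proof -
  have src: "map_pmf fst Q = mis_src P1 P2" using Q by (simp add: Cbar_def)
  let ?W1 = "\<lambda>\<omega>. (lA \<omega>, lC \<omega>, lY22 \<omega>)" and ?U1 = "\<lambda>\<omega>. (lB \<omega>, lY12 \<omega>)"
  let ?W2 = "\<lambda>\<omega>. (lA \<omega>, lB \<omega>, lY11 \<omega>)" and ?U2 = "\<lambda>\<omega>. (lC \<omega>, lY21 \<omega>)"
  have "RM P1 P2 d11 d12 d21 d22 (\<lambda>j i. D j i + \<epsilon>) \<le> ereal (max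
      (code_rate Q lX1 ?W1 ?U1 lY11 lY11 + code_rate Q lX2 ?W2 ?U2 lY22 lY12)
      (code_rate Q lX1 ?W1 ?U1 lY11 lY21 + code_rate Q lX2 ?W2 ?U2 lY22 lY22))"
    by (rule RM_le_of_layered_codes[OF Cbar_layered_codes(1) mis_src_component_laws(2)[OF src]
          Cbar_layered_codes(2) mis_src_component_laws(3)[OF src]])
  also have "\<dots> \<le> ereal (Rbar_lb Q)"
    unfolding ereal_less_eq(3) Rbar_lb_def mis_I_eq_cond_info[OF finite_law] ker_Pair ker_components
    using layered_rates_le mismatched_kernels.layered_rates_le[OF swap]
    by (intro max.mono) (simp_all add: inf_aci)
  finally show ?thesis .
qed

end

lemma RM_le_Rlb:
  fixes P1 :: "('x1::finite \<times> 'y11::finite \<times> 'y21::finite) pmf"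
    and P2 :: "('x2::finite \<times> 'y12::finite \<times> 'y22::finite) pmf"
  assumes degraded: "mis_markov P1 (\<lambda>(x, y11, y21). x) (\<lambda>(x, y11, y21). y11) (\<lambda>(x, y11, y21). y21)"
      "mis_markov P2 (\<lambda>(x, y12, y22). x) (\<lambda>(x, y12, y22). y22) (\<lambda>(x, y12, y22). y12)"
  shows "RM P1 P2 d11 d12 d21 d22 (\<lambda>j i. D j i + \<epsilon>) - ereal \<epsilon> \<le> Rlb P1 P2 d11 d12 d21 d22 D \<epsilon>"
proof -
  have "RM P1 P2 d11 d12 d21 d22 (\<lambda>j i. D j i + \<epsilon>)
      \<le> (INF Q \<in> Cbar d11 d12 d21 d22 D \<epsilon> (mis_src P1 P2). ereal (Rbar_lb Q))"
    by (intro INF_greatest RM_le_Rbar_lb[OF degraded])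
  also have "\<dots> \<le> (SUP Pb \<in> Pbar P1 P2. INF Q \<in> Cbar d11 d12 d21 d22 D \<epsilon> Pb. ereal (Rbar_lb Q))"
    by (intro SUP_upper) (simp add: Pbar_def)
  finally show ?thesis unfolding Rlb_def by (intro ereal_minus_mono) auto
qed

section \<open>Achievability\<close>

lemma cond_info_diff_markov_indep:
  assumes fin: "finite (set_pmf M)" and indep: "cond_indep M E F \<top>"
    and markov: "cond_indep M u y (x \<sqinter> w)"
    and E: "E \<le> x \<sqinter> w \<sqinter> u \<sqinter> y" and F: "F \<le> a" "F \<le> b"
  shows "cond_info M (x \<sqinter> w \<sqinter> a) u \<top> - cond_info M u (w \<sqinter> y \<sqinter> b) \<top> = cond_info M x u (y \<sqinter> w)"
proof -
  have "cond_info M (x \<sqinter> w \<sqinter> a) (u \<sqinter> \<top>) (\<top> \<sqinter> \<top>) = cond_info M (x \<sqinter> w) u \<top> + cond_info M a \<top> \<top>"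
    "cond_info M (u \<sqinter> \<top>) (w \<sqinter> y \<sqinter> b) (\<top> \<sqinter> \<top>) = cond_info M u (w \<sqinter> y) \<top> + cond_info M \<top> b \<top>"
    using E F by (intro cond_info_inf_indep[OF fin indep]; simp)+
  then have "cond_info M (x \<sqinter> w \<sqinter> a) u \<top> - cond_info M u (w \<sqinter> y \<sqinter> b) \<top>
      = cond_info M (x \<sqinter> w) u \<top> - cond_info M u (w \<sqinter> y) \<top>"
    by (simp add: info_defs)
  also have "\<dots> = cond_info M (x \<sqinter> w) u (w \<sqinter> y)"
    using markov by (intro cond_info_diff_markov) (simp add: cond_indep_def info_defs inf_aci)
  also have "\<dots> = cond_info M x u (y \<sqinter> w)"
    by (simp add: info_defs inf_aci)
  finally show ?thesis .
qed

locale independent_components =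
  fixes M :: "'o pmf" and x1 y11 y21 w1 u1 x2 y12 y22 w2 u2 :: "'o eqrel"
  assumes finite_law: "finite (set_pmf M)"
    and indep: "cond_indep M (x1 \<sqinter> y11 \<sqinter> y21 \<sqinter> w1 \<sqinter> u1) (x2 \<sqinter> y12 \<sqinter> y22 \<sqinter> w2 \<sqinter> u2) \<top>"
    and markov1: "cond_indep M (w1 \<sqinter> u1) (y11 \<sqinter> y21) x1"
    and markov2: "cond_indep M (w2 \<sqinter> u2) (y12 \<sqinter> y22) x2"
begin

lemma joint_markov: "cond_indep M (w1 \<sqinter> u1 \<sqinter> (w2 \<sqinter> u2)) (y11 \<sqinter> y21 \<sqinter> (y12 \<sqinter> y22)) (x1 \<sqinter> x2)"
  unfolding cond_indep_def
  using markov1 markov2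
  by (subst cond_info_inf_indep[OF finite_law indep]) (simp_all add: cond_indep_def le_infI1 le_infI2)

lemma common_layer_rate:
  assumes "y11 \<sqinter> y21 \<le> y1" "y12 \<sqinter> y22 \<le> y2"
  shows "cond_info M (x1 \<sqinter> x2) (w1 \<sqinter> w2) \<top> - cond_info M (w1 \<sqinter> w2) (y1 \<sqinter> y2) \<top>
    = cond_info M x1 w1 y1 + cond_info M x2 w2 y2"
proof -
  have le: "x1 \<sqinter> y11 \<sqinter> y21 \<sqinter> w1 \<sqinter> u1 \<le> y1" "x2 \<sqinter> y12 \<sqinter> y22 \<sqinter> w2 \<sqinter> u2 \<le> y2"
    using assms by (auto intro: order.trans[rotated] simp: le_infI1 le_infI2)
  have "cond_info M (x1 \<sqinter> x2) (w1 \<sqinter> w2) (\<top> \<sqinter> \<top>) = cond_info M x1 w1 \<top> + cond_info M x2 w2 \<top>"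
    "cond_info M (w1 \<sqinter> w2) (y1 \<sqinter> y2) (\<top> \<sqinter> \<top>) = cond_info M w1 y1 \<top> + cond_info M w2 y2 \<top>"
    using le by (intro cond_info_inf_indep[OF finite_law indep]; simp add: le_infI1 le_infI2)+
  moreover have "cond_info M x1 w1 \<top> - cond_info M w1 y1 \<top> = cond_info M x1 w1 y1"
    by (rule cond_info_diff_markov[OF cond_indep_mono[OF finite_law markov1 inf_le1 assms(1)]])
  moreover have "cond_info M x2 w2 \<top> - cond_info M w2 y2 \<top> = cond_info M x2 w2 y2"
    by (rule cond_info_diff_markov[OF cond_indep_mono[OF finite_law markov2 inf_le1 assms(2)]])
  ultimately show ?thesis by simp
qed

lemma private_layer_rate1:
  "cond_info M (x1 \<sqinter> w1 \<sqinter> (x2 \<sqinter> w2)) u1 \<top> - cond_info M u1 (w1 \<sqinter> y11 \<sqinter> (w2 \<sqinter> y12)) \<top>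
    = cond_info M x1 u1 (y11 \<sqinter> w1)"
proof (rule cond_info_diff_markov_indep[OF finite_law indep])
  have "cond_indep M y11 (w1 \<sqinter> u1) x1"
    by (rule cond_indep_mono[OF finite_law iffD1[OF cond_indep_commute markov1]]) simp_all
  then show "cond_indep M u1 y11 (x1 \<sqinter> w1)"
    using cond_indep_weak_union[OF finite_law, of y11 w1 u1 x1]
    by (simp add: cond_indep_commute inf_commute)
qed (simp_all add: le_infI1 le_infI2)

lemma private_layer_rate2:
  "cond_info M (x2 \<sqinter> w2 \<sqinter> (x1 \<sqinter> w1 \<sqinter> u1)) u2 \<top> - cond_info M u2 (w2 \<sqinter> y22 \<sqinter> (w1 \<sqinter> y21)) \<top>
    = cond_info M x2 u2 (y22 \<sqinter> w2)"
proof (rule cond_info_diff_markov_indep[OF finite_law iffD1[OF cond_indep_commute indep]])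
  have "cond_indep M y22 (w2 \<sqinter> u2) x2"
    by (rule cond_indep_mono[OF finite_law iffD1[OF cond_indep_commute markov2]]) simp_all
  then show "cond_indep M u2 y22 (x2 \<sqinter> w2)"
    using cond_indep_weak_union[OF finite_law, of y22 w2 u2 x2]
    by (simp add: cond_indep_commute inf_commute)
qed (simp_all add: le_infI1 le_infI2)

end

lemma ker_fst_snd:
  "ker fst = ker mX1 \<sqinter> ker mY11 \<sqinter> ker mY21 \<sqinter> ker mW1 \<sqinter> ker mU1"
  "ker snd = ker mX2 \<sqinter> ker mY12 \<sqinter> ker mY22 \<sqinter> ker mW2 \<sqinter> ker mU2"
  by (auto intro!: eqrel_eqI simp: m_defs prod_eq_iff)

definition superposition ::
  "('x1 \<times> 'y11 \<times> 'y21 \<times> nat \<times> nat) \<times> ('x2 \<times> 'y12 \<times> 'y22 \<times> nat \<times> nat) \<Rightarrow>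
   ('x1, 'x2, 'y11, 'y12, 'y21, 'y22) outcome" where
  "superposition \<omega> = (((mX1 \<omega>, mX2 \<omega>), (mY11 \<omega>, mY12 \<omega>), (mY21 \<omega>, mY22 \<omega>)),
    (mU1 \<omega>, mU2 \<omega>, prod_encode (mW1 \<omega>, mW2 \<omega>)))"

lemma superposition_simps [simp]:
  "lX (superposition \<omega>) = (mX1 \<omega>, mX2 \<omega>)" "lY1 (superposition \<omega>) = (mY11 \<omega>, mY12 \<omega>)"
  "lY2 (superposition \<omega>) = (mY21 \<omega>, mY22 \<omega>)" "lA (superposition \<omega>) = mU1 \<omega>" "lB (superposition \<omega>) = mU2 \<omega>"
  "lC (superposition \<omega>) = prod_encode (mW1 \<omega>, mW2 \<omega>)"
  by (simp_all add: superposition_def lX_def lY1_def lY2_def lA_def lB_def lC_def)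

lemma subset12_neq:
  "{1} \<noteq> {2::nat}" "{2} \<noteq> {1::nat}" "{1} \<noteq> {1, 2::nat}"
  "{1, 2} \<noteq> {1::nat}" "{2} \<noteq> {1, 2::nat}" "{1, 2} \<noteq> {2::nat}"
  by auto

lemma usel_simps: "usel {1} = lA" "usel {2} = lB" "usel {1, 2} = lC"
  by (simp_all only: usel_def fun_eq_iff subset12_neq simp_thms if_True if_False)

lemma ker_prod_encode [simp]: "ker (\<lambda>\<omega>. prod_encode (A \<omega>, B \<omega>)) = ker A \<sqinter> ker B"
  by (auto intro: eqrel_eqI)

lemma UU_eq_iff: "UU T \<omega> = UU T \<omega>' \<longleftrightarrow> (\<forall>S\<in>T. usel S \<omega> = usel S \<omega>')"
proof
  assume eq: "UU T \<omega> = UU T \<omega>'"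
  show "\<forall>S\<in>T. usel S \<omega> = usel S \<omega>'"
  proof
    show "usel S \<omega> = usel S \<omega>'" if "S \<in> T" for S
      using fun_cong[OF eq, of S] that by (simp add: UU_def)
  qed
qed (auto simp: UU_def intro: restrict_ext)

lemma ker_UU_insert: "ker (UU (insert S T)) = ker (usel S) \<sqinter> ker (UU T)"
  and ker_UU_empty: "ker (UU {}) = \<top>"
  by (auto intro!: eqrel_eqI simp: UU_eq_iff)

definition binning_rate ::
  "(('x1 \<times> 'y11 \<times> 'y21 \<times> nat \<times> nat) \<times> ('x2 \<times> 'y12 \<times> 'y22 \<times> nat \<times> nat)) pmf \<Rightarrow> nat set \<Rightarrow> real" where
  "binning_rate Q S =
    (if S = {1} then cond_info Q (ker mU1) (ker mW1 \<sqinter> ker mW2 \<sqinter> (ker mY11 \<sqinter> ker mY12)) \<top>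
     else if S = {2} then cond_info Q (ker mU2) (ker mW1 \<sqinter> ker mW2 \<sqinter> (ker mY21 \<sqinter> ker mY22)) \<top>
     else min (cond_info Q (ker mW1 \<sqinter> ker mW2) (ker mY11 \<sqinter> ker mY12) \<top>)
              (cond_info Q (ker mW1 \<sqinter> ker mW2) (ker mY21 \<sqinter> ker mY22) \<top>))"

definition message_rate ::
  "(('x1 \<times> 'y11 \<times> 'y21 \<times> nat \<times> nat) \<times> ('x2 \<times> 'y12 \<times> 'y22 \<times> nat \<times> nat)) pmf \<Rightarrow> nat set \<Rightarrow> real" where
  "message_rate Q S =
    (if S = {1} then cond_info Q (ker mX1) (ker mU1) (ker mY11 \<sqinter> ker mW1)
     else if S = {2} then cond_info Q (ker mX2) (ker mU2) (ker mY22 \<sqinter> ker mW2)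
     else max (cond_info Q (ker mX1) (ker mW1) (ker mY11) + cond_info Q (ker mX2) (ker mW2) (ker mY12))
              (cond_info Q (ker mX1) (ker mW1) (ker mY21) + cond_info Q (ker mX2) (ker mW2) (ker mY22)))"

lemma binning_rate_simps:
  "binning_rate Q {1} = cond_info Q (ker mU1) (ker mW1 \<sqinter> ker mW2 \<sqinter> (ker mY11 \<sqinter> ker mY12)) \<top>"
  "binning_rate Q {2} = cond_info Q (ker mU2) (ker mW1 \<sqinter> ker mW2 \<sqinter> (ker mY21 \<sqinter> ker mY22)) \<top>"
  "binning_rate Q {1, 2} = min (cond_info Q (ker mW1 \<sqinter> ker mW2) (ker mY11 \<sqinter> ker mY12) \<top>)
      (cond_info Q (ker mW1 \<sqinter> ker mW2) (ker mY21 \<sqinter> ker mY22) \<top>)"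
  unfolding binning_rate_def by (simp_all only: subset12_neq simp_thms if_True if_False)

lemma message_rate_simps:
  "message_rate Q {1} = cond_info Q (ker mX1) (ker mU1) (ker mY11 \<sqinter> ker mW1)"
  "message_rate Q {2} = cond_info Q (ker mX2) (ker mU2) (ker mY22 \<sqinter> ker mW2)"
  "message_rate Q {1, 2} = max
      (cond_info Q (ker mX1) (ker mW1) (ker mY11) + cond_info Q (ker mX2) (ker mW2) (ker mY12))
      (cond_info Q (ker mX1) (ker mW1) (ker mY21) + cond_info Q (ker mX2) (ker mW2) (ker mY22))"
  unfolding message_rate_def by (simp_all only: subset12_neq simp_thms if_True if_False)

lemma packing_bound:
  fixes Q :: "('o \<times> nat \<times> nat \<times> nat) pmf"
  assumes fin: "finite (set_pmf Q)" and ST: "S \<noteq> T"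
    and S: "R S \<le> cond_info Q (ker (usel S)) (ker (usel T) \<sqinter> ker Y) \<top>"
    and T: "R T \<le> cond_info Q (ker (usel T)) (ker Y) \<top>"
    and D': "D' \<subseteq> {S, T}" "D' \<noteq> {}"
  shows "(\<Sum>S\<in>D'. R S) \<le> (\<Sum>S\<in>D'. mis_H Q (usel S)) - mis_condH Q (UU D') (\<lambda>\<omega>. (UU ({S, T} - D') \<omega>, Y \<omega>))"
proof -
  note entropies = mis_H_eq_ent[OF fin] mis_condH_eq_cond_ent[OF fin] ker_Pair ker_UU_insert ker_UU_empty
  from D' consider (own) "D' = {S}" | (common) "D' = {T}" | (both) "D' = {S, T}" by blast
  then show ?thesis
  proof cases
    case own
    then have "{S, T} - D' = {T}" using ST by auto
    with own S show ?thesis by (simp add: entropies info_defs)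
  next
    case common
    then have diff: "{S, T} - D' = {S}" using ST by auto
    have "cond_ent Q (ker (usel T)) (ker (usel S) \<sqinter> ker Y) \<le> cond_ent Q (ker (usel T)) (ker Y)"
      by (intro cond_ent_mono[OF fin]) simp
    with common T diff show ?thesis by (simp add: entropies info_defs)
  next
    case both
    with S T ST show ?thesis by (simp add: entropies info_defs inf_aci)
  qed
qed

context
  fixes P1 :: "('x1::finite \<times> 'y11::finite \<times> 'y21::finite) pmf"
    and P2 :: "('x2::finite \<times> 'y12::finite \<times> 'y22::finite) pmf"
    and d11 :: "'x1 \<Rightarrow> 'z11 \<Rightarrow> real" and d12 :: "'x2 \<Rightarrow> 'z12 \<Rightarrow> real"
    and d21 :: "'x1 \<Rightarrow> 'z21 \<Rightarrow> real" and d22 :: "'x2 \<Rightarrow> 'z22 \<Rightarrow> real"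
    and D :: "nat \<Rightarrow> nat \<Rightarrow> real"
    and Q :: "(('x1 \<times> 'y11 \<times> 'y21 \<times> nat \<times> nat) \<times> ('x2 \<times> 'y12 \<times> 'y22 \<times> nat \<times> nat)) pmf"
  assumes feasible: "RM_feasible P1 P2 d11 d12 d21 d22 D Q"
begin

lemma RM_feasible_independent_components:
  shows "independent_components Q (ker mX1) (ker mY11) (ker mY21) (ker mW1) (ker mU1)
    (ker mX2) (ker mY12) (ker mY22) (ker mW2) (ker mU2)"
proof
  note codes = feasible[unfolded RM_feasible_iff_layered_codes]
  show fin: "finite (set_pmf Q)" using codes finite_RM_alphabet finite_subset by blast
  show "cond_indep Q (ker mX1 \<sqinter> ker mY11 \<sqinter> ker mY21 \<sqinter> ker mW1 \<sqinter> ker mU1)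
      (ker mX2 \<sqinter> ker mY12 \<sqinter> ker mY22 \<sqinter> ker mW2 \<sqinter> ker mU2) \<top>"
    using codes by (simp add: ker_fst_snd)
  show "cond_indep Q (ker mW1 \<sqinter> ker mU1) (ker mY11 \<sqinter> ker mY21) (ker mX1)"
    "cond_indep Q (ker mW2 \<sqinter> ker mU2) (ker mY12 \<sqinter> ker mY22) (ker mX2)"
    using codes layered_code.markov[of Q mX1 mY11 mY21 mW1 mU1]
      layered_code.markov[of Q mX2 mY22 mY12 mW2 mU2]
    by (auto simp: mis_markov_iff_cond_indep[OF fin] inf_commute)
qed

interpretation independent_components Q "ker mX1" "ker mY11" "ker mY21" "ker mW1" "ker mU1"
  "ker mX2" "ker mY12" "ker mY22" "ker mW2" "ker mU2"
  by (rule RM_feasible_independent_components)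

lemma superposition_source_law: "map_pmf fst (map_pmf superposition Q) = mis_src P1 P2"
proof -
  have laws: "map_pmf (\<lambda>(x, y, y', w, u). (x, y, y')) (map_pmf fst Q) = P1"
    "map_pmf (\<lambda>(x, y, y', w, u). (x, y, y')) (map_pmf snd Q) = P2"
    and product: "pair_pmf (map_pmf fst Q) (map_pmf snd Q) = Q"
    using feasible by (auto simp: RM_feasible_def)
  have "pair_pmf P1 P2 = map_pmf (\<lambda>(a, b). (case a of (x, y, y', w, u) \<Rightarrow> (x, y, y'),
      case b of (x, y, y', w, u) \<Rightarrow> (x, y, y'))) (pair_pmf (map_pmf fst Q) (map_pmf snd Q))"
    unfolding map_pair laws ..
  then show ?thesis
    by (simp add: product mis_src_def map_pmf_comp superposition_def m_defs case_prod_unfold)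
qed

lemma Rach_feasible_superposition:
  shows "Rach_feasible P1 P2 d11 d12 d21 d22 D (map_pmf superposition Q)"
proof -
  let ?Q = "map_pmf superposition Q"
  have fin: "finite (set_pmf ?Q)" using finite_law by simp
  have codes: "layered_code Q mX1 mY11 mY21 mW1 mU1 d11 (D 1 1) d21 (D 2 1)"
    "layered_code Q mX2 mY22 mY12 mW2 mU2 d22 (D 2 2) d12 (D 1 2)"
    using feasible by (simp_all add: RM_feasible_iff_layered_codes)
  show ?thesis
    unfolding Rach_feasible_def reconstructible_triple[where X = "\<lambda>\<omega>. fst (lX \<omega>)", symmetric]
      reconstructible_triple[where X = "\<lambda>\<omega>. snd (lX \<omega>)", symmetric]
  proof (intro conjI)
    show "map_pmf fst ?Q = mis_src P1 P2" by (rule superposition_source_law)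
    show "mis_markov ?Q (UU subsets12) lX (\<lambda>\<omega>. (lY1 \<omega>, lY2 \<omega>))"
      using joint_markov
      unfolding mis_markov_iff_cond_indep[OF fin] subsets12_def ker_UU_insert ker_UU_empty usel_simps
        cond_indep_def cond_info_map by (simp add: inf_aci)
    show "reconstructible ?Q d11 (\<lambda>\<omega>. fst (lX \<omega>)) (\<lambda>\<omega>. (lA \<omega>, lC \<omega>, lY1 \<omega>)) (D 1 1)"
      unfolding reconstructible_map superposition_simps fst_conv snd_conv
      by (rule reconstructible_factor[OF layered_code.fine_reconstruction[OF codes(1)],
            where h = "\<lambda>(u, c, y). (fst (prod_decode c), u, fst y)"]) simp
    show "reconstructible ?Q d12 (\<lambda>\<omega>. snd (lX \<omega>)) (\<lambda>\<omega>. (lA \<omega>, lC \<omega>, lY1 \<omega>)) (D 1 2)"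
      unfolding reconstructible_map superposition_simps fst_conv snd_conv
      by (rule reconstructible_factor[OF layered_code.coarse_reconstruction[OF codes(2)],
            where h = "\<lambda>(u, c, y). (snd (prod_decode c), snd y)"]) simp
    show "reconstructible ?Q d21 (\<lambda>\<omega>. fst (lX \<omega>)) (\<lambda>\<omega>. (lB \<omega>, lC \<omega>, lY2 \<omega>)) (D 2 1)"
      unfolding reconstructible_map superposition_simps fst_conv snd_conv
      by (rule reconstructible_factor[OF layered_code.coarse_reconstruction[OF codes(1)],
            where h = "\<lambda>(u, c, y). (fst (prod_decode c), fst y)"]) simp
    show "reconstructible ?Q d22 (\<lambda>\<omega>. snd (lX \<omega>)) (\<lambda>\<omega>. (lB \<omega>, lC \<omega>, lY2 \<omega>)) (D 2 2)"
      unfolding reconstructible_map superposition_simps fst_conv snd_conv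
      by (rule reconstructible_factor[OF layered_code.fine_reconstruction[OF codes(2)],
            where h = "\<lambda>(u, c, y). (snd (prod_decode c), u, snd y)"]) simp
  qed (rule fin)
qed

lemma Rach_rates_superposition:
  shows "Rach_rates [{1, 2}, {1}, {2}] (map_pmf superposition Q) (message_rate Q) (binning_rate Q)"
  unfolding Rach_rates_def
proof (intro conjI)
  let ?Q = "map_pmf superposition Q" and ?v = "[{1, 2}, {1}, {2}] :: nat set list"
  have fin: "finite (set_pmf ?Q)" using finite_law by simp
  show "\<forall>S\<in>subsets12. 0 \<le> message_rate Q S \<and> 0 \<le> binning_rate Q S"
    by (simp add: message_rate_def binning_rate_def cond_info_nonneg[OF finite_law]
        le_max_iff_disj add_nonneg_nonneg)
  show "\<forall>j<length ?v. mis_I ?Q (\<lambda>\<omega>. (lX \<omega>, UU (set (take j ?v)) \<omega>)) (usel (?v ! j)) (\<lambda>_. ())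
      \<le> message_rate Q (?v ! j) + binning_rate Q (?v ! j)"
  proof (intro allI impI)
    let ?covering = "\<lambda>T S. mis_I ?Q (\<lambda>\<omega>. (lX \<omega>, UU T \<omega>)) (usel S) (\<lambda>_. ())
        \<le> message_rate Q S + binning_rate Q S"
    note kernels = mis_I_eq_cond_info[OF fin] ker_Pair ker_UU_insert ker_UU_empty usel_simps cond_info_map
    have "?covering {} {1, 2}"
      using common_layer_rate[of "ker mY11" "ker mY12"] common_layer_rate[of "ker mY21" "ker mY22"]
      unfolding kernels message_rate_simps binning_rate_simps by simp
    moreover have "?covering {{1, 2}} {1}"
      using private_layer_rate1 unfolding kernels message_rate_simps binning_rate_simps
      by (simp add: inf_aci)
    moreover have "?covering {{1, 2}, {1}} {2}"
      using private_layer_rate2 unfolding kernels message_rate_simps binning_rate_simps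
      by (simp add: inf_aci)
    moreover fix j assume "j < length ?v"
    then have "j = 0 \<or> j = 1 \<or> j = 2" by auto
    ultimately show "?covering (set (take j ?v)) (?v ! j)" by auto
  qed
  have D: "Dset 1 = {{1}, {1, 2}}" "Dset 2 = {{2}, {1, 2}}" by (auto simp: Dset_def subsets12_def)
  have binning: "binning_rate Q {1} \<le> cond_info ?Q (ker (usel {1})) (ker (usel {1, 2}) \<sqinter> ker lY1) \<top>"
    "binning_rate Q {1, 2} \<le> cond_info ?Q (ker (usel {1, 2})) (ker lY1) \<top>"
    "binning_rate Q {2} \<le> cond_info ?Q (ker (usel {2})) (ker (usel {1, 2}) \<sqinter> ker lY2) \<top>"
    "binning_rate Q {1, 2} \<le> cond_info ?Q (ker (usel {1, 2})) (ker lY2) \<top>"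
    unfolding binning_rate_simps usel_simps cond_info_map by simp_all
  show "\<forall>D'. D' \<subseteq> Dset 1 \<and> D' \<noteq> {} \<longrightarrow> (\<Sum>S\<in>D'. binning_rate Q S)
      \<le> (\<Sum>S\<in>D'. mis_H ?Q (usel S)) - mis_condH ?Q (UU D') (\<lambda>\<omega>. (UU (Dset 1 - D') \<omega>, lY1 \<omega>))"
    unfolding D using packing_bound[OF fin subset12_neq(3) binning(1,2)] by blast
  show "\<forall>D'. D' \<subseteq> Dset 2 \<and> D' \<noteq> {} \<longrightarrow> (\<Sum>S\<in>D'. binning_rate Q S)
      \<le> (\<Sum>S\<in>D'. mis_H ?Q (usel S)) - mis_condH ?Q (UU D') (\<lambda>\<omega>. (UU (Dset 2 - D') \<omega>, lY2 \<omega>))"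
    unfolding D using packing_bound[OF fin subset12_neq(5) binning(3,4)] by blast
qed

lemma sum_message_rate: "(\<Sum>S\<in>subsets12. message_rate Q S) = max (RM_1 Q) (RM_2 Q)"
proof -
  have "(\<Sum>S\<in>subsets12. message_rate Q S) = message_rate Q {1} + message_rate Q {2} + message_rate Q {1, 2}"
    unfolding subsets12_def
    by (simp only: sum.insert sum.empty finite.intros insert_iff empty_iff subset12_neq simp_thms
        add_0_right add.assoc)
  also have "\<dots> = max (RM_1 Q) (RM_2 Q)"
    unfolding message_rate_simps by (simp add: RM_1_def RM_2_def mis_I_eq_cond_info[OF finite_law])
  finally show ?thesis .
qed

end

lemma Rach0_le_RM:
  fixes P1 :: "('x1::finite \<times> 'y11::finite \<times> 'y21::finite) pmf"
    and P2 :: "('x2::finite \<times> 'y12::finite \<times> 'y22::finite) pmf"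
  shows "Rach0 P1 P2 d11 d12 d21 d22 D \<le> RM P1 P2 d11 d12 d21 d22 D"
  unfolding RM_def
proof (rule INF_greatest)
  fix Q assume "Q \<in> {Q. RM_feasible P1 P2 d11 d12 d21 d22 D Q}"
  then have feasible: "RM_feasible P1 P2 d11 d12 d21 d22 D Q" by simp
  let ?v = "[{1, 2}, {1}, {2}] :: nat set list"
  have "distinct ?v \<and> set ?v = subsets12"
    using subset12_neq by (auto simp: subsets12_def)
  then show "Rach0 P1 P2 d11 d12 d21 d22 D \<le> ereal (max (RM_1 Q) (RM_2 Q))"
    unfolding Rach0_def
    using Rach_feasible_superposition[OF feasible] Rach_rates_superposition[OF feasible]
      sum_message_rate[OF feasible]
    by (intro INF_lower2[of ?v] INF_lower2[of "map_pmf superposition Q"]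
        INF_lower2[of "(message_rate Q, binning_rate Q)"])
      auto
qed

lemma lower_convex_envelope_le: "lower_convex_envelope f D \<le> f D"
  unfolding lower_convex_envelope_def
proof (rule Inf_lower, rule CollectI, intro exI conjI)
  show "f D = (\<Sum>t<1::nat. ereal ((\<lambda>_. 1) t) * f ((\<lambda>_. D) t))" by (simp flip: one_ereal_def)
qed auto

theorem theorem9:
  fixes P1 :: "('x1::finite \<times> 'y11::finite \<times> 'y21::finite) pmf"
    and P2 :: "('x2::finite \<times> 'y12::finite \<times> 'y22::finite) pmf"
    and d11 :: "'x1 \<Rightarrow> 'z11::finite \<Rightarrow> real"
    and d12 :: "'x2 \<Rightarrow> 'z12::finite \<Rightarrow> real"
    and d21 :: "'x1 \<Rightarrow> 'z21::finite \<Rightarrow> real"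
    and d22 :: "'x2 \<Rightarrow> 'z22::finite \<Rightarrow> real"
    and D :: "nat \<Rightarrow> nat \<Rightarrow> real"
  assumes "mis_markov P1 (\<lambda>(x, y11, y21). x) (\<lambda>(x, y11, y21). y11) (\<lambda>(x, y11, y21). y21)"
    and "mis_markov P2 (\<lambda>(x, y12, y22). x) (\<lambda>(x, y12, y22). y22) (\<lambda>(x, y12, y22). y12)"
  shows "Liminf (at_right 0) (\<lambda>\<epsilon>. Rlb P1 P2 d11 d12 d21 d22 D \<epsilon>) \<ge> RM P1 P2 d11 d12 d21 d22 D
       \<and> Rach P1 P2 d11 d12 d21 d22 D \<le> RM P1 P2 d11 d12 d21 d22 D"
proof
  let ?RM = "RM P1 P2 d11 d12 d21 d22" and ?Rlb = "Rlb P1 P2 d11 d12 d21 d22 D"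
  have "?RM D \<le> Liminf (at_right 0) (\<lambda>\<epsilon>. ?RM (\<lambda>j i. D j i + \<epsilon>) - ereal \<epsilon>)"
    by (rule RM_le_Liminf_RM)
  also have "\<dots> \<le> Liminf (at_right 0) ?Rlb"
    by (intro Liminf_mono always_eventually allI RM_le_Rlb assms)
  finally show "?RM D \<le> Liminf (at_right 0) ?Rlb" .
  have "Rach P1 P2 d11 d12 d21 d22 D \<le> Rach0 P1 P2 d11 d12 d21 d22 D"
    unfolding Rach_def by (rule lower_convex_envelope_le)
  also have "\<dots> \<le> ?RM D" by (rule Rach0_le_RM)
  finally show "Rach P1 P2 d11 d12 d21 d22 D \<le> ?RM D" .
qed

end
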